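(* Let $\mathcal{A}$ be a central arrangement in $\mathbb{K}^{\ell+1}$ with $\ell\ge3$ and fix $H\in\mathcal{A}$. Then $\mathcal{A}$ is free if and only if both of the following hold: (i) $\mathcal{A}$ is locally free along $H$, i.e. $\mathcal{A}_x$ is free for all $x\in H\setminus\{0\}$; (ii) the restricted multiarrangement $(\mathcal{A}^H,\mathbf{k}^H_\mathcal{A})$ is free.
   Context: $\mathbb{K}$ a field of characteristic $0$, $S$ the polynomial ring on $\mathbb{K}^{\ell+1}$; each hyperplane $H'$ has a defining linear form $\alpha_{H'}$. An arrangement $\mathcal{B}$ is free if $D(\mathcal{B})=\{\delta\in\mathrm{Der}:\delta(\alpha_{H'})\in\alpha_{H'}S\ \forall H'\in\mathcal{B}\}$ is a free $S$-module. For $x\in\mathbb{K}^{\ell+1}$, $\mathcal{A}_x=\{H'\in\mathcal{A}:x\in H'\}$. The restricted multiarrangement $(\mathcal{A}^H,\mathbf{k}^H_\mathcal{A})$ is the arrangement $\{H'\cap H:H'\in\mathcal{A}\setminus\{H\}\}$ in $H$ with multiplicity $\mathbf{k}^H_\mathcal{A}(X)=\#\{H'\in\mathcal{A}\setminus\{H\}:H'\cap H=X\}$; it is free if $D(\mathcal{A}^H,\mathbf{k})=\{\delta\in\mathrm{Der}_H:\delta(\alpha_X)\in\alpha_X^{\mathbf{k}(X)}\mathbb{K}[H]\ \forall X\}$ is a free $\mathbb{K}[H]$-module. *)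

theory Defs
  imports Main
begin

text \<open>Vectors of K^(l+1) are functions 'n => 'k from a finite index type with
CARD('n) = l+1.  The polynomial ring on a linear subspace W is realised as the
ring of polynomial functions on W (extended by 0 outside W); since K has
characteristic 0 (hence is infinite), polynomial functions on K^(l+1) are the
same as polynomials.\<close>

inductive_set polyfun :: "(('n::finite \<Rightarrow> 'k::field_char_0) \<Rightarrow> 'k) set" where
  const: "(\<lambda>x. c) \<in> polyfun"
| coord: "(\<lambda>x. x i) \<in> polyfun"
| add: "f \<in> polyfun \<Longrightarrow> g \<in> polyfun \<Longrightarrow> (\<lambda>x. f x + g x) \<in> polyfun"
| mult: "f \<in> polyfun \<Longrightarrow> g \<in> polyfun \<Longrightarrow> (\<lambda>x. f x * g x) \<in> polyfun"

definition restr :: "('n::finite \<Rightarrow> 'k::field_char_0) set \<Rightarrow> (('n \<Rightarrow> 'k) \<Rightarrow> 'k) \<Rightarrow> (('n \<Rightarrow> 'k) \<Rightarrow> 'k)" where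
  "restr W f = (\<lambda>x. if x \<in> W then f x else 0)"

definition coord_ring :: "('n::finite \<Rightarrow> 'k::field_char_0) set \<Rightarrow> (('n \<Rightarrow> 'k) \<Rightarrow> 'k) set" where
  "coord_ring W = restr W ` polyfun"

definition lin :: "('n::finite \<Rightarrow> 'k::field_char_0) \<Rightarrow> ('n \<Rightarrow> 'k) \<Rightarrow> 'k" where
  "lin a x = (\<Sum>i\<in>UNIV. a i * x i)"

definition hyp :: "('n::finite \<Rightarrow> 'k::field_char_0) \<Rightarrow> ('n \<Rightarrow> 'k) set" where
  "hyp a = {x. lin a x = 0}"

definition is_hyperplane :: "('n::finite \<Rightarrow> 'k::field_char_0) set \<Rightarrow> bool" where
  "is_hyperplane H \<longleftrightarrow> (\<exists>a. a \<noteq> (\<lambda>_. 0) \<and> H = hyp a)"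

definition is_central_arrangement :: "('n::finite \<Rightarrow> 'k::field_char_0) set set \<Rightarrow> bool" where
  "is_central_arrangement A \<longleftrightarrow> finite A \<and> (\<forall>H\<in>A. is_hyperplane H)"

definition derivations :: "('n::finite \<Rightarrow> 'k::field_char_0) set
    \<Rightarrow> ((('n \<Rightarrow> 'k) \<Rightarrow> 'k) \<Rightarrow> (('n \<Rightarrow> 'k) \<Rightarrow> 'k)) set" where
  "derivations W = {\<delta>.
     (\<forall>f. f \<notin> coord_ring W \<longrightarrow> \<delta> f = (\<lambda>x. 0)) \<and>
     (\<forall>f\<in>coord_ring W. \<delta> f \<in> coord_ring W) \<and>
     (\<forall>f\<in>coord_ring W. \<forall>g\<in>coord_ring W. \<delta> (\<lambda>x. f x + g x) = (\<lambda>x. \<delta> f x + \<delta> g x)) \<and>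
     (\<forall>c. \<forall>f\<in>coord_ring W. \<delta> (\<lambda>x. c * f x) = (\<lambda>x. c * \<delta> f x)) \<and>
     (\<forall>f\<in>coord_ring W. \<forall>g\<in>coord_ring W.
        \<delta> (\<lambda>x. f x * g x) = (\<lambda>x. f x * \<delta> g x + g x * \<delta> f x))}"

definition free_module_over :: "('n::finite \<Rightarrow> 'k::field_char_0) set
    \<Rightarrow> ((('n \<Rightarrow> 'k) \<Rightarrow> 'k) \<Rightarrow> (('n \<Rightarrow> 'k) \<Rightarrow> 'k)) set \<Rightarrow> bool" where
  "free_module_over W M \<longleftrightarrow> (\<exists>B\<subseteq>M.
     (\<forall>m\<in>M. \<exists>B' c. finite B' \<and> B' \<subseteq> B \<and> (\<forall>b\<in>B'. c b \<in> coord_ring W) \<and>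
        m = (\<lambda>f x. \<Sum>b\<in>B'. c b x * b f x)) \<and>
     (\<forall>B' c. finite B' \<and> B' \<subseteq> B \<and> (\<forall>b\<in>B'. c b \<in> coord_ring W) \<and>
        (\<lambda>f x. \<Sum>b\<in>B'. c b x * b f x) = (\<lambda>f x. 0) \<longrightarrow> (\<forall>b\<in>B'. c b = (\<lambda>x. 0))))"

definition der_module :: "('n::finite \<Rightarrow> 'k::field_char_0) set set
    \<Rightarrow> ((('n \<Rightarrow> 'k) \<Rightarrow> 'k) \<Rightarrow> (('n \<Rightarrow> 'k) \<Rightarrow> 'k)) set" where
  "der_module B = {\<delta> \<in> derivations UNIV. \<forall>H'\<in>B. \<forall>a. a \<noteq> (\<lambda>_. 0) \<and> H' = hyp a \<longrightarrow>
      (\<exists>g\<in>coord_ring UNIV. \<delta> (lin a) = (\<lambda>x. lin a x * g x))}"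

definition free_arrangement :: "('n::finite \<Rightarrow> 'k::field_char_0) set set \<Rightarrow> bool" where
  "free_arrangement B \<longleftrightarrow> free_module_over UNIV (der_module B)"

definition localization :: "('n::finite \<Rightarrow> 'k::field_char_0) set set \<Rightarrow> ('n \<Rightarrow> 'k) \<Rightarrow> ('n \<Rightarrow> 'k) set set" where
  "localization A x = {H' \<in> A. x \<in> H'}"

definition locally_free_along :: "('n::finite \<Rightarrow> 'k::field_char_0) set set \<Rightarrow> ('n \<Rightarrow> 'k) set \<Rightarrow> bool" where
  "locally_free_along A H \<longleftrightarrow> (\<forall>x \<in> H - {(\<lambda>_. 0)}. free_arrangement (localization A x))"

definition restriction :: "('n::finite \<Rightarrow> 'k::field_char_0) set set \<Rightarrow> ('n \<Rightarrow> 'k) set \<Rightarrow> ('n \<Rightarrow> 'k) set set" where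
  "restriction A H = (\<lambda>H'. H' \<inter> H) ` (A - {H})"

definition restr_mult :: "('n::finite \<Rightarrow> 'k::field_char_0) set set \<Rightarrow> ('n \<Rightarrow> 'k) set \<Rightarrow> ('n \<Rightarrow> 'k) set \<Rightarrow> nat" where
  "restr_mult A H X = card {H' \<in> A - {H}. H' \<inter> H = X}"

text \<open>D(A^H, k^H_A): the defining form alpha_X of X = H' cap H inside H is the
restriction to H of a defining form of H' (unique up to a nonzero scalar).\<close>
definition multi_der_module :: "('n::finite \<Rightarrow> 'k::field_char_0) set set \<Rightarrow> ('n \<Rightarrow> 'k) set
    \<Rightarrow> ((('n \<Rightarrow> 'k) \<Rightarrow> 'k) \<Rightarrow> (('n \<Rightarrow> 'k) \<Rightarrow> 'k)) set" where
  "multi_der_module A H = {\<delta> \<in> derivations H. \<forall>X \<in> restriction A H. \<forall>H' \<in> A - {H}. \<forall>a.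
      H' \<inter> H = X \<and> a \<noteq> (\<lambda>_. 0) \<and> H' = hyp a \<longrightarrow>
      (\<exists>g\<in>coord_ring H. \<delta> (restr H (lin a)) =
         (\<lambda>x. (restr H (lin a) x) ^ restr_mult A H X * g x))}"

definition free_restricted_multiarrangement :: "('n::finite \<Rightarrow> 'k::field_char_0) set set \<Rightarrow> ('n \<Rightarrow> 'k) set \<Rightarrow> bool" where
  "free_restricted_multiarrangement A H \<longleftrightarrow> free_module_over H (multi_der_module A H)"

end

theory Submission
  imports Defs "HOL-Computational_Algebra.Polynomial"
begin

text \<open>
  Derivations are polynomial vector fields. Let \<open>\<alpha>\<close> define \<open>H\<close>, let \<open>M\<close> be the module of logarithmic
  fields killing \<open>\<alpha>\<close>, a complement of the Euler field in \<open>D(A)\<close>, and let \<open>N\<close> be the module of the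
  restricted multiarrangement. Restriction to \<open>H\<close> embeds \<open>M / \<alpha> M\<close> into \<open>N\<close>, and by graded
  Nakayama arguments \<open>A\<close> is free if and only if \<open>N\<close> is free and the embedding is onto.

  If \<open>A\<close> is free, a field in \<open>N\<close> lifts after multiplication by the forms of all hyperplanes outside one
  class with a common trace on \<open>H\<close>; as independent linear forms are a regular sequence on
  \<open>M / \<alpha> M\<close>, these factors can be removed one at a time.

  Conversely, local freeness shows that the cokernel of the restriction is killed by powers of all
  linear forms. With \<open>F\<close> the module of fields killing \<open>\<alpha>\<close>, the module \<open>M\<close> is the kernel of
  \<open>F \<rightarrow> \<Oplus> S / \<alpha>'\<close>, \<open>\<delta> \<mapsto> \<delta>(\<alpha>')\<close>, the sum being over the other hyperplanes. The obstruction to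
  lifting is a torsion class in the cokernel \<open>L\<close> of this map. Since \<open>N\<close> is free over a polynomial ring
  in at least three variables, its first Cech cohomology vanishes, which makes every torsion class
  of \<open>L\<close> divisible by \<open>\<alpha>\<close> within the torsion; \<open>L\<close> is graded with degrees bounded below, so the torsion
  is zero.
\<close>

section \<open>Polynomial functions\<close>

text \<open>The obstacle is to recognise free modules without determinants or a theory of rank. Each
  module in question contains \<open>Q\<close> times every constant direction of its space for some
  nonzero polynomial \<open>Q\<close>, so a spanning list whose length is the dimension is
  independent wherever \<open>Q\<close> does not vanish; freeness becomes the existence of such a
  short list (\<open>generated_by\<close>). No quotient modules are formed either: a field on
  \<open>H\<close> is represented by a polynomial field on the whole space, and identities are
  asserted only at points of \<open>H\<close>. The hypothesis \<open>l \<ge> 3\<close> enters where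
  three coordinates of \<open>H\<close> have to form a regular sequence. For \<open>l = 2\<close>
  both conditions hold for every arrangement, because arrangements and multiarrangements of rank two
  are free, whereas four generic planes in 3-space are not free. Degrees replace completeness: an
  equation modulo \<open>\<alpha> ^ N\<close>, with \<open>N\<close> above all degrees involved, is
  exact in those degrees.\<close>

lemma polyfun_sum [intro]:
  "(\<And>i. i \<in> I \<Longrightarrow> (\<lambda>x. f i x) \<in> polyfun) \<Longrightarrow> (\<lambda>x. \<Sum>i\<in>I. f i x) \<in> polyfun"
proof (induction I rule: infinite_finite_induct)
  case (insert i I)
  then show ?case by (simp add: polyfun.add)
qed (simp_all add: polyfun.const)

lemma polyfun_prod [intro]:
  "(\<And>i. i \<in> I \<Longrightarrow> (\<lambda>x. f i x) \<in> polyfun) \<Longrightarrow> (\<lambda>x. \<Prod>i\<in>I. f i x) \<in> polyfun"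
proof (induction I rule: infinite_finite_induct)
  case (insert i I)
  then show ?case by (simp add: polyfun.mult)
qed (simp_all add: polyfun.const)

lemma polyfun_power [intro]: "f \<in> polyfun \<Longrightarrow> (\<lambda>x. f x ^ k) \<in> polyfun"
  by (induction k) (simp_all add: polyfun.const polyfun.mult)

lemma polyfun_uminus [intro]:
  assumes "f \<in> polyfun" shows "(\<lambda>x. - f x) \<in> polyfun"
  using polyfun.mult [OF polyfun.const [of "-1"] assms] by simp

lemma polyfun_diff [intro]: "f \<in> polyfun \<Longrightarrow> g \<in> polyfun \<Longrightarrow> (\<lambda>x. f x - g x) \<in> polyfun"
  using polyfun.add [of f "\<lambda>x. - g x"] by (simp add: polyfun_uminus)

lemma polyfun_lin [intro]: "lin a \<in> polyfun"
  unfolding lin_def by (intro polyfun_sum polyfun.mult polyfun.const polyfun.coord)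

lemmas polyfun_intros = polyfun_sum polyfun_prod polyfun_power polyfun_uminus polyfun_diff
  polyfun_lin polyfun.const polyfun.coord polyfun.add polyfun.mult

section \<open>Polynomial maps and linear forms\<close>

definition polymap :: "(('n::finite \<Rightarrow> 'k::field_char_0) \<Rightarrow> 'i \<Rightarrow> 'k) \<Rightarrow> bool" where
  "polymap V \<longleftrightarrow> (\<forall>i. (\<lambda>x. V x i) \<in> polyfun)"

lemma polymapD: "polymap V \<Longrightarrow> (\<lambda>x. V x i) \<in> polyfun"
  by (simp add: polymap_def)

lemma polyfun_compose:
  assumes "f \<in> polyfun" "polymap V" shows "(\<lambda>x. f (V x)) \<in> polyfun"
  using assms(1)
  by induction (use assms(2) in \<open>auto simp: polymap_def intro: polyfun_intros\<close>)

lemma lin_polymap: "polymap V \<Longrightarrow> (\<lambda>x. lin b (V x)) \<in> polyfun"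
  using polyfun_compose [OF polyfun_lin] .

lemma lin_add: "lin a (\<lambda>i. x i + y i) = lin a x + lin a y"
  by (simp add: lin_def algebra_simps sum.distrib)

lemma lin_diff: "lin a (\<lambda>i. x i - y i) = lin a x - lin a y"
  by (simp add: lin_def algebra_simps sum_subtractf)

lemma lin_scale: "lin a (\<lambda>i. c * x i) = c * lin a x"
  by (simp add: lin_def sum_distrib_left mult.left_commute)

lemma lin_sum: "lin a (\<lambda>i. \<Sum>j\<in>J. x j i) = (\<Sum>j\<in>J. lin a (x j))"
proof -
  have "lin a (\<lambda>i. \<Sum>j\<in>J. x j i) = (\<Sum>i\<in>UNIV. \<Sum>j\<in>J. a i * x j i)"
    by (simp add: lin_def sum_distrib_left)
  also have "\<dots> = (\<Sum>j\<in>J. lin a (x j))"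
    by (subst sum.swap) (simp add: lin_def)
  finally show ?thesis .
qed

lemma lin_zero [simp]: "lin a (\<lambda>_. 0) = 0"
  by (simp add: lin_def)

lemma lin_eq_zero_iff: "(\<forall>x. lin a x = 0) \<longleftrightarrow> a = (\<lambda>_. 0)"
proof
  assume *: "\<forall>x. lin a x = 0"
  show "a = (\<lambda>_. 0)"
  proof
    fix i
    have "lin a (\<lambda>j. if j = i then 1 else 0) = a i"
      by (simp add: lin_def if_distrib cong: if_cong)
    then show "a i = 0" using * by simp
  qed
qed (simp add: lin_def)

section \<open>Linear subspaces and proportional linear forms\<close>

definition subsp :: "('n::finite \<Rightarrow> 'k::field_char_0) set \<Rightarrow> bool" where
  "subsp W \<longleftrightarrow> (\<lambda>_. 0) \<in> W \<and> (\<forall>x\<in>W. \<forall>y\<in>W. \<forall>s t. (\<lambda>i. s * x i + t * y i) \<in> W)"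

lemma subsp_zero: "subsp W \<Longrightarrow> (\<lambda>_. 0) \<in> W"
  by (simp add: subsp_def)

lemma subsp_comb: "subsp W \<Longrightarrow> x \<in> W \<Longrightarrow> y \<in> W \<Longrightarrow> (\<lambda>i. s * x i + t * y i) \<in> W"
  by (simp add: subsp_def)

lemma subsp_scale: "subsp W \<Longrightarrow> x \<in> W \<Longrightarrow> (\<lambda>i. s * x i) \<in> W"
  using subsp_comb [of W x x s 0] by simp

lemma subsp_line: "subsp W \<Longrightarrow> x \<in> W \<Longrightarrow> y \<in> W \<Longrightarrow> (\<lambda>i. x i + t * y i) \<in> W"
  using subsp_comb [of W x y 1 t] by simp

lemma subsp_minus: "subsp W \<Longrightarrow> x \<in> W \<Longrightarrow> y \<in> W \<Longrightarrow> (\<lambda>i. x i - t * y i) \<in> W"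
  using subsp_comb [of W x y 1 "-t"] by simp

lemma subsp_sum:
  assumes "subsp W" "\<And>j. j \<in> J \<Longrightarrow> v j \<in> W"
  shows "(\<lambda>i. \<Sum>j\<in>J. c j * v j i) \<in> W"
  using assms(2)
proof (induction J rule: infinite_finite_induct)
  case (insert j J)
  then have "v j \<in> W" "(\<lambda>i. \<Sum>j\<in>J. c j * v j i) \<in> W" by auto
  from subsp_comb [OF assms(1) this, of "c j" 1] show ?case
    using insert by simp
qed (simp_all add: subsp_zero assms)

lemma subsp_UNIV [simp]: "subsp UNIV"
  by (simp add: subsp_def)

lemma subsp_hyp [simp]: "subsp (hyp a)"
  by (simp add: subsp_def hyp_def lin_add lin_scale)

lemma subsp_Int: "subsp V \<Longrightarrow> subsp W \<Longrightarrow> subsp (V \<inter> W)"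
  by (simp add: subsp_def)

lemma subsp_INT: "(\<And>j. j \<in> J \<Longrightarrow> subsp (W j)) \<Longrightarrow> subsp (\<Inter>j\<in>J. W j)"
  by (simp add: subsp_def)

text \<open>Subtracting a suitable multiple of a fixed \<open>v\<close> in \<open>W\<close> with
  \<open>lin b v \<noteq> 0\<close> moves \<open>x\<close> into the kernel of \<open>b\<close>,
  where \<open>b'\<close> vanishes too. If \<open>b\<close> is zero on \<open>W\<close>, so is
  \<open>b'\<close>.\<close>

lemma lin_proportional:
  assumes W: "subsp W" and *: "\<And>x. x \<in> W \<Longrightarrow> lin b x = 0 \<Longrightarrow> lin b' x = 0"
  shows "\<exists>c. \<forall>x\<in>W. lin b' x = c * lin b x"
proof (cases "\<exists>v\<in>W. lin b v \<noteq> 0")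
  case True
  then obtain v where v: "v \<in> W" "lin b v \<noteq> 0" by auto
  show ?thesis
  proof (intro exI ballI)
    fix x assume x: "x \<in> W"
    define s where "s = lin b x / lin b v"
    have "(\<lambda>i. x i - s * v i) \<in> W" using W x v(1) by (rule subsp_minus)
    moreover have "lin b (\<lambda>i. x i - s * v i) = 0"
      unfolding lin_diff lin_scale using v by (simp add: s_def)
    ultimately have "lin b' (\<lambda>i. x i - s * v i) = 0" by (rule *)
    then show "lin b' x = (lin b' v / lin b v) * lin b x"
      unfolding lin_diff lin_scale using v by (simp add: s_def field_simps)
  qed
next
  case False
  then show ?thesis using * by (metis mult_zero_right)
qed

lemma hyp_subset_imp_eq:
  assumes "b \<noteq> (\<lambda>_. 0)" "hyp a \<subseteq> hyp b"
  shows "hyp a = hyp b"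
proof -
  have "\<exists>c. \<forall>x\<in>UNIV. lin b x = c * lin a x"
    by (rule lin_proportional) (use assms in \<open>auto simp: hyp_def\<close>)
  then obtain c where c: "\<And>x. lin b x = c * lin a x" by auto
  with assms(1) have "c \<noteq> 0" using lin_eq_zero_iff [of b] by auto
  with c show ?thesis by (auto simp: hyp_def)
qed

subsection \<open>Restriction to lines\<close>

lemma poly_unique:
  assumes "\<And>t. poly p t = poly q (t :: 'k::field_char_0)" shows "p = q"
  using assms poly_eq_poly_eq_iff by blast

text \<open>Elements of \<open>polyfun\<close> are bare functions and carry no coefficients. The
  univariate polynomial along a line, unique because the field is infinite, supplies them: lines
  through the origin give homogeneous components, the linear coefficient gives derivatives.\<close>

definition linepoly :: "(('n::finite \<Rightarrow> 'k::field_char_0) \<Rightarrow> 'k) \<Rightarrow> ('n \<Rightarrow> 'k) \<Rightarrow> ('n \<Rightarrow> 'k) \<Rightarrow> 'k poly" where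
  "linepoly f x v = (THE p. \<forall>t. poly p t = f (\<lambda>i. x i + t * v i))"

lemma linepoly_eqI:
  assumes "\<And>t. poly p t = f (\<lambda>i. x i + t * v i)" shows "linepoly f x v = p"
  unfolding linepoly_def
  by (rule the_equality) (use assms in \<open>auto intro: poly_unique\<close>)

lemma poly_linepoly:
  assumes "f \<in> polyfun"
  shows "poly (linepoly f x v) t = f (\<lambda>i. x i + t * v i)"
proof -
  have "\<exists>p. \<forall>t. poly p t = f (\<lambda>i. x i + t * v i)"
    using assms
  proof induction
    case (const c) then show ?case by (intro exI [of _ "[:c:]"]) simp
  next
    case (coord i) then show ?case by (intro exI [of _ "[:x i, v i:]"]) simp
  next
    case (add f g) then show ?case by (metis poly_add)
  next
    case (mult f g) then show ?case by (metis poly_mult)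
  qed
  then obtain p where "\<And>t. poly p t = f (\<lambda>i. x i + t * v i)" by auto
  with linepoly_eqI [of p f x v] show ?thesis by simp
qed

lemma linepoly_const [simp]: "linepoly (\<lambda>x. c) x v = [:c:]"
  by (rule linepoly_eqI) simp

lemma linepoly_coord [simp]: "linepoly (\<lambda>x. x i) x v = [:x i, v i:]"
  by (rule linepoly_eqI) simp

lemma linepoly_add:
  "f \<in> polyfun \<Longrightarrow> g \<in> polyfun \<Longrightarrow> linepoly (\<lambda>x. f x + g x) x v = linepoly f x v + linepoly g x v"
  by (rule linepoly_eqI) (simp add: poly_linepoly)

lemma linepoly_mult:
  "f \<in> polyfun \<Longrightarrow> g \<in> polyfun \<Longrightarrow> linepoly (\<lambda>x. f x * g x) x v = linepoly f x v * linepoly g x v"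
  by (rule linepoly_eqI) (simp add: poly_linepoly)

lemma linepoly_cong:
  assumes "subsp W" "x \<in> W" "v \<in> W" "\<And>x. x \<in> W \<Longrightarrow> f x = g x"
  shows "linepoly f x v = linepoly g x v"
  using assms by (simp add: linepoly_def subsp_line)

text \<open>Restriction to the line through \<open>x\<close> and \<open>y\<close> reduces the claim
  to nonzero univariate polynomials, whose product is not zero at every scalar. This is the
  integrality of the coordinate ring of \<open>W\<close>, on which all later cancellations
  rest.\<close>

lemma polyfun_domain:
  assumes W: "subsp W" and f: "f \<in> polyfun" and g: "g \<in> polyfun"
    and x: "x \<in> W" "f x \<noteq> 0" and y: "y \<in> W" "g y \<noteq> 0"
  shows "\<exists>z\<in>W. f z \<noteq> 0 \<and> g z \<noteq> 0"
proof -
  define v where "v = (\<lambda>i. y i - x i)"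
  have v: "v \<in> W" using subsp_minus [OF W y(1) x(1), of 1] by (simp add: v_def)
  have "poly (linepoly f x v) 0 \<noteq> 0" "poly (linepoly g x v) 1 \<noteq> 0"
    using x y by (simp_all add: poly_linepoly f g v_def)
  then have "linepoly f x v * linepoly g x v \<noteq> 0" by auto
  then obtain t where "poly (linepoly f x v * linepoly g x v) t \<noteq> 0"
    using poly_all_0_iff_0 by blast
  then show ?thesis
    using subsp_line [OF W x(1) v, of t] by (auto simp: poly_linepoly f g)
qed

lemma polyfun_cancel:
  assumes "subsp W" "f \<in> polyfun" "g \<in> polyfun" "\<exists>x\<in>W. f x \<noteq> 0"
    and "\<And>x. x \<in> W \<Longrightarrow> f x * g x = 0" and "x \<in> W"
  shows "g x = 0"
  using polyfun_domain [OF assms(1-3)] assms(4-6) by fastforce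

lemma polyfun_prod_nonzero:
  assumes "subsp W" "finite I" "W \<noteq> {}"
    and "\<And>i. i \<in> I \<Longrightarrow> (\<lambda>x. f i x) \<in> polyfun" "\<And>i. i \<in> I \<Longrightarrow> \<exists>x\<in>W. f i x \<noteq> 0"
  shows "\<exists>x\<in>W. (\<Prod>i\<in>I. f i x) \<noteq> 0"
  using assms(2,4,5)
proof (induction I)
  case empty then show ?case using assms(3) by auto
next
  case (insert i I)
  have "\<exists>x\<in>W. (\<Prod>i\<in>I. f i x) \<noteq> 0" using insert by auto
  then obtain x where "x \<in> W" "(\<Prod>i\<in>I. f i x) \<noteq> 0" by auto
  moreover obtain y where "y \<in> W" "f i y \<noteq> 0" using insert.prems(2) by blast
  moreover have "(\<lambda>x. \<Prod>i\<in>I. f i x) \<in> polyfun" "f i \<in> polyfun" using insert.prems by auto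
  ultimately obtain z where "z \<in> W" "(\<Prod>i\<in>I. f i z) \<noteq> 0" "f i z \<noteq> 0"
    using polyfun_domain [OF assms(1)] by blast
  then show ?case using insert.hyps by (intro bexI [of _ z]) auto
qed

subsection \<open>Divisibility by linear forms\<close>

text \<open>Modulo \<open>lin y\<close> the substitution of \<open>x - lin y x * v\<close> for
  \<open>x\<close> is the identity, which sums and products preserve. For \<open>lin y v = 1\<close>
  the substitution is the projection onto the kernel of \<open>y\<close>, so this is division by
  \<open>lin y\<close> with remainder.\<close>

lemma polyfun_shift:
  assumes "f \<in> polyfun"
  shows "\<exists>g\<in>polyfun. \<forall>x. f x = f (\<lambda>i. x i - lin y x * v i) + lin y x * g x"
  using assms
proof induction
  case (const c) then show ?case by (intro bexI [of _ "\<lambda>x. 0"]) (auto intro: polyfun_intros)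
next
  case (coord i) then show ?case by (intro bexI [of _ "\<lambda>x. v i"]) (auto intro: polyfun_intros)
next
  case (add f1 f2)
  then obtain g1 g2 where g: "g1 \<in> polyfun" "g2 \<in> polyfun"
    and 1: "\<And>x. f1 x = f1 (\<lambda>i. x i - lin y x * v i) + lin y x * g1 x"
    and 2: "\<And>x. f2 x = f2 (\<lambda>i. x i - lin y x * v i) + lin y x * g2 x" by blast
  have "f1 x + f2 x = f1 (\<lambda>i. x i - lin y x * v i) + f2 (\<lambda>i. x i - lin y x * v i)
      + lin y x * (g1 x + g2 x)" for x
    by (subst 1, subst 2) (simp add: distrib_left)
  then show ?case by (intro bexI [OF _ polyfun.add [OF g]]) blast
next
  case (mult f1 f2)
  then obtain g1 g2 where g: "g1 \<in> polyfun" "g2 \<in> polyfun"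
    and 1: "\<And>x. f1 x = f1 (\<lambda>i. x i - lin y x * v i) + lin y x * g1 x"
    and 2: "\<And>x. f2 x = f2 (\<lambda>i. x i - lin y x * v i) + lin y x * g2 x" by blast
  let ?P = "\<lambda>x i. x i - lin y x * v i"
  let ?G = "\<lambda>x. g1 x * f2 x + f1 (?P x) * g2 x"
  have "polymap ?P" unfolding polymap_def by (intro allI polyfun_intros)
  then have "(\<lambda>x. f1 (?P x)) \<in> polyfun" using mult.hyps(1) by (rule polyfun_compose [rotated])
  then have "?G \<in> polyfun"
    using g mult.hyps by (intro polyfun_intros)
  moreover have "\<forall>x. f1 x * f2 x = f1 (?P x) * f2 (?P x) + lin y x * (g1 x * f2 x + f1 (?P x) * g2 x)"
  proof
    fix x
    have "f1 x * f2 x = f1 (?P x) * f2 x + lin y x * g1 x * f2 x"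
      by (subst 1) (simp add: algebra_simps)
    also have "f1 (?P x) * f2 x = f1 (?P x) * f2 (?P x) + f1 (?P x) * (lin y x * g2 x)"
      by (subst 2) (simp add: algebra_simps)
    finally show "f1 x * f2 x = f1 (?P x) * f2 (?P x) + lin y x * (g1 x * f2 x + f1 (?P x) * g2 x)"
      by (simp add: algebra_simps)
  qed
  ultimately show ?case by (intro bexI [of _ ?G])
qed

text \<open>With \<open>v\<close> in \<open>W\<close> scaled to \<open>lin y v = 1\<close>, the
  remainder of the division along \<open>v\<close> is a value of \<open>f\<close> at a point of
  \<open>W\<close> in the kernel of \<open>y\<close>, hence zero. The quotient is a polynomial on
  the whole space, but the identity holds on \<open>W\<close> only.\<close>

lemma lin_dvd:
  assumes W: "subsp W" and f: "f \<in> polyfun"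
    and 0: "\<And>x. x \<in> W \<Longrightarrow> lin y x = 0 \<Longrightarrow> f x = 0"
  shows "\<exists>g\<in>polyfun. \<forall>x\<in>W. f x = lin y x * g x"
proof (cases "\<exists>v\<in>W. lin y v \<noteq> 0")
  case True
  then obtain u where u: "u \<in> W" "lin y u \<noteq> 0" by auto
  define v where "v = (\<lambda>i. (1 / lin y u) * u i)"
  have v: "v \<in> W" "lin y v = 1"
    using u subsp_scale [OF W u(1)] by (simp_all only: v_def lin_scale) simp
  obtain g where g: "g \<in> polyfun" "\<And>x. f x = f (\<lambda>i. x i - lin y x * v i) + lin y x * g x"
    using polyfun_shift [OF f] by blast
  have "f x = lin y x * g x" if "x \<in> W" for x
  proof -
    have "f (\<lambda>i. x i - lin y x * v i) = 0"
      by (rule 0) (use that v W in \<open>auto simp: subsp_minus lin_diff lin_scale\<close>)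
    with g(2) [of x] show ?thesis by simp
  qed
  with g(1) show ?thesis by blast
next
  case False
  then show ?thesis using 0 by (intro bexI [of _ "\<lambda>x. 0"]) (auto intro: polyfun_intros)
qed

text \<open>A Nullstellensatz for linear equations. On the common kernel of the forms in
  \<open>Z\<close> one division by \<open>b k\<close> suffices; the difference vanishes on that
  kernel, so the induction hypothesis applies to it.\<close>

lemma lin_dvd_sum:
  assumes "finite Z" and W: "subsp W" and f: "f \<in> polyfun"
    and 0: "\<And>x. x \<in> W \<Longrightarrow> (\<And>j. j \<in> Z \<Longrightarrow> lin (b j) x = 0) \<Longrightarrow> f x = 0"
  shows "\<exists>g. (\<forall>j\<in>Z. g j \<in> polyfun) \<and> (\<forall>x\<in>W. f x = (\<Sum>j\<in>Z. lin (b j) x * g j x))"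
  using assms(1) f 0
proof (induction Z arbitrary: f)
  case empty
  then show ?case by auto
next
  case (insert k Z)
  let ?W = "W \<inter> (\<Inter>j\<in>Z. hyp (b j))"
  have "subsp ?W" by (intro subsp_Int subsp_INT W) simp
  then obtain g where g: "g \<in> polyfun" "\<forall>x\<in>?W. f x = lin (b k) x * g x"
    using lin_dvd [of ?W f "b k"] insert.prems by (simp add: hyp_def) metis
  have "(\<lambda>x. f x - lin (b k) x * g x) \<in> polyfun"
    using g insert.prems by (intro polyfun_intros)
  then obtain h where h: "\<forall>j\<in>Z. h j \<in> polyfun"
      "\<forall>x\<in>W. f x - lin (b k) x * g x = (\<Sum>j\<in>Z. lin (b j) x * h j x)"
    using insert.IH [of "\<lambda>x. f x - lin (b k) x * g x"] g by (auto simp: hyp_def)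
  have "\<forall>x\<in>W. f x = (\<Sum>j\<in>insert k Z. lin (b j) x * (h(k := g)) j x)"
  proof
    fix x assume "x \<in> W"
    have "(\<Sum>j\<in>Z. lin (b j) x * (h(k := g)) j x) = (\<Sum>j\<in>Z. lin (b j) x * h j x)"
      by (rule sum.cong) (use insert.hyps in auto)
    with \<open>x \<in> W\<close> h(2) insert.hyps
    show "f x = (\<Sum>j\<in>insert k Z. lin (b j) x * (h(k := g)) j x)"
      by (simp add: algebra_simps)
  qed
  moreover have "\<forall>j\<in>insert k Z. (h(k := g)) j \<in> polyfun" using h g by auto
  ultimately show ?case by blast
qed

text \<open>Since \<open>s\<close> does not vanish identically on the kernel of \<open>y\<close> in
  \<open>W\<close>, it is a non-zero-divisor modulo \<open>lin y\<close> and hence modulo its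
  powers: one factor \<open>lin y\<close> after the other is split off \<open>f\<close> and
  cancelled.\<close>

lemma lin_power_regular:
  assumes W: "subsp W" and f: "f \<in> polyfun" and g: "g \<in> polyfun" and s: "s \<in> polyfun"
    and s0: "\<exists>x\<in>W. lin y x = 0 \<and> s x \<noteq> 0"
    and eq: "\<And>x. x \<in> W \<Longrightarrow> s x * f x = lin y x ^ j * g x"
    and y0: "\<exists>x\<in>W. lin y x \<noteq> 0"
  shows "\<exists>u\<in>polyfun. \<forall>x\<in>W. f x = lin y x ^ j * u x"
  using f eq
proof (induction j arbitrary: f)
  case 0
  then show ?case by (intro bexI [of _ f]) auto
next
  case (Suc j)
  have "subsp (W \<inter> hyp y)" by (simp add: W subsp_Int)
  then have "f x = 0" if "x \<in> W \<inter> hyp y" for x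
    by (rule polyfun_cancel [OF _ s Suc.prems(1)]) (use s0 Suc.prems(2) that in \<open>auto simp: hyp_def\<close>)
  then obtain f' where f': "f' \<in> polyfun" "\<forall>x\<in>W. f x = lin y x * f' x"
    using lin_dvd [OF W Suc.prems(1), of y] by (auto simp: hyp_def)
  have "s x * f' x = lin y x ^ j * g x" if x: "x \<in> W" for x
  proof -
    have "s x * f' x - lin y x ^ j * g x = 0"
      by (rule polyfun_cancel [OF W polyfun_lin _ y0 _ x])
        (use f' g s Suc.prems(2) in \<open>auto intro!: polyfun_intros simp: algebra_simps\<close>)
    then show ?thesis by simp
  qed
  from Suc.IH [OF f'(1) this] obtain u where "u \<in> polyfun" "\<forall>x\<in>W. f' x = lin y x ^ j * u x" by auto
  with f' show ?case by (intro bexI [of _ u]) auto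
qed

subsection \<open>Homogeneous components\<close>

text \<open>The coefficient of \<open>t ^ d\<close> in \<open>f(t x)\<close>, which yields the
  homogeneous component without reference to monomials.\<close>

definition comp :: "nat \<Rightarrow> (('n::finite \<Rightarrow> 'k::field_char_0) \<Rightarrow> 'k) \<Rightarrow> ('n \<Rightarrow> 'k) \<Rightarrow> 'k" where
  "comp d f x = coeff (linepoly f (\<lambda>_. 0) x) d"

definition hom :: "nat \<Rightarrow> (('n::finite \<Rightarrow> 'k::field_char_0) \<Rightarrow> 'k) \<Rightarrow> bool" where
  "hom d f \<longleftrightarrow> (\<forall>t x. f (\<lambda>i. t * x i) = t ^ d * f x)"

lemma comp_const: "comp d (\<lambda>_. c) x = (if d = 0 then c else 0)"
  by (simp add: comp_def coeff_pCons split: nat.split)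

lemma comp_coord: "comp d (\<lambda>x. x i) x = (if d = 1 then x i else 0)"
  by (simp add: comp_def coeff_pCons split: nat.split)

lemma comp_add:
  "f \<in> polyfun \<Longrightarrow> g \<in> polyfun \<Longrightarrow> comp d (\<lambda>x. f x + g x) x = comp d f x + comp d g x"
  by (simp add: comp_def linepoly_add)

lemma comp_mult:
  "f \<in> polyfun \<Longrightarrow> g \<in> polyfun \<Longrightarrow> comp d (\<lambda>x. f x * g x) x = (\<Sum>s\<le>d. comp s f x * comp (d - s) g x)"
  by (simp add: comp_def linepoly_mult coeff_mult)

lemma comp_scale:
  assumes "f \<in> polyfun" shows "comp d (\<lambda>x. c * f x) x = c * comp d f x"
proof -
  have "linepoly (\<lambda>x. c * f x) (\<lambda>_. 0) x = smult c (linepoly f (\<lambda>_. 0) x)"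
    using assms by (simp add: linepoly_mult polyfun.const)
  then show ?thesis by (simp add: comp_def)
qed

lemma comp_sum:
  "(\<And>j. j \<in> J \<Longrightarrow> (\<lambda>x. f j x) \<in> polyfun) \<Longrightarrow> comp d (\<lambda>x. \<Sum>j\<in>J. f j x) x = (\<Sum>j\<in>J. comp d (f j) x)"
proof (induction J rule: infinite_finite_induct)
  case (insert j J)
  then have "(\<lambda>x. \<Sum>j\<in>J. f j x) \<in> polyfun" "f j \<in> polyfun" by auto
  then show ?case using insert by (simp add: comp_add)
qed (simp_all add: comp_const)

lemma comp_polyfun: "f \<in> polyfun \<Longrightarrow> comp d f \<in> polyfun"
proof (induction arbitrary: d rule: polyfun.induct)
  case (const c)
  show ?case unfolding comp_const [abs_def] by (rule polyfun.const)
next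
  case (coord i)
  show ?case unfolding comp_coord [abs_def] by (cases "d = 1") (auto intro: polyfun.const polyfun.coord)
next
  case (add f g)
  have "comp d (\<lambda>x. f x + g x) = (\<lambda>x. comp d f x + comp d g x)"
    using add.hyps by (auto simp: comp_add)
  then show ?case using add.IH by (simp add: polyfun.add)
next
  case (mult f g)
  have "comp d (\<lambda>x. f x * g x) = (\<lambda>x. \<Sum>s\<le>d. comp s f x * comp (d - s) g x)"
    using mult.hyps by (auto simp: comp_mult)
  moreover have "(\<lambda>x. \<Sum>s\<le>d. comp s f x * comp (d - s) g x) \<in> polyfun"
    by (intro polyfun_sum polyfun.mult mult.IH)
  ultimately show ?case by simp
qed

lemma comp_bounded:
  assumes "f \<in> polyfun" shows "\<exists>N. \<forall>d\<ge>N. \<forall>x. comp d f x = 0"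
  using assms
proof induction
  case (const c)
  show ?case by (intro exI [of _ 1]) (simp add: comp_const)
next
  case (coord i)
  show ?case by (intro exI [of _ 2]) (simp add: comp_coord)
next
  case (add f g)
  then obtain M N where "\<forall>d\<ge>M. \<forall>x. comp d f x = 0" "\<forall>d\<ge>N. \<forall>x. comp d g x = 0" by auto
  then show ?case using add.hyps by (intro exI [of _ "max M N"]) (simp add: comp_add)
next
  case (mult f g)
  then obtain M N where MN: "\<forall>d\<ge>M. \<forall>x. comp d f x = 0" "\<forall>d\<ge>N. \<forall>x. comp d g x = 0" by auto
  have "comp d (\<lambda>x. f x * g x) x = 0" if "d \<ge> M + N" for d x
    unfolding comp_mult [OF mult.hyps]
  proof (rule sum.neutral, rule ballI)
    fix s
    have "s \<ge> M \<or> d - s \<ge> N" using that by linarith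
    with MN show "comp s f x * comp (d - s) g x = 0" by auto
  qed
  then show ?case by blast
qed

lemma sum_comp:
  assumes f: "f \<in> polyfun" and N: "\<And>d. d \<ge> N \<Longrightarrow> comp d f x = 0"
  shows "(\<Sum>d<N. comp d f x) = f x"
proof -
  let ?p = "linepoly f (\<lambda>_. 0) x"
  have "f x = poly ?p 1" by (simp add: poly_linepoly f)
  also have "\<dots> = (\<Sum>d\<le>degree ?p. coeff ?p d)" by (simp add: poly_altdef)
  also have "\<dots> = (\<Sum>d<N. coeff ?p d)"
  proof (rule sum.mono_neutral_cong)
    show "coeff ?p d = 0" if "d \<in> {..<N} - {..degree ?p}" for d
      using that by (simp add: coeff_eq_0)
    show "coeff ?p d = 0" if "d \<in> {..degree ?p} - {..<N}" for d
      using that N [of d] by (simp add: comp_def)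
  qed auto
  finally show ?thesis by (simp add: comp_def)
qed

lemma comp_cong:
  assumes "subsp W" "x \<in> W" "\<And>x. x \<in> W \<Longrightarrow> f x = g x"
  shows "comp d f x = comp d g x"
  unfolding comp_def using linepoly_cong [OF assms(1) subsp_zero [OF assms(1)] assms(2,3)] by simp

lemma comp_zero_apply: "f \<in> polyfun \<Longrightarrow> comp 0 f x = f (\<lambda>_. 0)"
  using poly_linepoly [of f "\<lambda>_. 0" x 0] by (simp add: comp_def poly_0_coeff_0)

lemma hom_comp: assumes "f \<in> polyfun" shows "hom d (comp d f)"
  unfolding hom_def
proof (intro allI)
  fix t :: 'b and x :: "'a \<Rightarrow> 'b"
  have "linepoly f (\<lambda>_. 0) (\<lambda>i. t * x i) = pcompose (linepoly f (\<lambda>_. 0) x) [:0, t:]"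
    by (rule linepoly_eqI) (simp add: poly_pcompose poly_linepoly assms mult.assoc)
  then show "comp d f (\<lambda>i. t * x i) = t ^ d * comp d f x"
    by (simp add: comp_def coeff_pcompose_linear)
qed

lemma comp_mult_hom:
  assumes "c \<in> polyfun" "h \<in> polyfun" "hom d h"
  shows "comp e (\<lambda>x. c x * h x) x = (if e < d then 0 else comp (e - d) c x * h x)"
proof -
  have "linepoly h (\<lambda>_. 0) x = monom (h x) d"
    by (rule linepoly_eqI) (use assms(3) in \<open>simp add: poly_monom hom_def mult.commute\<close>)
  then have "linepoly (\<lambda>x. c x * h x) (\<lambda>_. 0) x = monom (h x) d * linepoly c (\<lambda>_. 0) x"
    using assms by (simp add: linepoly_mult mult.commute)
  then show ?thesis by (simp add: comp_def coeff_monom_mult mult.commute)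
qed

lemma hom_lin_power: "hom d (\<lambda>x. lin y x ^ d)"
  by (simp add: hom_def lin_scale power_mult_distrib)

text \<open>Graded by the polynomial degree of the coefficient functions, so the Euler field has
  degree 1 and applying a constant linear form to a field preserves degrees.\<close>

definition vcomp :: "nat \<Rightarrow> (('n::finite \<Rightarrow> 'k::field_char_0) \<Rightarrow> 'n \<Rightarrow> 'k) \<Rightarrow> ('n \<Rightarrow> 'k) \<Rightarrow> 'n \<Rightarrow> 'k" where
  "vcomp d V x i = comp d (\<lambda>x. V x i) x"

lemma polymap_vcomp: "polymap V \<Longrightarrow> polymap (vcomp d V)"
  by (simp add: polymap_def vcomp_def comp_polyfun)

lemma lin_vcomp:
  assumes "polymap V" shows "lin b (vcomp d V x) = comp d (\<lambda>x. lin b (V x)) x"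
proof -
  have "comp d (\<lambda>x. \<Sum>i\<in>UNIV. b i * V x i) x = (\<Sum>i\<in>UNIV. b i * comp d (\<lambda>x. V x i) x)"
    using assms by (subst comp_sum) (auto simp: comp_scale polymap_def intro: polyfun_intros)
  then show ?thesis by (simp add: lin_def vcomp_def)
qed

lemma vcomp_bounded:
  fixes V :: "('n::finite \<Rightarrow> 'k::field_char_0) \<Rightarrow> 'n \<Rightarrow> 'k"
  assumes "polymap V" shows "\<exists>N. \<forall>d\<ge>N. \<forall>x i. vcomp d V x i = 0"
proof -
  have "\<exists>N. \<forall>d\<ge>N. \<forall>x. comp d (\<lambda>x. V x i) x = 0" for i
    using assms by (simp add: comp_bounded polymap_def)
  then obtain N where N: "\<And>i d x. d \<ge> N i \<Longrightarrow> comp d (\<lambda>x. V x i) x = 0" by metis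
  have "vcomp d V x i = 0" if "d \<ge> Max (range N)" for d x i
  proof -
    have "N i \<le> Max (range N)" by simp
    with that N show ?thesis by (simp add: vcomp_def)
  qed
  then show ?thesis by blast
qed

lemma comp_cong_vanish:
  assumes "subsp W" "x \<in> W" "\<And>x. x \<in> W \<Longrightarrow> f x = 0"
  shows "comp d f x = 0"
  using comp_cong [OF assms(1,2), of f "\<lambda>x. 0" d] assms(3) by (simp add: comp_const)

section \<open>Linear algebra\<close>

text \<open>Gaussian elimination: a nonzero entry \<open>u p j\<close> removes the unknown
  \<open>p\<close> together with the equation \<open>j\<close>. All dimension counts below rest on
  this.\<close>

lemma underdetermined_system:
  fixes u :: "'i \<Rightarrow> 'j \<Rightarrow> 'k::field"
  assumes "finite J" "finite I" "card J < card I"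
  shows "\<exists>a. (\<exists>i\<in>I. a i \<noteq> 0) \<and> (\<forall>j\<in>J. (\<Sum>i\<in>I. a i * u i j) = 0)"
  using assms
proof (induction J arbitrary: I u)
  case empty
  then obtain i where "i \<in> I" by fastforce
  then show ?case by (intro exI [of _ "\<lambda>_. 1"]) auto
next
  case (insert j J)
  show ?case
  proof (cases "\<forall>i\<in>I. u i j = 0")
    case True
    have "card J < card I" using insert by simp
    with insert.IH [OF insert.prems(1)] True show ?thesis by fastforce
  next
    case False
    then obtain p where p: "p \<in> I" "u p j \<noteq> 0" by auto
    define w where "w i k = u i k - u i j / u p j * u p k" for i k
    have "card J < card (I - {p})" using insert p by simp
    then obtain a where a: "\<exists>i\<in>I - {p}. a i \<noteq> 0" "\<And>k. k \<in> J \<Longrightarrow> (\<Sum>i\<in>I - {p}. a i * w i k) = 0"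
      using insert.IH [of "I - {p}" w] insert.prems by auto
    \<comment> \<open>The value at \<open>p\<close> is chosen to solve the eliminated equation
      \<open>j\<close>.\<close>
    define b where "b i = (if i = p then - (\<Sum>i\<in>I - {p}. a i * u i j) / u p j else a i)" for i
    have b: "(\<Sum>i\<in>I. b i * u i k) = (\<Sum>i\<in>I - {p}. a i * w i k)" for k
    proof -
      have "(\<Sum>i\<in>I. b i * u i k) = b p * u p k + (\<Sum>i\<in>I - {p}. b i * u i k)"
        using insert.prems(1) p(1) by (rule sum.remove)
      also have "(\<Sum>i\<in>I - {p}. b i * u i k) = (\<Sum>i\<in>I - {p}. a i * u i k)"
        by (rule sum.cong) (auto simp: b_def)
      also have "b p * u p k = - (\<Sum>i\<in>I - {p}. a i * (u i j / u p j * u p k))"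
        using p by (simp add: b_def sum_distrib_right sum_divide_distrib mult.assoc)
      finally show ?thesis
        by (simp add: w_def right_diff_distrib sum_subtractf)
    qed
    have "w i j = 0" for i using p by (simp add: w_def)
    with a(2) b have "\<forall>k\<in>insert j J. (\<Sum>i\<in>I. b i * u i k) = 0" by auto
    moreover have "\<exists>i\<in>I. b i \<noteq> 0" using a(1) by (auto simp: b_def)
    ultimately show ?thesis by blast
  qed
qed

section \<open>Modules of polynomial vector fields\<close>

text \<open>Generation over the coordinate ring of \<open>W\<close>: coefficients are polynomials on
  the whole space, but the identity is required on \<open>W\<close> only. Generators are indexed,
  not collected in a set, so that repetitions do no harm.\<close>

definition spans :: "('n::finite \<Rightarrow> 'k::field_char_0) set \<Rightarrow> 'j set \<Rightarrow> ('j \<Rightarrow> ('n \<Rightarrow> 'k) \<Rightarrow> 'n \<Rightarrow> 'k)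
    \<Rightarrow> (('n \<Rightarrow> 'k) \<Rightarrow> 'n \<Rightarrow> 'k) set \<Rightarrow> bool" where
  "spans W J h E \<longleftrightarrow> (\<forall>V\<in>E. \<exists>c. (\<forall>j\<in>J. c j \<in> polyfun) \<and>
     (\<forall>x\<in>W. \<forall>i. V x i = (\<Sum>j\<in>J. c j x * h j x i)))"

definition generated_by :: "('n::finite \<Rightarrow> 'k::field_char_0) set \<Rightarrow> nat \<Rightarrow> (('n \<Rightarrow> 'k) \<Rightarrow> 'n \<Rightarrow> 'k) set \<Rightarrow> bool" where
  "generated_by W n E \<longleftrightarrow> (\<exists>e :: nat \<Rightarrow> ('n \<Rightarrow> 'k) \<Rightarrow> 'n \<Rightarrow> 'k. (\<forall>k<n. e k \<in> E) \<and> spans W {..<n} e E)"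

text \<open>Linear independence of the classes of the \<open>h j\<close> in \<open>E / \<mm> E\<close>, where \<open>\<mm>\<close> is the ideal of
  the origin.\<close>

definition minimal_gens :: "('n::finite \<Rightarrow> 'k::field_char_0) set \<Rightarrow> 'j set \<Rightarrow> ('j \<Rightarrow> ('n \<Rightarrow> 'k) \<Rightarrow> 'n \<Rightarrow> 'k) \<Rightarrow> bool" where
  "minimal_gens W J h \<longleftrightarrow> (\<forall>a c. (\<forall>j\<in>J. c j \<in> polyfun \<and> c j (\<lambda>_. 0) = 0) \<longrightarrow>
     (\<forall>x\<in>W. \<forall>i. (\<Sum>j\<in>J. a j * h j x i) = (\<Sum>j\<in>J. c j x * h j x i)) \<longrightarrow> (\<forall>j\<in>J. a j = 0))"

lemma spansE:
  assumes "spans W J h E" "V \<in> E"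
  obtains c where "\<forall>j\<in>J. c j \<in> polyfun" "\<forall>x\<in>W. \<forall>i. V x i = (\<Sum>j\<in>J. c j x * h j x i)"
  using assms unfolding spans_def by blast

lemma spansI:
  assumes "\<And>V. V \<in> E \<Longrightarrow> \<exists>c. (\<forall>j\<in>J. c j \<in> polyfun) \<and> (\<forall>x\<in>W. \<forall>i. V x i = (\<Sum>j\<in>J. c j x * h j x i))"
  shows "spans W J h E"
  using assms unfolding spans_def by (rule ballI)

lemma minimal_gensD:
  assumes "minimal_gens W J h" "\<And>j. j \<in> J \<Longrightarrow> c j \<in> polyfun" "\<And>j. j \<in> J \<Longrightarrow> c j (\<lambda>_. 0) = 0"
    and "\<And>x i. x \<in> W \<Longrightarrow> (\<Sum>j\<in>J. a j * h j x i) = (\<Sum>j\<in>J. c j x * h j x i)" and "j \<in> J"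
  shows "a j = 0"
  using assms unfolding minimal_gens_def by blast

text \<open>Missing generators are replaced by the zero field, so only the inequality
  \<open>card J \<le> n\<close> matters.\<close>

lemma generated_byI:
  assumes J: "finite J" "card J \<le> n" and h: "\<And>j. j \<in> J \<Longrightarrow> h j \<in> E"
    and zero: "(\<lambda>_ _. 0) \<in> E" and sp: "spans W J h E"
  shows "generated_by W n E"
proof -
  obtain g where g: "bij_betw g {..<card J} J"
    using J(1) ex_bij_betw_nat_finite [of J] by (auto simp: atLeast0LessThan)
  define e where "e k = (if k < card J then h (g k) else (\<lambda>_ _. 0))" for k
  have "e k \<in> E" for k using h g zero by (auto simp: e_def bij_betw_def)
  moreover have "spans W {..<n} e E"
    unfolding spans_def
  proof
    fix V assume "V \<in> E"
    then obtain c where c: "\<forall>j\<in>J. c j \<in> polyfun" "\<forall>x\<in>W. \<forall>i. V x i = (\<Sum>j\<in>J. c j x * h j x i)"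
      using sp by (auto simp: spans_def)
    define c' where "c' k = (if k < card J then c (g k) else (\<lambda>_. 0))" for k
    have "c' k \<in> polyfun" for k
      using c(1) g by (auto simp: c'_def bij_betw_def intro: polyfun.const)
    moreover have "V x i = (\<Sum>k<n. c' k x * e k x i)" if "x \<in> W" for x i
    proof -
      have "V x i = (\<Sum>k<card J. c (g k) x * h (g k) x i)"
        using c(2) that sum.reindex_bij_betw [OF g, of "\<lambda>j. c j x * h j x i"] by simp
      also have "\<dots> = (\<Sum>k<n. c' k x * e k x i)"
        by (rule sum.mono_neutral_cong_left) (use J in \<open>auto simp: c'_def e_def\<close>)
      finally show ?thesis .
    qed
    ultimately show "\<exists>c. (\<forall>j\<in>{..<n}. c j \<in> polyfun) \<and> (\<forall>x\<in>W. \<forall>i. V x i = (\<Sum>j<n. c j x * e j x i))"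
      by blast
  qed
  ultimately show ?thesis by (auto simp: generated_by_def)
qed

lemma spans_minimal_subset:
  assumes "finite J0" "spans W J0 h E"
  shows "\<exists>J\<subseteq>J0. spans W J h E \<and> (\<forall>j\<in>J. \<not> spans W (J - {j}) h E)"
  using assms
proof (induction J0 rule: finite_psubset_induct)
  case (psubset J0)
  show ?case
  proof (cases "\<exists>j\<in>J0. spans W (J0 - {j}) h E")
    case True
    then obtain j where "j \<in> J0" "spans W (J0 - {j}) h E" by auto
    then obtain J where "J \<subseteq> J0 - {j}" "spans W J h E" "\<forall>j\<in>J. \<not> spans W (J - {j}) h E"
      using psubset.IH [of "J0 - {j}"] by auto
    then show ?thesis by (intro exI [of _ J]) auto
  next
    case False
    with psubset.prems show ?thesis by (intro exI [of _ J0]) auto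
  qed
qed

text \<open>Graded Nakayama. In a relation, the component of degree \<open>deg j0\<close> gives
  \<open>h j0\<close> the constant coefficient \<open>- a j0\<close>, because \<open>c j0\<close>
  has no constant term. If \<open>a j0\<close> were nonzero, \<open>h j0\<close> would be a
  combination of the other generators.\<close>

lemma irredundant_imp_minimal_gens:
  assumes W: "subsp W" and J: "finite J" and sp: "spans W J h E"
    and irr: "\<And>j. j \<in> J \<Longrightarrow> \<not> spans W (J - {j}) h E"
    and pm: "\<And>j. j \<in> J \<Longrightarrow> polymap (h j)"
    and hm: "\<And>j i. j \<in> J \<Longrightarrow> hom (deg j) (\<lambda>x. h j x i)"
  shows "minimal_gens W J h"
  unfolding minimal_gens_def
proof (intro allI impI ballI, rule ccontr)
  fix a c j0
  assume c: "\<forall>j\<in>J. c j \<in> polyfun \<and> c j (\<lambda>_. 0) = 0"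
    and eq: "\<forall>x\<in>W. \<forall>i. (\<Sum>j\<in>J. a j * h j x i) = (\<Sum>j\<in>J. c j x * h j x i)"
    and j0: "j0 \<in> J" "a j0 \<noteq> 0"
  define d where "d = deg j0"
  \<comment> \<open>The coefficient of \<open>h j\<close> in the degree \<open>d\<close> part of the
    difference of the two sides; as \<open>h j\<close> is homogeneous, only one component of
    \<open>c j - a j\<close> contributes.\<close>
  define q where "q j x = (if d < deg j then 0 else comp (d - deg j) (c j) x)
      - (if deg j = d then a j else 0)" for j x
  have qp: "q j \<in> polyfun" if "j \<in> J" for j
  proof -
    have "comp (d - deg j) (c j) \<in> polyfun" using c that by (simp add: comp_polyfun)
    then show ?thesis
      unfolding q_def by (cases "d < deg j"; cases "deg j = d") (auto intro: polyfun_intros)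
  qed
  have q0: "q j0 x = - a j0" for x
    using c j0(1) by (simp add: q_def d_def comp_zero_apply)
  have "(\<Sum>j\<in>J. q j x * h j x i) = 0" if x: "x \<in> W" for x i
  proof -
    have hp: "(\<lambda>x. h j x i) \<in> polyfun" if "j \<in> J" for j using pm that by (simp add: polymap_def)
    have "comp d (\<lambda>x. \<Sum>j\<in>J. a j * h j x i) x = (\<Sum>j\<in>J. comp d (\<lambda>x. a j * h j x i) x)"
      by (rule comp_sum) (auto intro: polyfun_intros hp)
    also have "\<dots> = (\<Sum>j\<in>J. (if deg j = d then a j else 0) * h j x i)"
    proof (rule sum.cong [OF refl])
      fix j assume j: "j \<in> J"
      show "comp d (\<lambda>x. a j * h j x i) x = (if deg j = d then a j else 0) * h j x i"
        by (subst comp_mult_hom [OF polyfun.const hp [OF j] hm [OF j]]) (auto simp: comp_const)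
    qed
    finally have 1: "comp d (\<lambda>x. \<Sum>j\<in>J. a j * h j x i) x = (\<Sum>j\<in>J. (if deg j = d then a j else 0) * h j x i)" .
    have "comp d (\<lambda>x. \<Sum>j\<in>J. c j x * h j x i) x = (\<Sum>j\<in>J. comp d (\<lambda>x. c j x * h j x i) x)"
      by (rule comp_sum) (use c in \<open>auto intro: polyfun_intros hp\<close>)
    also have "\<dots> = (\<Sum>j\<in>J. (if d < deg j then 0 else comp (d - deg j) (c j) x) * h j x i)"
    proof (rule sum.cong [OF refl])
      fix j assume j: "j \<in> J"
      show "comp d (\<lambda>x. c j x * h j x i) x = (if d < deg j then 0 else comp (d - deg j) (c j) x) * h j x i"
        by (subst comp_mult_hom [OF _ hp [OF j] hm [OF j]]) (use c j in auto)
    qed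
    finally have "comp d (\<lambda>x. \<Sum>j\<in>J. c j x * h j x i) x
        = (\<Sum>j\<in>J. (if d < deg j then 0 else comp (d - deg j) (c j) x) * h j x i)" .
    moreover have "comp d (\<lambda>x. \<Sum>j\<in>J. a j * h j x i) x = comp d (\<lambda>x. \<Sum>j\<in>J. c j x * h j x i) x"
      by (rule comp_cong [OF W x]) (use eq in auto)
    ultimately show ?thesis using 1
      by (simp add: q_def left_diff_distrib sum_subtractf)
  qed
  then have h0: "h j0 x i = (\<Sum>j\<in>J - {j0}. (1 / a j0 * q j x) * h j x i)" if "x \<in> W" for x i
  proof -
    have "(\<Sum>j\<in>J. q j x * h j x i) = q j0 x * h j0 x i + (\<Sum>j\<in>J - {j0}. q j x * h j x i)"
      using J j0(1) by (rule sum.remove)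
    then have "a j0 * h j0 x i = (\<Sum>j\<in>J - {j0}. q j x * h j x i)"
      using \<open>x \<in> W \<Longrightarrow> (\<Sum>j\<in>J. q j x * h j x i) = 0\<close> that by (simp add: q0)
    then have "h j0 x i = 1 / a j0 * (\<Sum>j\<in>J - {j0}. q j x * h j x i)"
      using j0(2) by (simp add: field_simps)
    then show ?thesis by (simp only: sum_distrib_left mult.assoc)
  qed
  have "spans W (J - {j0}) h E"
    unfolding spans_def
  proof
    fix V assume "V \<in> E"
    then obtain b where b: "\<forall>j\<in>J. b j \<in> polyfun" "\<forall>x\<in>W. \<forall>i. V x i = (\<Sum>j\<in>J. b j x * h j x i)"
      using sp by (auto simp: spans_def)
    let ?b = "\<lambda>j x. b j x + b j0 x * (1 / a j0 * q j x)"
    have "\<forall>j\<in>J - {j0}. ?b j \<in> polyfun"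
      using b(1) qp j0(1) by (intro ballI polyfun_intros) auto
    moreover have "V x i = (\<Sum>j\<in>J - {j0}. ?b j x * h j x i)" if x: "x \<in> W" for x i
    proof -
      have "V x i = b j0 x * h j0 x i + (\<Sum>j\<in>J - {j0}. b j x * h j x i)"
        using b(2) x sum.remove [OF J j0(1)] by simp
      also have "b j0 x * h j0 x i = (\<Sum>j\<in>J - {j0}. b j0 x * (1 / a j0 * q j x) * h j x i)"
        by (subst h0 [OF x]) (simp only: sum_distrib_left mult.assoc)
      finally show ?thesis by (simp add: distrib_right sum.distrib add.commute)
    qed
    ultimately show "\<exists>c. (\<forall>j\<in>J - {j0}. c j \<in> polyfun) \<and> (\<forall>x\<in>W. \<forall>i. V x i = (\<Sum>j\<in>J - {j0}. c j x * h j x i))"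
      by (intro exI [of _ ?b]) blast
  qed
  with irr j0(1) show False by blast
qed

text \<open>The polynomial \<open>f\<close> acts as a denominator that is a unit at the origin.
  Writing \<open>f(0) = f + (f(0) - f)\<close> and expanding each \<open>e k\<close> in the
  generators turns the sum of the \<open>f(0) * a j * h j\<close> into a combination whose
  coefficients vanish at the origin, so minimality applies.\<close>

lemma minimal_gens_combination:
  fixes e :: "nat \<Rightarrow> ('n::finite \<Rightarrow> 'k::field_char_0) \<Rightarrow> 'n \<Rightarrow> 'k"
  assumes mg: "minimal_gens W J h" and sp: "spans W J h E"
    and e: "\<And>k. k < n \<Longrightarrow> e k \<in> E" and f: "f \<in> polyfun" "f (\<lambda>_. 0) \<noteq> 0"
    and r: "\<And>k. k < n \<Longrightarrow> r k \<in> polyfun" "\<And>k. k < n \<Longrightarrow> r k (\<lambda>_. 0) = 0"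
    and eq: "\<And>x i. x \<in> W \<Longrightarrow> f x * (\<Sum>j\<in>J. a j * h j x i) = (\<Sum>k<n. r k x * e k x i)"
    and j: "j \<in> J"
  shows "a j = 0"
proof -
  have "\<forall>k. \<exists>c. k < n \<longrightarrow> (\<forall>j\<in>J. c j \<in> polyfun) \<and> (\<forall>x\<in>W. \<forall>i. e k x i = (\<Sum>j\<in>J. c j x * h j x i))"
    using e sp by (auto simp: spans_def)
  then obtain v where v: "\<And>k j. k < n \<Longrightarrow> j \<in> J \<Longrightarrow> v k j \<in> polyfun"
    "\<And>k x i. k < n \<Longrightarrow> x \<in> W \<Longrightarrow> e k x i = (\<Sum>j\<in>J. v k j x * h j x i)"
    by metis
  let ?f0 = "f (\<lambda>_. 0)"
  let ?c = "\<lambda>j x. (?f0 - f x) * a j + (\<Sum>k<n. r k x * v k j x)"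
  have cp: "?c j \<in> polyfun" if "j \<in> J" for j
    using f r v that by (intro polyfun_intros) auto
  have c0: "?c j (\<lambda>_. 0) = 0" for j
    using r by simp
  have ceq: "(\<Sum>j\<in>J. (?f0 * a j) * h j x i) = (\<Sum>j\<in>J. ?c j x * h j x i)" if x: "x \<in> W" for x i
  proof -
    have "(\<Sum>j\<in>J. (\<Sum>k<n. r k x * v k j x) * h j x i) = (\<Sum>k<n. r k x * (\<Sum>j\<in>J. v k j x * h j x i))"
      unfolding sum_distrib_left sum_distrib_right by (subst sum.swap) (simp add: mult.assoc)
    also have "\<dots> = f x * (\<Sum>j\<in>J. a j * h j x i)"
      using v(2) x eq by simp
    finally show ?thesis
      by (simp add: distrib_right sum.distrib left_diff_distrib sum_subtractf sum_distrib_left mult.assoc)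
  qed
  have "?f0 * a j = 0"
    by (rule minimal_gensD [OF mg, of ?c "\<lambda>j. ?f0 * a j", OF cp c0 ceq j])
  with f show ?thesis by simp
qed

text \<open>With more than \<open>n\<close> generators, linear algebra on the values at the origin
  yields constants \<open>a\<close>, not all zero, for which the combination of the
  \<open>f * h j\<close> has coefficients over the \<open>e k\<close> that vanish at the origin;
  \<open>minimal_gens_combination\<close> forbids this.\<close>

lemma minimal_gens_card_le:
  fixes e :: "nat \<Rightarrow> ('n::finite \<Rightarrow> 'k::field_char_0) \<Rightarrow> 'n \<Rightarrow> 'k"
  assumes J: "finite J" and mg: "minimal_gens W J h" and sp: "spans W J h E"
    and e: "\<And>k. k < n \<Longrightarrow> e k \<in> E" and f: "f \<in> polyfun" "f (\<lambda>_. 0) \<noteq> 0"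
    and h: "\<And>j. j \<in> J \<Longrightarrow> \<exists>c. (\<forall>k<n. c k \<in> polyfun) \<and> (\<forall>x\<in>W. \<forall>i. f x * h j x i = (\<Sum>k<n. c k x * e k x i))"
  shows "card J \<le> n"
proof (rule ccontr)
  assume "\<not> card J \<le> n"
  then have lt: "card {..<n} < card J" by simp
  obtain u where u: "\<And>j k. j \<in> J \<Longrightarrow> k < n \<Longrightarrow> u j k \<in> polyfun"
    "\<And>j x i. j \<in> J \<Longrightarrow> x \<in> W \<Longrightarrow> f x * h j x i = (\<Sum>k<n. u j k x * e k x i)"
    using h by metis
  obtain a where a: "\<exists>j\<in>J. a j \<noteq> 0" "\<And>k. k < n \<Longrightarrow> (\<Sum>j\<in>J. a j * u j k (\<lambda>_. 0)) = 0"
    using underdetermined_system [OF _ J lt, of "\<lambda>j k. u j k (\<lambda>_. 0)"] by auto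
  let ?r = "\<lambda>k x. \<Sum>j\<in>J. a j * u j k x"
  have eq: "f x * (\<Sum>j\<in>J. a j * h j x i) = (\<Sum>k<n. ?r k x * e k x i)" if x: "x \<in> W" for x i
  proof -
    have "f x * (\<Sum>j\<in>J. a j * h j x i) = (\<Sum>j\<in>J. a j * (f x * h j x i))"
      by (simp add: sum_distrib_left mult.left_commute)
    also have "\<dots> = (\<Sum>j\<in>J. a j * (\<Sum>k<n. u j k x * e k x i))"
      using u(2) x by simp
    also have "\<dots> = (\<Sum>k<n. ?r k x * e k x i)"
      unfolding sum_distrib_left sum_distrib_right by (subst sum.swap) (simp add: mult.assoc)
    finally show ?thesis .
  qed
  have rp: "?r k \<in> polyfun" if "k < n" for k using u that by (intro polyfun_intros) auto
  have "a j = 0" if "j \<in> J" for j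
    by (rule minimal_gens_combination [of W J h E n e f ?r a, OF mg sp e f rp a(2) eq that])
  with a(1) show False by blast
qed

lemma homogeneous_generators:
  fixes e :: "nat \<Rightarrow> ('n::finite \<Rightarrow> 'k::field_char_0) \<Rightarrow> 'n \<Rightarrow> 'k"
  assumes W: "subsp W" and pm: "\<And>V. V \<in> E \<Longrightarrow> polymap V" and gr: "\<And>V d. V \<in> E \<Longrightarrow> vcomp d V \<in> E"
    and e: "\<And>k. k < n \<Longrightarrow> e k \<in> E" and f: "f \<in> polyfun" "f (\<lambda>_. 0) \<noteq> 0"
    and gen: "\<And>V. V \<in> E \<Longrightarrow> \<exists>c. (\<forall>k<n. c k \<in> polyfun) \<and> (\<forall>x\<in>W. \<forall>i. f x * V x i = (\<Sum>k<n. c k x * e k x i))"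
  obtains J :: "(nat \<times> nat) set" and h deg where "finite J" "\<forall>j\<in>J. h j \<in> E"
    "\<forall>j\<in>J. \<forall>i. hom (deg j) (\<lambda>x. h j x i)" "spans W J h E" "minimal_gens W J h" "card J \<le> n"
proof -
  have "\<forall>k. \<exists>N. k < n \<longrightarrow> (\<forall>d\<ge>N. \<forall>x i. vcomp d (e k) x i = 0)"
    using vcomp_bounded pm e by blast
  then obtain N' where N': "\<And>k d x i. k < n \<Longrightarrow> d \<ge> N' k \<Longrightarrow> vcomp d (e k) x i = 0" by metis
  define N where "N = (\<Sum>k<n. N' k)"
  have N: "vcomp d (e k) x i = 0" if "k < n" "d \<ge> N" for d k x i
  proof -
    have "N' k \<le> N" using that(1) unfolding N_def by (intro member_le_sum) auto
    with that N' show ?thesis by simp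
  qed
  define J0 where "J0 = {..<n} \<times> {..<N}"
  define h where "h = (\<lambda>(k, s). vcomp s (e k))"
  define deg where "deg = (snd :: nat \<times> nat \<Rightarrow> nat)"
  have ep: "(\<lambda>x. e k x i) \<in> polyfun" if "k < n" for k i
    using pm e that by (simp add: polymap_def)
  have hE: "h j \<in> E" if "j \<in> J0" for j
    using that gr e by (auto simp: J0_def h_def)
  have hh: "hom (deg j) (\<lambda>x. h j x i)" if "j \<in> J0" for j i
    using that ep by (auto simp: J0_def h_def deg_def vcomp_def hom_comp)
  have "spans W J0 h E"
    unfolding spans_def
  proof
    fix V assume V: "V \<in> E"
    obtain M where M: "\<And>d x i. d \<ge> M \<Longrightarrow> vcomp d V x i = 0"
      using vcomp_bounded [OF pm [OF V]] by blast
    obtain c where c: "\<And>d k. k < n \<Longrightarrow> c d k \<in> polyfun"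
      "\<And>d x i. x \<in> W \<Longrightarrow> f x * vcomp d V x i = (\<Sum>k<n. c d k x * e k x i)"
      using gen [OF gr [OF V]] by metis
    let ?q = "\<lambda>d j x. if snd j \<le> d then comp (d - snd j) (c d (fst j)) x else 0"
    let ?C = "\<lambda>j x. 1 / f (\<lambda>_. 0) * (\<Sum>d<M. ?q d j x)"
    have qp: "?q d j \<in> polyfun" if "j \<in> J0" for d j
      using c(1) [of "fst j" d] that
      by (cases "snd j \<le> d") (auto simp: J0_def intro: polyfun.const comp_polyfun)
    have Vp: "(\<lambda>x. V x i) \<in> polyfun" for i using pm [OF V] by (simp add: polymap_def)
    have key: "f (\<lambda>_. 0) * vcomp d V x i = (\<Sum>j\<in>J0. ?q d j x * h j x i)" if x: "x \<in> W" for d x i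
    proof -
      have "comp d (\<lambda>x. f x * vcomp d V x i) x = f (\<lambda>_. 0) * vcomp d V x i"
        using f(1) Vp by (subst comp_mult_hom [of f "\<lambda>x. vcomp d V x i" d])
          (simp_all add: vcomp_def comp_polyfun hom_comp comp_zero_apply)
      moreover have "comp d (\<lambda>x. f x * vcomp d V x i) x = comp d (\<lambda>x. \<Sum>k<n. c d k x * e k x i) x"
        by (rule comp_cong [OF W x]) (rule c(2))
      moreover have "comp d (\<lambda>x. \<Sum>k<n. c d k x * e k x i) x
          = (\<Sum>k<n. comp d (\<lambda>x. c d k x * e k x i) x)"
        by (rule comp_sum) (use c(1) ep in \<open>auto intro: polyfun_intros\<close>)
      moreover have "comp d (\<lambda>x. c d k x * e k x i) x = (\<Sum>s<N. ?q d (k, s) x * h (k, s) x i)"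
        if k: "k < n" for k
      proof -
        have "comp d (\<lambda>x. c d k x * e k x i) x = comp d (\<lambda>x. e k x i * c d k x) x"
          by (simp add: mult.commute)
        also have "\<dots> = (\<Sum>s\<le>d. vcomp s (e k) x i * comp (d - s) (c d k) x)"
          using c(1) ep k by (simp add: comp_mult vcomp_def)
        also have "\<dots> = (\<Sum>s<N. ?q d (k, s) x * h (k, s) x i)"
          by (rule sum.mono_neutral_cong) (use N k in \<open>auto simp: h_def mult.commute\<close>)
        finally show ?thesis .
      qed
      ultimately have "f (\<lambda>_. 0) * vcomp d V x i = (\<Sum>k<n. \<Sum>s<N. ?q d (k, s) x * h (k, s) x i)"
        by simp
      also have "\<dots> = (\<Sum>j\<in>J0. ?q d j x * h j x i)"
        unfolding J0_def sum.cartesian_product by (rule sum.cong) auto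
      finally show ?thesis .
    qed
    have "V x i = (\<Sum>j\<in>J0. ?C j x * h j x i)" if x: "x \<in> W" for x i
    proof -
      have "V x i = (\<Sum>d<M. vcomp d V x i)"
        using sum_comp [OF Vp, where N = M and x = x] M by (simp add: vcomp_def)
      also have "\<dots> = (\<Sum>d<M. 1 / f (\<lambda>_. 0) * (\<Sum>j\<in>J0. ?q d j x * h j x i))"
        by (rule sum.cong [OF refl], subst key [OF x, symmetric]) (use f(2) in simp)
      also have "\<dots> = (\<Sum>j\<in>J0. ?C j x * h j x i)"
        unfolding sum_distrib_left sum_distrib_right by (subst sum.swap) (simp only: mult.assoc)
      finally show ?thesis .
    qed
    moreover have "\<forall>j\<in>J0. ?C j \<in> polyfun"
      using qp by (intro ballI polyfun.mult polyfun.const polyfun_sum) blast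
    ultimately show "\<exists>c. (\<forall>j\<in>J0. c j \<in> polyfun) \<and> (\<forall>x\<in>W. \<forall>i. V x i = (\<Sum>j\<in>J0. c j x * h j x i))"
      by (intro exI [of _ ?C]) blast
  qed
  moreover have "finite J0" by (simp add: J0_def)
  ultimately obtain J where J: "J \<subseteq> J0" "spans W J h E" "\<And>j. j \<in> J \<Longrightarrow> \<not> spans W (J - {j}) h E"
    using spans_minimal_subset [of J0 W h E] by blast
  have fin: "finite J" using J(1) by (rule finite_subset) (simp add: J0_def)
  have hE': "\<And>j. j \<in> J \<Longrightarrow> h j \<in> E" using hE J(1) by blast
  have hh': "\<And>j i. j \<in> J \<Longrightarrow> hom (deg j) (\<lambda>x. h j x i)" using hh J(1) by blast
  have mg: "minimal_gens W J h"
    by (rule irredundant_imp_minimal_gens [OF W fin J(2,3) pm [OF hE'] hh'])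
  have "card J \<le> n"
    by (rule minimal_gens_card_le [OF fin mg J(2) e f gen [OF hE']])
  with fin hE' hh' J(2) mg show ?thesis by (intro that [of J h deg]) blast+
qed

section \<open>Derivations as vector fields\<close>

text \<open>The derivative of \<open>f\<close> at \<open>x\<close> in direction \<open>v\<close>,
  read off from a line; through it a vector field acts on polynomials.\<close>

definition grad :: "(('n::finite \<Rightarrow> 'k::field_char_0) \<Rightarrow> 'k) \<Rightarrow> ('n \<Rightarrow> 'k) \<Rightarrow> ('n \<Rightarrow> 'k) \<Rightarrow> 'k" where
  "grad f x v = coeff (linepoly f x v) 1"

lemma grad_const: "grad (\<lambda>_. c) x v = 0"
  by (simp add: grad_def)

lemma grad_coord: "grad (\<lambda>x. x i) x v = v i"
  by (simp add: grad_def)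

lemma grad_add: "f \<in> polyfun \<Longrightarrow> g \<in> polyfun \<Longrightarrow> grad (\<lambda>x. f x + g x) x v = grad f x v + grad g x v"
  by (simp add: grad_def linepoly_add)

lemma coeff_linepoly_0: "f \<in> polyfun \<Longrightarrow> coeff (linepoly f x v) 0 = f x"
  using poly_linepoly [of f x v 0] by (simp add: poly_0_coeff_0)

lemma grad_mult:
  "f \<in> polyfun \<Longrightarrow> g \<in> polyfun \<Longrightarrow> grad (\<lambda>x. f x * g x) x v = f x * grad g x v + g x * grad f x v"
  by (simp add: grad_def linepoly_mult coeff_mult atMost_Suc coeff_linepoly_0 mult.commute)

lemma grad_lin: "grad (lin a) x v = lin a v"
proof -
  have "linepoly (lin a) x v = [:lin a x, lin a v:]"
    by (rule linepoly_eqI) (simp add: lin_add lin_scale)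
  then show ?thesis by (simp add: grad_def)
qed

lemma grad_cong:
  assumes "subsp W" "x \<in> W" "v \<in> W" "\<And>x. x \<in> W \<Longrightarrow> f x = g x"
  shows "grad f x v = grad g x v"
  unfolding grad_def using linepoly_cong [OF assms] by simp

lemma grad_polyfun:
  assumes "f \<in> polyfun" "polymap V" shows "(\<lambda>x. grad f x (V x)) \<in> polyfun"
  using assms(1)
  by induction
    (use assms(2) in \<open>auto simp: polymap_def grad_const grad_coord grad_add grad_mult intro: polyfun_intros\<close>)

lemma grad_sum:
  assumes "f \<in> polyfun"
  shows "grad f x (\<lambda>i. \<Sum>j\<in>J. c j * v j i) = (\<Sum>j\<in>J. c j * grad f x (v j))"
  using assms
  by induction
    (simp_all add: grad_const grad_coord grad_add grad_mult distrib_left sum.distrib sum_distrib_left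
      mult.left_commute)

lemma grad_scale: "f \<in> polyfun \<Longrightarrow> grad f x (\<lambda>i. c * v i) = c * grad f x v"
  using grad_sum [of f x "\<lambda>_. c" "\<lambda>_. v" "{()}"] by simp

section \<open>Derivations of the coordinate ring of a subspace\<close>

lemma restr_in_ring [intro]: "g \<in> polyfun \<Longrightarrow> restr W g \<in> coord_ring W"
  by (simp add: coord_ring_def)

lemma coord_ringE:
  assumes "f \<in> coord_ring W" obtains g where "g \<in> polyfun" "f = restr W g"
  using assms by (auto simp: coord_ring_def)

lemma coord_ring_outside: "f \<in> coord_ring W \<Longrightarrow> x \<notin> W \<Longrightarrow> f x = 0"
  by (auto simp: coord_ring_def restr_def)

lemma restr_apply [simp]: "x \<in> W \<Longrightarrow> restr W f x = f x"
  by (simp add: restr_def)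

lemma restr_add: "(\<lambda>x. restr W f x + restr W g x) = restr W (\<lambda>x. f x + g x)"
  and restr_times: "(\<lambda>x. restr W f x * restr W g x) = restr W (\<lambda>x. f x * g x)"
  and restr_scale: "(\<lambda>x. c * restr W f x) = restr W (\<lambda>x. c * f x)"
  by (auto simp: restr_def)

definition vf :: "('n::finite \<Rightarrow> 'k::field_char_0) set \<Rightarrow> ((('n \<Rightarrow> 'k) \<Rightarrow> 'k) \<Rightarrow> (('n \<Rightarrow> 'k) \<Rightarrow> 'k))
    \<Rightarrow> ('n \<Rightarrow> 'k) \<Rightarrow> 'n \<Rightarrow> 'k" where
  "vf W \<delta> x i = \<delta> (restr W (\<lambda>x. x i)) x"

text \<open>The zero values outside \<open>coord_ring W\<close> and at points outside
  \<open>W\<close> are forced by the conventions of \<open>derivations\<close> and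
  \<open>coord_ring\<close>.\<close>

definition dfield :: "('n::finite \<Rightarrow> 'k::field_char_0) set \<Rightarrow> (('n \<Rightarrow> 'k) \<Rightarrow> 'n \<Rightarrow> 'k)
    \<Rightarrow> (('n \<Rightarrow> 'k) \<Rightarrow> 'k) \<Rightarrow> (('n \<Rightarrow> 'k) \<Rightarrow> 'k)" where
  "dfield W V f = (if f \<in> coord_ring W then restr W (\<lambda>x. grad f x (V x)) else (\<lambda>x. 0))"

context
  fixes W :: "('n::finite \<Rightarrow> 'k::field_char_0) set" and \<delta>
  assumes \<delta>: "\<delta> \<in> derivations W"
begin

lemma der_ring: "f \<in> coord_ring W \<Longrightarrow> \<delta> f \<in> coord_ring W"
  using \<delta> by (simp add: derivations_def)

lemma der_not_ring: "f \<notin> coord_ring W \<Longrightarrow> \<delta> f = (\<lambda>x. 0)"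
  using \<delta> by (simp add: derivations_def)

lemma der_outside: assumes "x \<notin> W" shows "\<delta> f x = 0"
  using der_ring [of f] der_not_ring [of f] coord_ring_outside [OF _ assms] by (cases "f \<in> coord_ring W") auto

lemma der_add: "f \<in> coord_ring W \<Longrightarrow> g \<in> coord_ring W \<Longrightarrow> \<delta> (\<lambda>x. f x + g x) x = \<delta> f x + \<delta> g x"
  using \<delta> by (simp add: derivations_def)

lemma der_mult: "f \<in> coord_ring W \<Longrightarrow> g \<in> coord_ring W \<Longrightarrow> \<delta> (\<lambda>x. f x * g x) x = f x * \<delta> g x + g x * \<delta> f x"
  using \<delta> by (simp add: derivations_def)

lemma der_scale: "f \<in> coord_ring W \<Longrightarrow> \<delta> (\<lambda>x. c * f x) x = c * \<delta> f x"
  using \<delta> by (simp add: derivations_def)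

lemma der_const: "\<delta> (restr W (\<lambda>_. c)) x = 0"
proof (cases "x \<in> W")
  case True
  let ?u = "restr W (\<lambda>_. 1)"
  have u: "?u \<in> coord_ring W" by (intro restr_in_ring polyfun.const)
  have "(\<lambda>x. ?u x * ?u x) = ?u" by (auto simp: restr_def)
  with der_mult [OF u u, of x] True have "\<delta> ?u x = \<delta> ?u x + \<delta> ?u x" by simp
  then have "\<delta> ?u x = 0" by simp
  moreover have "restr W (\<lambda>_. c) = (\<lambda>x. c * ?u x)" by (auto simp: restr_def)
  ultimately show ?thesis using der_scale [OF u, of c x] by simp
next
  case False
  then show ?thesis by (rule der_outside)
qed

lemma der_grad:
  assumes "g \<in> polyfun" "x \<in> W" shows "\<delta> (restr W g) x = grad g x (vf W \<delta> x)"
  using assms(1)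
proof induction
  case (const c) then show ?case by (simp add: der_const grad_const)
next
  case (coord i) then show ?case by (simp add: grad_coord vf_def)
next
  case (add f g)
  then show ?case
    using der_add [of "restr W f" "restr W g" x] by (simp add: restr_add grad_add restr_in_ring)
next
  case (mult f g)
  then show ?case
    using der_mult [of "restr W f" "restr W g" x] assms(2) by (simp add: restr_times grad_mult restr_in_ring)
qed

text \<open>\<open>vf W \<delta>\<close> is zero off \<open>W\<close> and therefore need not be
  polynomial; the modules are described by ambient polynomial fields that agree with it on
  \<open>W\<close>.\<close>

lemma vf_extension: "\<exists>V. polymap V \<and> (\<forall>x\<in>W. V x = vf W \<delta> x)"
proof -
  have "\<exists>g. g \<in> polyfun \<and> \<delta> (restr W (\<lambda>x. x i)) = restr W g" for i
    using coord_ringE [OF der_ring [OF restr_in_ring [OF polyfun.coord [of i]]]] by metis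
  then obtain g where g: "\<And>i. g i \<in> polyfun" "\<And>i. \<delta> (restr W (\<lambda>x. x i)) = restr W (g i)" by metis
  then show ?thesis by (intro exI [of _ "\<lambda>x i. g i x"]) (auto simp: polymap_def vf_def)
qed

lemma dfield_vf:
  assumes W: "subsp W" and "\<And>x. x \<in> W \<Longrightarrow> V x = vf W \<delta> x" "\<And>x. x \<in> W \<Longrightarrow> V x \<in> W"
  shows "dfield W V = \<delta>"
proof (rule ext, rule ext)
  fix f x
  show "dfield W V f x = \<delta> f x"
  proof (cases "f \<in> coord_ring W \<and> x \<in> W")
    case True
    then obtain g where g: "g \<in> polyfun" "f = restr W g" by (auto elim: coord_ringE)
    have "grad f x (V x) = grad g x (V x)"
      by (rule grad_cong [OF W]) (use True assms g in auto)
    with g True assms show ?thesis by (simp add: dfield_def der_grad)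
  next
    case False
    then show ?thesis by (auto simp: dfield_def der_not_ring der_outside restr_def)
  qed
qed

end

lemma dfield_restr:
  assumes W: "subsp W" and V: "\<And>x. x \<in> W \<Longrightarrow> V x \<in> W" and g: "g \<in> polyfun"
  shows "dfield W V (restr W g) = restr W (\<lambda>x. grad g x (V x))"
proof
  fix x
  have "grad (restr W g) x (V x) = grad g x (V x)" if "x \<in> W"
    by (rule grad_cong [OF W]) (use that V in auto)
  with restr_in_ring [OF g, of W] show "dfield W V (restr W g) x = restr W (\<lambda>x. grad g x (V x)) x"
    by (auto simp: dfield_def restr_def)
qed

lemma dfield_derivation:
  assumes W: "subsp W" and pm: "polymap V" and V: "\<And>x. x \<in> W \<Longrightarrow> V x \<in> W"
  shows "dfield W V \<in> derivations W"
proof -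
  note d = dfield_restr [OF W V]
  have 0: "dfield W V f = (\<lambda>x. 0)" if "f \<notin> coord_ring W" for f
    using that by (simp add: dfield_def)
  have 1: "dfield W V f \<in> coord_ring W" if "f \<in> coord_ring W" for f
    using that by (elim coord_ringE) (auto simp: d intro: grad_polyfun pm)
  have 2: "dfield W V (\<lambda>x. f x + g x) = (\<lambda>x. dfield W V f x + dfield W V g x)"
    if "f \<in> coord_ring W" "g \<in> coord_ring W" for f g
    using that by (elim coord_ringE) (simp add: d restr_add polyfun.add grad_add)
  have 3: "dfield W V (\<lambda>x. f x * g x) = (\<lambda>x. f x * dfield W V g x + g x * dfield W V f x)"
    if "f \<in> coord_ring W" "g \<in> coord_ring W" for f g
    using that by (elim coord_ringE) (simp add: d restr_times polyfun.mult grad_mult, simp add: restr_def fun_eq_iff)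
  have 4: "dfield W V (\<lambda>x. c * f x) = (\<lambda>x. c * dfield W V f x)" if "f \<in> coord_ring W" for f c
    using that by (elim coord_ringE)
      (simp add: d restr_scale polyfun.mult polyfun.const grad_mult grad_const)
  show ?thesis using 0 1 2 3 4 by (simp add: derivations_def)
qed

lemma dfield_lin:
  assumes W: "subsp W" and V: "\<And>x. x \<in> W \<Longrightarrow> V x \<in> W"
  shows "dfield W V (restr W (lin a)) = restr W (\<lambda>x. lin a (V x))"
  using dfield_restr [OF W V polyfun_lin] by (simp add: grad_lin)

lemma dfield_coord:
  assumes W: "subsp W" and V: "\<And>x. x \<in> W \<Longrightarrow> V x \<in> W"
  shows "dfield W V (restr W (\<lambda>x. x i)) = restr W (\<lambda>x. V x i)"
  using dfield_restr [OF W V polyfun.coord] by (simp add: grad_coord)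

section \<open>Free modules are generated by as many elements as the dimension\<close>

text \<open>Basis vectors of \<open>W\<close> dual to a selection \<open>\<kappa>\<close> of
  coordinate functions, so \<open>card \<kappa>\<close> is the dimension. The two instances are the
  whole space and a hyperplane solved for one coordinate.\<close>

locale coord_space =
  fixes W :: "('n::finite \<Rightarrow> 'k::field_char_0) set" and \<kappa> :: "'n set" and w :: "'n \<Rightarrow> 'n \<Rightarrow> 'k"
  assumes W: "subsp W" and w_in: "k \<in> \<kappa> \<Longrightarrow> w k \<in> W"
    and w_dual: "k \<in> \<kappa> \<Longrightarrow> j \<in> \<kappa> \<Longrightarrow> w k j = (if j = k then 1 else 0)"
    and w_expand: "x \<in> W \<Longrightarrow> x i = (\<Sum>k\<in>\<kappa>. x k * w k i)"
begin

text \<open>On \<open>W\<close> each coordinate is a fixed linear combination of those in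
  \<open>\<kappa>\<close>. A derivation preserves this relation, so its values on the coordinates
  form a vector of \<open>W\<close>.\<close>

lemma vf_in:
  assumes \<delta>: "\<delta> \<in> derivations W" and x: "x \<in> W"
  shows "vf W \<delta> x \<in> W"
proof -
  have "vf W \<delta> x i = (\<Sum>k\<in>\<kappa>. vf W \<delta> x k * w k i)" for i
  proof -
    let ?g = "\<lambda>x. \<Sum>k\<in>\<kappa>. x k * w k i"
    have "restr W (\<lambda>x. x i) = restr W ?g"
      using w_expand by (auto simp: restr_def)
    then have "vf W \<delta> x i = \<delta> (restr W ?g) x" by (simp add: vf_def)
    also have "\<dots> = grad ?g x (vf W \<delta> x)"
      by (rule der_grad [OF \<delta> _ x]) (intro polyfun_intros)
    also have "linepoly ?g x (vf W \<delta> x) = [:?g x, ?g (vf W \<delta> x):]"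
      by (rule linepoly_eqI) (simp add: distrib_right sum.distrib sum_distrib_left mult.assoc)
    then have "grad ?g x (vf W \<delta> x) = ?g (vf W \<delta> x)" by (simp add: grad_def)
    finally show ?thesis .
  qed
  then have "vf W \<delta> x = (\<lambda>i. \<Sum>k\<in>\<kappa>. vf W \<delta> x k * w k i)" by (rule ext)
  also have "\<dots> \<in> W" by (rule subsp_sum [OF W w_in])
  finally show ?thesis .
qed

text \<open>A setting shared by the logarithmic derivations of an arrangement and those of the
  restricted multiarrangement: \<open>E\<close> collects the polynomial fields representing
  \<open>M\<close>, and the fields \<open>Q * w k\<close> force full rank.\<close>

context
  fixes M and E :: "(('n \<Rightarrow> 'k) \<Rightarrow> 'n \<Rightarrow> 'k) set" and Q
  assumes M: "M \<subseteq> derivations W"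
    and E: "E = {V. polymap V \<and> (\<forall>x\<in>W. V x \<in> W) \<and> dfield W V \<in> M}"
    and Q: "Q \<in> polyfun" "\<exists>p\<in>W. Q p \<noteq> 0"
    and QE: "k \<in> \<kappa> \<Longrightarrow> (\<lambda>x i. Q x * w k i) \<in> E"
    and zero: "(\<lambda>_ _. 0) \<in> E"
begin

text \<open>Where \<open>Q\<close> is nonzero the vectors \<open>e k p\<close> span
  \<open>W\<close>, since they generate every \<open>Q p * w k\<close>. A relation among them would
  leave fewer than \<open>card \<kappa>\<close> vectors spanning the same space.\<close>

lemma spans_indep_at:
  fixes e :: "nat \<Rightarrow> ('n \<Rightarrow> 'k) \<Rightarrow> 'n \<Rightarrow> 'k"
  assumes sp: "spans W {..<card \<kappa>} e E" and p: "p \<in> W" "Q p \<noteq> 0"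
    and a: "\<And>i. (\<Sum>k<card \<kappa>. a k * e k p i) = 0" and k0: "k0 < card \<kappa>"
  shows "a k0 = 0"
proof (rule ccontr)
  assume a0: "a k0 \<noteq> 0"
  let ?n = "card \<kappa>"
  have "\<forall>k\<in>\<kappa>. \<exists>c. \<forall>i. Q p * w k i = (\<Sum>j<?n. c j * e j p i)"
  proof
    fix k assume "k \<in> \<kappa>"
    obtain c where "\<forall>j\<in>{..<?n}. c j \<in> polyfun"
      and "\<forall>x\<in>W. \<forall>i. Q x * w k i = (\<Sum>j<?n. c j x * e j x i)"
      by (rule spansE [OF sp QE [OF \<open>k \<in> \<kappa>\<close>]])
    with p show "\<exists>c. \<forall>i. Q p * w k i = (\<Sum>j<?n. c j * e j p i)"
      by (intro exI [of _ "\<lambda>j. c j p"]) auto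
  qed
  then obtain c where c: "\<And>k i. k \<in> \<kappa> \<Longrightarrow> Q p * w k i = (\<Sum>j<?n. c k j * e j p i)" by metis
  \<comment> \<open>A multiple of the relation is subtracted so that the coefficient of
    \<open>e k0\<close> becomes zero.\<close>
  define u where "u k j = c k j - c k k0 / a k0 * a j" for k j
  have u: "Q p * w k i = (\<Sum>j\<in>{..<?n} - {k0}. u k j * e j p i)" if "k \<in> \<kappa>" for k i
  proof -
    have "(\<Sum>j<?n. u k j * e j p i) = (\<Sum>j<?n. c k j * e j p i) - c k k0 / a k0 * (\<Sum>j<?n. a j * e j p i)"
      by (simp add: u_def left_diff_distrib sum_subtractf sum_distrib_left mult.assoc)
    also have "\<dots> = Q p * w k i" using a c that by simp
    finally have "Q p * w k i = (\<Sum>j<?n. u k j * e j p i)" by simp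
    also have "\<dots> = u k k0 * e k0 p i + (\<Sum>j\<in>{..<?n} - {k0}. u k j * e j p i)"
      by (rule sum.remove) (use k0 in auto)
    also have "u k k0 = 0" using a0 by (simp add: u_def)
    finally show ?thesis by simp
  qed
  have "card ({..<?n} - {k0}) < card \<kappa>" using k0 by simp
  then obtain b where b: "\<exists>k\<in>\<kappa>. b k \<noteq> 0" "\<And>j. j \<in> {..<?n} - {k0} \<Longrightarrow> (\<Sum>k\<in>\<kappa>. b k * u k j) = 0"
    using underdetermined_system [of "{..<?n} - {k0}" \<kappa> u] by auto
  have "b l = 0" if l: "l \<in> \<kappa>" for l
  proof -
    have "Q p * b l = (\<Sum>k\<in>\<kappa>. b k * (Q p * w k l))"
      using l by (simp add: w_dual if_distrib [of "\<lambda>x. _ * x"] sum.delta mult.commute cong: if_cong)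
    also have "\<dots> = (\<Sum>k\<in>\<kappa>. b k * (\<Sum>j\<in>{..<?n} - {k0}. u k j * e j p l))"
      using u by simp
    also have "\<dots> = (\<Sum>j\<in>{..<?n} - {k0}. (\<Sum>k\<in>\<kappa>. b k * u k j) * e j p l)"
      unfolding sum_distrib_left sum_distrib_right by (subst sum.swap) (simp add: mult.assoc)
    also have "\<dots> = 0" using b(2) by simp
    finally show ?thesis using p by simp
  qed
  with b(1) show False by blast
qed

lemma spans_indep:
  fixes e :: "nat \<Rightarrow> ('n \<Rightarrow> 'k) \<Rightarrow> 'n \<Rightarrow> 'k"
  assumes sp: "spans W {..<card \<kappa>} e E" and c: "c k \<in> polyfun"
    and eq: "\<And>x i. x \<in> W \<Longrightarrow> (\<Sum>k<card \<kappa>. c k x * e k x i) = 0" and k: "k < card \<kappa>" and x: "x \<in> W"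
  shows "c k x = 0"
proof (rule polyfun_cancel [OF W Q(1) c Q(2) _ x])
  fix x assume x: "x \<in> W"
  show "Q x * c k x = 0"
    using spans_indep_at [OF sp x, of "\<lambda>k. c k x", OF _ eq [OF x] k] by (cases "Q x = 0") auto
qed

lemma mem_M_E:
  assumes "\<delta> \<in> M"
  obtains V where "V \<in> E" "dfield W V = \<delta>" "\<And>x. x \<in> W \<Longrightarrow> V x = vf W \<delta> x"
proof -
  have \<delta>: "\<delta> \<in> derivations W" using assms M by auto
  obtain V where V: "polymap V" "\<forall>x\<in>W. V x = vf W \<delta> x" using vf_extension [OF \<delta>] by auto
  have t: "V x \<in> W" if "x \<in> W" for x using V that vf_in [OF \<delta> that] by simp
  have "dfield W V = \<delta>" by (rule dfield_vf [OF \<delta> W]) (use V t in auto)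
  with V t assms show ?thesis by (intro that [of V]) (auto simp: E)
qed

lemma generated_imp_free:
  assumes "generated_by W (card \<kappa>) E" shows "free_module_over W M"
proof -
  let ?n = "card \<kappa>"
  obtain e where e: "\<And>k. k < ?n \<Longrightarrow> e k \<in> E" and sp: "spans W {..<?n} e E"
    using assms by (auto simp: generated_by_def)
  note ind = spans_indep_at [OF sp]
  have et: "e k x \<in> W" if "k < ?n" "x \<in> W" for k x using e that by (auto simp: E)
  define d where "d k = dfield W (e k)" for k
  have dx: "d k (restr W (\<lambda>x. x i)) x = e k x i" if "k < ?n" "x \<in> W" for k x i
    unfolding d_def by (subst dfield_coord [OF W]) (use that et in auto)
  obtain p where p: "p \<in> W" "Q p \<noteq> 0" using Q by blast
  \<comment> \<open>A basis in \<open>free_module_over\<close> is a set, so the generators must be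
    distinct; two equal ones would give a relation with coefficients 1 and -1.\<close>
  have inj: "inj_on d {..<?n}"
  proof (rule inj_onI, rule ccontr)
    fix k j assume kj: "k \<in> {..<?n}" "j \<in> {..<?n}" "d k = d j" "k \<noteq> j"
    define a where "a l = (if l = k then 1 else if l = j then -1 else 0 :: 'k)" for l
    have "(\<Sum>l<?n. a l * e l p i) = 0" for i
    proof -
      have "e k p i = e j p i" using kj p dx [of k p i] dx [of j p i] by simp
      moreover have "(\<Sum>l<?n. a l * e l p i) = (\<Sum>l\<in>{k, j}. a l * e l p i)"
        by (rule sum.mono_neutral_right) (use kj in \<open>auto simp: a_def\<close>)
      ultimately show ?thesis using kj by (simp add: a_def)
    qed
    from ind [OF p, of a, OF this, of k] kj show False by (simp add: a_def)
  qed
  define B where "B = d ` {..<?n}"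
  have BM: "B \<subseteq> M" using e by (auto simp: B_def d_def E)
  have gen: "\<exists>B' c. finite B' \<and> B' \<subseteq> B \<and> (\<forall>b\<in>B'. c b \<in> coord_ring W) \<and>
        m = (\<lambda>f x. \<Sum>b\<in>B'. c b x * b f x)" if m: "m \<in> M" for m
  proof -
    obtain V where V: "V \<in> E" "dfield W V = m" by (rule mem_M_E [OF m])
    obtain c where c1: "\<forall>k\<in>{..<?n}. c k \<in> polyfun"
      and c2: "\<forall>x\<in>W. \<forall>i. V x i = (\<Sum>k<?n. c k x * e k x i)"
      using V(1) sp unfolding spans_def by blast
    have c: "\<And>k. k < ?n \<Longrightarrow> c k \<in> polyfun"
      "\<And>x i. x \<in> W \<Longrightarrow> V x i = (\<Sum>k<?n. c k x * e k x i)"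
      using c1 c2 by blast+
    define c' where "c' b = restr W (c (the_inv_into {..<?n} d b))" for b
    have c'd: "c' (d k) = restr W (c k)" if "k < ?n" for k
      using that inj by (simp add: c'_def the_inv_into_f_f)
    have "m f x = (\<Sum>b\<in>B. c' b x * b f x)" for f x
    proof -
      have "(\<Sum>b\<in>B. c' b x * b f x) = (\<Sum>k<?n. restr W (c k) x * d k f x)"
        unfolding B_def using inj by (simp add: sum.reindex c'd)
      also have "\<dots> = m f x"
      proof (cases "f \<in> coord_ring W \<and> x \<in> W")
        case True
        then obtain g where g: "g \<in> polyfun" "f = restr W g" by (auto elim: coord_ringE)
        have "m f x = grad g x (V x)"
          using V True g dfield_restr [OF W _ g(1), of V] by (auto simp: E)
        also have "V x = (\<lambda>i. \<Sum>k<?n. c k x * e k x i)" by (rule ext) (use c(2) True in blast)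
        also have "grad g x \<dots> = (\<Sum>k<?n. c k x * grad g x (e k x))" by (rule grad_sum [OF g(1)])
        also have "\<dots> = (\<Sum>k<?n. restr W (c k) x * d k f x)"
          unfolding d_def g(2)
          by (rule sum.cong [OF refl], subst dfield_restr [OF W _ g(1)]) (use True et in auto)
        finally show ?thesis by simp
      next
        case False
        then show ?thesis by (auto simp: V(2) [symmetric] d_def dfield_def restr_def)
      qed
      finally show ?thesis by simp
    qed
    moreover have "\<forall>b\<in>B. c' b \<in> coord_ring W" using c(1) c'd by (auto simp: B_def)
    moreover have "finite B" by (simp add: B_def)
    ultimately show ?thesis by (intro exI [of _ B] exI [of _ c']) auto
  qed
  have indep: "c b = (\<lambda>x. 0)" if B': "finite B'" "B' \<subseteq> B" "\<forall>b\<in>B'. c b \<in> coord_ring W"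
      "(\<lambda>f x. \<Sum>b\<in>B'. c b x * b f x) = (\<lambda>f x. 0)" and b: "b \<in> B'" for B' c b
  proof -
    obtain k0 where k0: "k0 < ?n" "b = d k0" using b B' by (auto simp: B_def)
    have z: "c b x = 0" if x: "x \<in> W" "Q x \<noteq> 0" for x
    proof -
      define a where "a k = (if d k \<in> B' then c (d k) x else 0)" for k
      have "(\<Sum>k<?n. a k * e k x i) = 0" for i
      proof -
        have "(\<Sum>k<?n. a k * e k x i) = (\<Sum>k<?n. (\<lambda>b. if b \<in> B' then c b x * b (restr W (\<lambda>x. x i)) x else 0) (d k))"
          by (rule sum.cong) (use dx x in \<open>auto simp: a_def\<close>)
        also have "\<dots> = (\<Sum>b\<in>B. if b \<in> B' then c b x * b (restr W (\<lambda>x. x i)) x else 0)"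
          unfolding B_def using inj by (simp add: sum.reindex)
        also have "\<dots> = (\<Sum>b\<in>B'. c b x * b (restr W (\<lambda>x. x i)) x)"
          using B' by (intro sum.mono_neutral_cong_right) (auto simp: B_def)
        also have "\<dots> = 0" using fun_cong [OF fun_cong [OF B'(4)]] by simp
        finally show ?thesis .
      qed
      from ind [OF x, of a, OF this k0(1)] show ?thesis using k0 b by (simp add: a_def)
    qed
    obtain g where g: "g \<in> polyfun" "c b = restr W g" using B'(3) b by (auto elim: coord_ringE)
    have "g x = 0" if "x \<in> W" for x
      by (rule polyfun_cancel [OF W Q(1) g(1) Q(2) _ that]) (use z g in force)
    with g show ?thesis by (auto simp: restr_def)
  qed
  show ?thesis
    unfolding free_module_over_def
  proof (intro exI [of _ B] conjI allI impI)
    fix B' c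
    assume h: "finite B' \<and> B' \<subseteq> B \<and> (\<forall>b\<in>B'. c b \<in> coord_ring W) \<and>
        (\<lambda>f x. \<Sum>b\<in>B'. c b x * b f x) = (\<lambda>f x. 0)"
    from h have h': "finite B'" "B' \<subseteq> B" "\<forall>b\<in>B'. c b \<in> coord_ring W"
        "(\<lambda>f x. \<Sum>b\<in>B'. c b x * b f x) = (\<lambda>f x. 0)"
      by - (elim conjE, assumption)+
    show "\<forall>b\<in>B'. c b = (\<lambda>x. 0)" using indep [OF h'] by (rule ballI)
  next
    show "\<forall>m\<in>M. \<exists>B' c. finite B' \<and> B' \<subseteq> B \<and> (\<forall>b\<in>B'. c b \<in> coord_ring W) \<and>
        m = (\<lambda>f x. \<Sum>b\<in>B'. c b x * b f x)" using gen by (rule ballI)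
  qed (rule BM)
qed

text \<open>The given basis \<open>B\<close> may a priori be infinite. Expanding
  \<open>Q * w k\<close> in \<open>B\<close> and each \<open>b\<close> in coordinates factors
  \<open>Q\<close> times the identity through the coordinates in \<open>\<kappa>\<close>; this
  bounds \<open>B\<close>, and representatives of its elements generate \<open>E\<close>.\<close>

lemma free_imp_generated:
  assumes "free_module_over W M" shows "generated_by W (card \<kappa>) E"
proof -
  from assms obtain B where BM: "B \<subseteq> M"
    and sp0: "\<forall>m\<in>M. \<exists>B' c. finite B' \<and> B' \<subseteq> B \<and> (\<forall>b\<in>B'. c b \<in> coord_ring W) \<and>
        m = (\<lambda>f x. \<Sum>b\<in>B'. c b x * b f x)"
    and ind0: "\<forall>B' c. finite B' \<and> B' \<subseteq> B \<and> (\<forall>b\<in>B'. c b \<in> coord_ring W) \<and>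
        (\<lambda>f x. \<Sum>b\<in>B'. c b x * b f x) = (\<lambda>f x. 0) \<longrightarrow> (\<forall>b\<in>B'. c b = (\<lambda>x. 0))"
    unfolding free_module_over_def by (elim exE conjE) (rule that, assumption+)
  have sp: "\<exists>B' c. finite B' \<and> B' \<subseteq> B \<and> (\<forall>b\<in>B'. c b \<in> coord_ring W) \<and>
        m = (\<lambda>f x. \<Sum>b\<in>B'. c b x * b f x)" if "m \<in> M" for m
    using sp0 that by (rule bspec)
  have ind: "c b = (\<lambda>x. 0)" if "finite B'" "B' \<subseteq> B" "\<forall>b\<in>B'. c b \<in> coord_ring W"
      "\<And>f x. (\<Sum>b\<in>B'. c b x * b f x) = 0" "b \<in> B'" for B' c b
  proof -
    have "(\<lambda>f x. \<Sum>b\<in>B'. c b x * b f x) = (\<lambda>f x. 0)" by (intro ext) (rule that(4))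
    with ind0 [THEN spec, THEN spec, THEN mp, of B' c] that show ?thesis by blast
  qed
  have Bd: "b \<in> derivations W" if "b \<in> B" for b using that BM M by auto
  have "\<forall>k\<in>\<kappa>. \<exists>B' c. finite B' \<and> B' \<subseteq> B \<and> (\<forall>b\<in>B'. c b \<in> coord_ring W) \<and>
        dfield W (\<lambda>x i. Q x * w k i) = (\<lambda>f x. \<Sum>b\<in>B'. c b x * b f x)"
    using sp QE by (simp add: E)
  from bchoice [OF this] obtain S' where "\<forall>k\<in>\<kappa>. \<exists>c. finite (S' k) \<and> S' k \<subseteq> B \<and>
        (\<forall>b\<in>S' k. c b \<in> coord_ring W) \<and>
        dfield W (\<lambda>x i. Q x * w k i) = (\<lambda>f x. \<Sum>b\<in>S' k. c b x * b f x)" by (rule exE)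
  from bchoice [OF this] obtain c where Sc: "\<forall>k\<in>\<kappa>. finite (S' k) \<and> S' k \<subseteq> B \<and>
        (\<forall>b\<in>S' k. c k b \<in> coord_ring W) \<and>
        dfield W (\<lambda>x i. Q x * w k i) = (\<lambda>f x. \<Sum>b\<in>S' k. c k b x * b f x)" by (rule exE)
  then have S': "\<And>k. k \<in> \<kappa> \<Longrightarrow> finite (S' k)" "\<And>k. k \<in> \<kappa> \<Longrightarrow> S' k \<subseteq> B"
    and c: "\<And>k b. k \<in> \<kappa> \<Longrightarrow> b \<in> S' k \<Longrightarrow> c k b \<in> coord_ring W"
    and dQ: "\<And>k. k \<in> \<kappa> \<Longrightarrow> dfield W (\<lambda>x i. Q x * w k i) = (\<lambda>f x. \<Sum>b\<in>S' k. c k b x * b f x)"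
    by blast+
  define u where "u k b = (if b \<in> S' k then c k b else restr W (\<lambda>_. 0))" for k b
  have ur: "u k b \<in> coord_ring W" if "k \<in> \<kappa>" for k b
    using c [OF that] by (auto simp: u_def intro: polyfun.const)
  define S where "S = (\<Union>k\<in>\<kappa>. S' k)"
  have S: "finite S" "S \<subseteq> B" using S' by (auto simp: S_def)
  have Bring: "(\<lambda>x. vf W b x k) \<in> coord_ring W" if "b \<in> B" for b k
    using der_ring [OF Bd [OF that] restr_in_ring [OF polyfun.coord [of k]]] by (simp add: vf_def)
  \<comment> \<open>Comparison of two expansions of \<open>Q * b\<close> in the basis: trivially as
    a multiple of \<open>b\<close>, and through the coordinates of \<open>b\<close> and the
    expansions of the \<open>Q * w k\<close>.\<close>
  have rel: "(if b' = b then Q x else 0) = (\<Sum>k\<in>\<kappa>. vf W b x k * u k b' x)"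
    if T: "finite T" "T \<subseteq> B" "S \<subseteq> T" "b \<in> T" "b' \<in> T" and x: "x \<in> W" for T b b' x
  proof -
    define C where "C b' x = (if b' = b then restr W Q x else 0) - (\<Sum>k\<in>\<kappa>. vf W b x k * u k b' x)" for b' x
    have b: "b \<in> B" using T by auto
    have Cz: "(\<Sum>b'\<in>T. C b' x * b' f x) = 0" for f x
    proof (cases "f \<in> coord_ring W \<and> x \<in> W")
      case True
      then obtain g where g: "g \<in> polyfun" "f = restr W g" by (auto elim: coord_ringE)
      have "(\<Sum>b'\<in>T. (if b' = b then restr W Q x else 0) * b' f x) = Q x * b f x"
        using T True by (simp add: if_distrib [of "\<lambda>y. y * _"] sum.delta' cong: if_cong)
      also have "b f x = grad g x (vf W b x)" using der_grad [OF Bd [OF b] g(1)] True g by simp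
      also have "vf W b x = (\<lambda>i. \<Sum>k\<in>\<kappa>. vf W b x k * w k i)"
        by (rule ext) (use w_expand [OF vf_in [OF Bd [OF b]]] True in blast)
      also have "grad g x \<dots> = (\<Sum>k\<in>\<kappa>. vf W b x k * grad g x (w k))" by (rule grad_sum [OF g(1)])
      also have "Q x * \<dots> = (\<Sum>k\<in>\<kappa>. vf W b x k * (\<Sum>b'\<in>T. u k b' x * b' f x))"
        unfolding sum_distrib_left
      proof (rule sum.cong [OF refl])
        fix k assume k: "k \<in> \<kappa>"
        have "(\<Sum>b'\<in>T. u k b' x * b' f x) = (\<Sum>b'\<in>S' k. c k b' x * b' f x)"
          by (rule sum.mono_neutral_cong_right) (use T k in \<open>auto simp: S_def u_def restr_def\<close>)
        also have "\<dots> = dfield W (\<lambda>x i. Q x * w k i) f x" using dQ [OF k] by simp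
        also have "\<dots> = grad g x (\<lambda>i. Q x * w k i)"
          using True g subsp_scale [OF W w_in [OF k]] by (simp add: dfield_restr [OF W])
        also have "\<dots> = Q x * grad g x (w k)" by (rule grad_scale [OF g(1)])
        finally have "vf W b x k * (\<Sum>b'\<in>T. u k b' x * b' f x) = Q x * (vf W b x k * grad g x (w k))"
          by simp
        then show "Q x * (vf W b x k * grad g x (w k)) = (\<Sum>n\<in>T. vf W b x k * (u k n x * n f x))"
          unfolding sum_distrib_left by (rule sym)
      qed
      also have "\<dots> = (\<Sum>b'\<in>T. (\<Sum>k\<in>\<kappa>. vf W b x k * u k b' x) * b' f x)"
        unfolding sum_distrib_left sum_distrib_right by (subst sum.swap) (simp add: mult.assoc)
      finally show ?thesis
        by (simp add: C_def left_diff_distrib sum_subtractf)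
    next
      case False
      have "C b' x * b' f x = 0" if "b' \<in> T" for b'
        using False der_outside [OF Bd, of b' x f] der_not_ring [OF Bd, of b' f] that T by auto
      then show ?thesis by (intro sum.neutral ballI)
    qed
    have Cr: "\<forall>b'\<in>T. C b' \<in> coord_ring W"
    proof
      fix b' assume "b' \<in> T"
      have "\<forall>k. \<exists>g. k \<in> \<kappa> \<longrightarrow> g \<in> polyfun \<and> u k b' = restr W g" using ur by (metis coord_ringE)
      then obtain g where g: "\<And>k. k \<in> \<kappa> \<Longrightarrow> g k \<in> polyfun" "\<And>k. k \<in> \<kappa> \<Longrightarrow> u k b' = restr W (g k)" by metis
      have "\<forall>k. \<exists>h. h \<in> polyfun \<and> (\<lambda>x. vf W b x k) = restr W h" using Bring [OF b] by (metis coord_ringE)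
      then obtain h where h: "\<And>k. h k \<in> polyfun" "\<And>k. (\<lambda>x. vf W b x k) = restr W (h k)" by metis
      have h': "vf W b x k = restr W (h k) x" for x k using fun_cong [OF h(2)] .
      have "C b' = restr W (\<lambda>x. (if b' = b then Q x else 0) - (\<Sum>k\<in>\<kappa>. h k x * g k x))"
        using g by (auto simp: C_def h' restr_def fun_eq_iff)
      moreover have "(\<lambda>x. (if b' = b then Q x else 0)) \<in> polyfun"
        using Q by (cases "b' = b") (auto intro: polyfun.const)
      moreover have "(\<lambda>x. \<Sum>k\<in>\<kappa>. h k x * g k x) \<in> polyfun" using g h by (intro polyfun_intros)
      ultimately show "C b' \<in> coord_ring W" by (simp add: restr_in_ring polyfun_diff)
    qed
    have "C b' = (\<lambda>x. 0)" by (rule ind [OF T(1,2) Cr Cz T(5)])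
    from fun_cong [OF this, of x] x show ?thesis by (simp add: C_def split: if_splits)
  qed
  obtain p where p: "p \<in> W" "Q p \<noteq> 0" using Q by blast
  \<comment> \<open>An element outside \<open>S\<close> occurs in no expansion of a
    \<open>Q * w k\<close>, so its diagonal relation would give \<open>Q p = 0\<close>.\<close>
  have "B \<subseteq> S"
  proof
    fix b assume b: "b \<in> B"
    show "b \<in> S"
    proof (rule ccontr)
      assume "b \<notin> S"
      then have "u k b p = 0" if "k \<in> \<kappa>" for k using that by (auto simp: u_def S_def restr_def)
      moreover have "Q p = (\<Sum>k\<in>\<kappa>. vf W b p k * u k b p)"
        using rel [of "insert b S" b b p] S b p by (simp add: subset_insertI)
      ultimately show False using p by simp
    qed
  qed
  with S have BS: "S = B" "finite B" by auto
  \<comment> \<open>At \<open>p\<close> the relation factors \<open>Q p\<close> times the identity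
    matrix indexed by \<open>B\<close> through \<open>\<kappa>\<close>; a larger \<open>B\<close>
    would force a nonzero kernel.\<close>
  have cardB: "card B \<le> card \<kappa>"
  proof (rule ccontr)
    assume "\<not> card B \<le> card \<kappa>"
    then have lt: "card \<kappa> < card B" by simp
    obtain a where "(\<exists>b\<in>B. a b \<noteq> 0) \<and> (\<forall>k\<in>\<kappa>. (\<Sum>b\<in>B. a b * vf W b p k) = 0)"
      using underdetermined_system [OF finite BS(2) lt, of "\<lambda>b k. vf W b p k"] by (rule exE)
    then have a: "\<exists>b\<in>B. a b \<noteq> 0" "\<And>k. k \<in> \<kappa> \<Longrightarrow> (\<Sum>b\<in>B. a b * vf W b p k) = 0"
      by blast+
    have "a b' = 0" if b': "b' \<in> B" for b'
    proof -
      have "Q p * a b' = (\<Sum>b\<in>B. a b * (if b' = b then Q p else 0))"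
        using b' BS by (simp add: if_distrib [of "\<lambda>x. _ * x"] sum.delta' mult.commute cong: if_cong)
      also have "\<dots> = (\<Sum>b\<in>B. a b * (\<Sum>k\<in>\<kappa>. vf W b p k * u k b' p))"
        by (rule sum.cong [OF refl], subst rel [of B]) (use BS b' p in auto)
      also have "\<dots> = (\<Sum>k\<in>\<kappa>. (\<Sum>b\<in>B. a b * vf W b p k) * u k b' p)"
        unfolding sum_distrib_left sum_distrib_right by (subst sum.swap) (simp add: mult.assoc)
      also have "\<dots> = 0" using a(2) by simp
      finally show ?thesis using p by simp
    qed
    with a(1) show False by blast
  qed
  have "\<forall>b. \<exists>V. b \<in> B \<longrightarrow> V \<in> E \<and> (\<forall>x\<in>W. V x = vf W b x)"
    using mem_M_E BM by (metis subsetD)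
  then obtain h where h: "\<And>b. b \<in> B \<Longrightarrow> h b \<in> E" "\<And>b x. b \<in> B \<Longrightarrow> x \<in> W \<Longrightarrow> h b x = vf W b x"
    by metis
  have "spans W B h E"
    unfolding spans_def
  proof
    fix V assume V: "V \<in> E"
    then have "dfield W V \<in> M" by (simp add: E)
    from sp [OF this] obtain B' c where B': "finite B'" "B' \<subseteq> B" "\<forall>b\<in>B'. c b \<in> coord_ring W"
      "dfield W V = (\<lambda>f x. \<Sum>b\<in>B'. c b x * b f x)"
      by (elim exE conjE) (rule that, assumption+)
    have "\<forall>b. \<exists>g. b \<in> B' \<longrightarrow> g \<in> polyfun \<and> c b = restr W g" using B'(3) by (metis coord_ringE)
    then obtain g where g: "\<And>b. b \<in> B' \<Longrightarrow> g b \<in> polyfun" "\<And>b. b \<in> B' \<Longrightarrow> c b = restr W (g b)" by metis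
    let ?c = "\<lambda>b x. if b \<in> B' then g b x else 0"
    have "V x i = (\<Sum>b\<in>B. ?c b x * h b x i)" if x: "x \<in> W" for x i
    proof -
      have "V x i = dfield W V (restr W (\<lambda>x. x i)) x"
        using V x dfield_coord [OF W, of V i] by (auto simp: E)
      also have "\<dots> = (\<Sum>b\<in>B'. c b x * vf W b x i)" by (simp add: B'(4) vf_def)
      also have "\<dots> = (\<Sum>b\<in>B. ?c b x * h b x i)"
        by (rule sum.mono_neutral_cong_left) (use B' BS h g x in auto)
      finally show ?thesis .
    qed
    moreover have "\<forall>b\<in>B. ?c b \<in> polyfun"
    proof
      fix b show "?c b \<in> polyfun" using g by (cases "b \<in> B'") (auto intro: polyfun.const)
    qed
    ultimately show "\<exists>c. (\<forall>j\<in>B. c j \<in> polyfun) \<and> (\<forall>x\<in>W. \<forall>i. V x i = (\<Sum>j\<in>B. c j x * h j x i))"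
      by (intro exI [of _ ?c]) blast
  qed
  with BS(2) cardB h(1) zero show ?thesis by (intro generated_byI [of B]) auto
qed

lemma free_iff_generated: "free_module_over W M \<longleftrightarrow> generated_by W (card \<kappa>) E"
  using generated_imp_free free_imp_generated by blast

end

end

section \<open>Logarithmic vector fields\<close>

definition nrm :: "('n::finite \<Rightarrow> 'k::field_char_0) set \<Rightarrow> 'n \<Rightarrow> 'k" where
  "nrm H = (SOME b. b \<noteq> (\<lambda>_. 0) \<and> H = hyp b)"

lemma nrm:
  assumes "is_hyperplane H" shows nrm_nonzero: "nrm H \<noteq> (\<lambda>_. 0)" and hyp_nrm: "hyp (nrm H) = H"
  using someI_ex [of "\<lambda>b. b \<noteq> (\<lambda>_. 0) \<and> H = hyp b"] assms
  by (auto simp: is_hyperplane_def nrm_def)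

lemma in_hyp_iff: "is_hyperplane H \<Longrightarrow> x \<in> H \<longleftrightarrow> lin (nrm H) x = 0"
  using hyp_nrm [of H] by (auto simp: hyp_def)

lemma hyperplane_subsp: "is_hyperplane H \<Longrightarrow> subsp H"
  by (metis hyp_nrm subsp_hyp)

lemma hyperplane_subset_eq: "is_hyperplane H \<Longrightarrow> is_hyperplane H' \<Longrightarrow> H \<subseteq> H' \<Longrightarrow> H = H'"
  by (metis hyp_nrm nrm_nonzero hyp_subset_imp_eq)

text \<open>\<open>multi_der_module\<close> quantifies over all normals of a hyperplane; the scalar
  relating any of them to the chosen \<open>nrm H\<close> transfers the condition.\<close>

lemma hyperplane_normal_scaled:
  assumes "is_hyperplane H" "a \<noteq> (\<lambda>_. 0)" "H = hyp a"
  shows "\<exists>c. c \<noteq> 0 \<and> (\<forall>x. lin a x = c * lin (nrm H) x)"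
proof -
  have "\<exists>c. \<forall>x\<in>UNIV. lin a x = c * lin (nrm H) x"
  proof (rule lin_proportional [OF subsp_UNIV])
    show "lin a x = 0" if "lin (nrm H) x = 0" for x
      using that in_hyp_iff [OF assms(1), of x] assms(3) by (simp add: hyp_def)
  qed
  then obtain c where c: "\<forall>x. lin a x = c * lin (nrm H) x" by auto
  with assms(2) have "c \<noteq> 0" using lin_eq_zero_iff [of a] by auto
  with c show ?thesis by blast
qed

text \<open>Divisibility of the derivative of a defining form is encoded as tangency at the points
  of each hyperplane; \<open>lin_dvd\<close> makes the two equivalent.\<close>

definition Dfields :: "('n::finite \<Rightarrow> 'k::field_char_0) set set \<Rightarrow> (('n \<Rightarrow> 'k) \<Rightarrow> 'n \<Rightarrow> 'k) set" where
  "Dfields A = {V. polymap V \<and> (\<forall>H'\<in>A. \<forall>x\<in>H'. V x \<in> H')}"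

text \<open>Values lie in \<open>H\<close> at every point, not only at points of \<open>H\<close>:
  the form of \<open>H\<close> is annihilated, not merely mapped to a multiple of itself.\<close>

definition Mfields :: "('n::finite \<Rightarrow> 'k::field_char_0) set set \<Rightarrow> ('n \<Rightarrow> 'k) set \<Rightarrow> (('n \<Rightarrow> 'k) \<Rightarrow> 'n \<Rightarrow> 'k) set" where
  "Mfields A H = {V \<in> Dfields A. \<forall>x. V x \<in> H}"

text \<open>The fields live on the whole space, but apart from polynomiality every condition
  concerns their values on \<open>H\<close>; fields agreeing on \<open>H\<close> represent the same
  derivation of its coordinate ring.\<close>

definition Nfields :: "('n::finite \<Rightarrow> 'k::field_char_0) set set \<Rightarrow> ('n \<Rightarrow> 'k) set \<Rightarrow> (('n \<Rightarrow> 'k) \<Rightarrow> 'n \<Rightarrow> 'k) set" where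
  "Nfields A H = {V. polymap V \<and> (\<forall>x\<in>H. V x \<in> H) \<and> (\<forall>H'\<in>A - {H}. \<exists>g\<in>polyfun. \<forall>x\<in>H.
     lin (nrm H') (V x) = lin (nrm H') x ^ restr_mult A H (H' \<inter> H) * g x)}"

lemma NfieldsE:
  assumes "V \<in> Nfields A H" "H' \<in> A" "H' \<noteq> H"
  obtains g where "g \<in> polyfun"
    "\<forall>x\<in>H. lin (nrm H') (V x) = lin (nrm H') x ^ restr_mult A H (H' \<inter> H) * g x"
proof -
  from assms have "\<exists>g\<in>polyfun. \<forall>x\<in>H. lin (nrm H') (V x) = lin (nrm H') x ^ restr_mult A H (H' \<inter> H) * g x"
    by (simp add: Nfields_def)
  then show ?thesis using that by (elim bexE)
qed

lemma polymap_zero: "polymap (\<lambda>_ _. 0)"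
  by (simp add: polymap_def polyfun.const)

lemma polymap_scale: "c \<in> polyfun \<Longrightarrow> polymap V \<Longrightarrow> polymap (\<lambda>x i. c x * V x i)"
  by (simp add: polymap_def polyfun.mult)

lemma polymap_diff: "polymap U \<Longrightarrow> polymap V \<Longrightarrow> polymap (\<lambda>x i. U x i - V x i)"
  by (simp add: polymap_def polyfun_diff)

lemma polymap_sum:
  "(\<And>j. j \<in> J \<Longrightarrow> c j \<in> polyfun) \<Longrightarrow> (\<And>j. j \<in> J \<Longrightarrow> polymap (V j)) \<Longrightarrow> polymap (\<lambda>x i. \<Sum>j\<in>J. c j x * V j x i)"
  by (auto simp: polymap_def intro!: polyfun_sum polyfun.mult)

lemma polymap_const_dir: "c \<in> polyfun \<Longrightarrow> polymap (\<lambda>x i. c x * w i)"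
  by (simp add: polymap_def polyfun.mult polyfun.const)

lemma polymap_id: "polymap (\<lambda>x. x)"
  by (simp add: polymap_def polyfun.coord)

lemma Dfields_iff_der_module:
  assumes A: "is_central_arrangement A"
  shows "Dfields A = {V. polymap V \<and> (\<forall>x\<in>UNIV. V x \<in> UNIV) \<and> dfield UNIV V \<in> der_module A}"
proof -
  have r: "restr UNIV f = f" for f :: "('a \<Rightarrow> 'b) \<Rightarrow> 'b" by (simp add: restr_def)
  have dl: "dfield UNIV V (lin a) = (\<lambda>x. lin a (V x))" for V :: "('a \<Rightarrow> 'b) \<Rightarrow> 'a \<Rightarrow> 'b" and a
    using dfield_lin [OF subsp_UNIV, of V a] by (simp add: r)
  have cr: "coord_ring UNIV = (polyfun :: (('a \<Rightarrow> 'b) \<Rightarrow> 'b) set)"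
    by (auto simp: coord_ring_def r)
  show ?thesis
  proof (rule set_eqI, rule iffI)
    fix V assume V: "V \<in> Dfields A"
    then have pm: "polymap V" by (simp add: Dfields_def)
    have "\<exists>g\<in>polyfun. (\<lambda>x. lin a (V x)) = (\<lambda>x. lin a x * g x)" if "hyp a \<in> A" for a
    proof -
      have "\<exists>g\<in>polyfun. \<forall>x\<in>UNIV. lin a (V x) = lin a x * g x"
        by (rule lin_dvd [OF subsp_UNIV lin_polymap [OF pm]])
          (use V that in \<open>auto simp: Dfields_def hyp_def\<close>)
      then show ?thesis by auto
    qed
    then show "V \<in> {V. polymap V \<and> (\<forall>x\<in>UNIV. V x \<in> UNIV) \<and> dfield UNIV V \<in> der_module A}"
      using dfield_derivation [OF subsp_UNIV pm] pm by (auto simp: der_module_def dl cr)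
  next
    fix V assume V: "V \<in> {V. polymap V \<and> (\<forall>x\<in>UNIV. V x \<in> UNIV) \<and> dfield UNIV V \<in> der_module A}"
    have "V x \<in> H'" if H': "H' \<in> A" "x \<in> H'" for H' x
    proof -
      obtain a where a: "a \<noteq> (\<lambda>_. 0)" "H' = hyp a"
        using H'(1) A unfolding is_central_arrangement_def is_hyperplane_def by meson
      have "dfield UNIV V \<in> der_module A" using V by simp
      with a that(1) have "\<exists>g\<in>coord_ring UNIV. dfield UNIV V (lin a) = (\<lambda>x. lin a x * g x)"
        unfolding der_module_def by simp
      then obtain g where "(\<lambda>x. lin a (V x)) = (\<lambda>x. lin a x * g x)"
        unfolding dl by (elim bexE)
      then have "lin a (V x) = lin a x * g x" by (rule fun_cong)
      with that(2) a show ?thesis by (simp add: hyp_def)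
    qed
    with V show "V \<in> Dfields A" by (simp add: Dfields_def)
  qed
qed

section \<open>Coordinates on the whole space and on a hyperplane\<close>

lemma coord_space_UNIV: "coord_space UNIV UNIV (\<lambda>k i. if i = k then 1 else 0)"
  by unfold_locales (auto simp: if_distrib cong: if_cong)

text \<open>Basis vectors of the hyperplane of \<open>a\<close>, obtained by solving its equation
  for coordinate \<open>i0\<close>.\<close>

definition hyp_dir :: "('n::finite \<Rightarrow> 'k::field_char_0) \<Rightarrow> 'n \<Rightarrow> 'n \<Rightarrow> 'n \<Rightarrow> 'k" where
  "hyp_dir a i0 k i = (if i = k then 1 else if i = i0 then - a k / a i0 else 0)"

lemma coord_space_hyp:
  assumes a: "a i0 \<noteq> 0" shows "coord_space (hyp a) (UNIV - {i0}) (hyp_dir a i0)"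
proof
  show "hyp_dir a i0 k \<in> hyp a" if "k \<in> UNIV - {i0}" for k
  proof -
    have "lin a (hyp_dir a i0 k) = (\<Sum>i\<in>{k, i0}. a i * hyp_dir a i0 k i)"
      unfolding lin_def by (rule sum.mono_neutral_right) (auto simp: hyp_dir_def)
    with that a show ?thesis by (auto simp: hyp_def hyp_dir_def)
  qed
  show "x i = (\<Sum>k\<in>UNIV - {i0}. x k * hyp_dir a i0 k i)" if x: "x \<in> hyp a" for x i
  proof (cases "i = i0")
    case False
    have "(\<Sum>k\<in>UNIV - {i0}. x k * hyp_dir a i0 k i) = (\<Sum>k\<in>UNIV - {i0}. if k = i then x k else 0)"
      by (rule sum.cong) (use False in \<open>auto simp: hyp_dir_def\<close>)
    with False show ?thesis by simp
  next
    case True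
    have "a i0 * x i0 + (\<Sum>k\<in>UNIV - {i0}. a k * x k) = 0"
      using x sum.remove [of UNIV i0 "\<lambda>k. a k * x k"] by (simp add: hyp_def lin_def)
    then have "x i0 = - (\<Sum>k\<in>UNIV - {i0}. a k * x k) / a i0"
      using a by (simp add: eq_neg_iff_add_eq_0 field_simps)
    also have "\<dots> = (\<Sum>k\<in>UNIV - {i0}. x k * hyp_dir a i0 k i0)"
      unfolding sum_divide_distrib sum_negf [symmetric]
      by (rule sum.cong) (auto simp: hyp_dir_def)
    finally show ?thesis using True by simp
  qed
qed (auto simp: hyp_dir_def)

lemma restr_mult_le:
  assumes "finite A" shows "restr_mult A H X \<le> card A"
  unfolding restr_mult_def by (rule card_mono) (use assms in auto)

section \<open>Freeness of an arrangement and of its restricted multiarrangement\<close>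

locale arr =
  fixes A :: "('n::finite \<Rightarrow> 'k::field_char_0) set set" and H :: "('n \<Rightarrow> 'k) set"
  assumes central: "is_central_arrangement A" and HA: "H \<in> A"
begin

abbreviation "\<alpha> \<equiv> lin (nrm H)"

lemma fin: "finite A" and hypl: "H' \<in> A \<Longrightarrow> is_hyperplane H'"
  using central by (auto simp: is_central_arrangement_def)

lemma H_iff: "x \<in> H \<longleftrightarrow> \<alpha> x = 0"
  by (rule in_hyp_iff [OF hypl [OF HA]])

lemma H_subsp: "subsp H"
  by (rule hyperplane_subsp [OF hypl [OF HA]])

lemma alpha_nonzero: "\<exists>x\<in>UNIV. \<alpha> x \<noteq> 0"
  using nrm_nonzero [OF hypl [OF HA]] lin_eq_zero_iff [of "nrm H"] by auto

lemma nonzero_on_hyperplane: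
  assumes "H1 \<in> A" "H2 \<in> A" "H1 \<noteq> H2" shows "\<exists>x\<in>H1. lin (nrm H2) x \<noteq> 0"
  using hyperplane_subset_eq [OF hypl [OF assms(1)] hypl [OF assms(2)]] assms(3)
    in_hyp_iff [OF hypl [OF assms(2)]] by blast

lemma zero_div_alpha:
  assumes "H' \<in> A" "H' \<noteq> H" "f \<in> polyfun" "\<And>x. x \<in> H' \<Longrightarrow> \<alpha> x * f x = 0" "x \<in> H'"
  shows "f x = 0"
  by (rule polyfun_cancel [OF hyperplane_subsp [OF hypl [OF assms(1)]] polyfun_lin assms(3)
        nonzero_on_hyperplane [OF assms(1) HA assms(2)] assms(4,5)])

text \<open>The polynomial \<open>Q\<close> of the freeness criterion for the arrangement: a
  constant field multiplied by it vanishes on every hyperplane of \<open>A\<close> and so is tangent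
  to it.\<close>

definition QA where "QA x = (\<Prod>H'\<in>A. lin (nrm H') x)"

lemma QA: "QA \<in> polyfun" "\<exists>p\<in>UNIV. QA p \<noteq> 0" "\<And>H' x. H' \<in> A \<Longrightarrow> x \<in> H' \<Longrightarrow> QA x = 0"
proof -
  show "QA \<in> polyfun" unfolding QA_def [abs_def] by (intro polyfun_intros)
  show "\<exists>p\<in>UNIV. QA p \<noteq> 0"
    unfolding QA_def
    by (rule polyfun_prod_nonzero [OF subsp_UNIV fin])
      (use nrm_nonzero [OF hypl] lin_eq_zero_iff in \<open>auto intro: polyfun_intros\<close>)
  show "QA x = 0" if "H' \<in> A" "x \<in> H'" for H' x
    unfolding QA_def using that in_hyp_iff [OF hypl] by (intro prod_zero fin) auto
qed

lemma Dfields_zero: "(\<lambda>_ _. 0) \<in> Dfields A"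
  using subsp_zero [OF hyperplane_subsp [OF hypl]] by (auto simp: Dfields_def polymap_zero)

lemma Dfields_const_dir: "(\<lambda>x i. QA x * w i) \<in> Dfields A"
  using subsp_zero [OF hyperplane_subsp [OF hypl]] QA(3)
  by (auto simp: Dfields_def polymap_const_dir QA(1))

lemma der_module_subset: "der_module A \<subseteq> derivations UNIV"
  by (auto simp: der_module_def)

lemma free_arrangement_iff: "free_arrangement A \<longleftrightarrow> generated_by UNIV (card (UNIV :: 'n set)) (Dfields A)"
  unfolding free_arrangement_def
  by (rule coord_space.free_iff_generated [OF coord_space_UNIV der_module_subset
        Dfields_iff_der_module [OF central] QA(1,2) Dfields_const_dir Dfields_zero])

lemma Dfields_indep:
  fixes e :: "nat \<Rightarrow> ('n \<Rightarrow> 'k) \<Rightarrow> 'n \<Rightarrow> 'k"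
  assumes "spans UNIV {..<(card (UNIV :: 'n set))} e (Dfields A)" "c k \<in> polyfun"
    and "\<And>x i. (\<Sum>k<(card (UNIV :: 'n set)). c k x * e k x i) = 0" and "k < (card (UNIV :: 'n set))"
  shows "c k x = 0"
  by (rule coord_space.spans_indep [OF coord_space_UNIV der_module_subset
        Dfields_iff_der_module [OF central] QA(1,2) Dfields_const_dir Dfields_zero assms]) simp

text \<open>The exponent \<open>card A\<close> bounds every multiplicity, so this multiplier makes a
  constant field of \<open>H\<close> satisfy all divisibility conditions at once.\<close>

definition QH where "QH x = (\<Prod>H'\<in>A - {H}. lin (nrm H') x) ^ card A"

lemma QH: "QH \<in> polyfun" "\<exists>p\<in>H. QH p \<noteq> 0"
proof -
  show "QH \<in> polyfun" unfolding QH_def [abs_def] by (intro polyfun_intros)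
  have "\<exists>p\<in>H. (\<Prod>H'\<in>A - {H}. lin (nrm H') p) \<noteq> 0"
    by (rule polyfun_prod_nonzero [OF H_subsp])
      (use fin subsp_zero [OF H_subsp] nonzero_on_hyperplane [OF HA] in \<open>auto intro: polyfun_intros\<close>)
  then show "\<exists>p\<in>H. QH p \<noteq> 0" by (auto simp: QH_def)
qed

lemma Nfields_zero: "(\<lambda>_ _. 0) \<in> Nfields A H"
  using subsp_zero [OF H_subsp] by (auto simp: Nfields_def polymap_zero intro!: bexI [of _ "\<lambda>_. 0"] polyfun.const)

lemma Nfields_const_dir: assumes "w \<in> H" shows "(\<lambda>x i. QH x * w i) \<in> Nfields A H"
proof -
  have "\<exists>g\<in>polyfun. \<forall>x\<in>H. lin (nrm H') (\<lambda>i. QH x * w i)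
      = lin (nrm H') x ^ restr_mult A H (H' \<inter> H) * g x" if H': "H' \<in> A - {H}" for H'
  proof -
    let ?m = "restr_mult A H (H' \<inter> H)" and ?b = "lin (nrm H')"
    let ?g = "\<lambda>x. ?b x ^ (card A - ?m) * (\<Prod>H''\<in>A - {H} - {H'}. lin (nrm H'') x) ^ card A * ?b w"
    have "?b x ^ card A = ?b x ^ ?m * ?b x ^ (card A - ?m)" for x
      using restr_mult_le [OF fin] by (simp flip: power_add)
    moreover have "QH x = ?b x ^ card A * (\<Prod>H''\<in>A - {H} - {H'}. lin (nrm H'') x) ^ card A" for x
      using H' fin by (simp add: QH_def prod.remove [of "A - {H}" H'] power_mult_distrib)
    ultimately have "?b (\<lambda>i. QH x * w i) = ?b x ^ ?m * ?g x" for x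
      by (simp add: lin_scale mult.assoc)
    moreover have "?g \<in> polyfun" by (intro polyfun_intros)
    ultimately show ?thesis by (intro bexI [of _ ?g]) auto
  qed
  with assms show ?thesis
    using subsp_scale [OF H_subsp assms] by (auto simp: Nfields_def polymap_const_dir QH(1))
qed

lemma Nfields_iff_multi_der_module:
  "Nfields A H = {V. polymap V \<and> (\<forall>x\<in>H. V x \<in> H) \<and> dfield H V \<in> multi_der_module A H}"
proof (rule set_eqI, rule iffI)
  fix V assume V: "V \<in> Nfields A H"
  then have pm: "polymap V" and t: "\<And>x. x \<in> H \<Longrightarrow> V x \<in> H" by (auto simp: Nfields_def)
  have "\<exists>g\<in>coord_ring H. dfield H V (restr H (lin a)) = (\<lambda>x. restr H (lin a) x ^ restr_mult A H X * g x)"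
    if H': "H' \<in> A - {H}" and X: "H' \<inter> H = X" and a: "a \<noteq> (\<lambda>_. 0)" "H' = hyp a" for X H' a
  proof -
    obtain c where c: "c \<noteq> 0" "\<And>x. lin a x = c * lin (nrm H') x"
      using hyperplane_normal_scaled [OF hypl a] H' by blast
    obtain g where g: "g \<in> polyfun" "\<forall>x\<in>H. lin (nrm H') (V x) = lin (nrm H') x ^ restr_mult A H X * g x"
      using NfieldsE [OF V, of H'] H' unfolding X by auto
    \<comment> \<open>Replacing the form of \<open>nrm H'\<close> by \<open>c\<close> times itself
      multiplies the derivative by \<open>c\<close> and the power by \<open>c\<close> to the
      multiplicity.\<close>
    let ?g = "\<lambda>x. c / c ^ restr_mult A H X * g x"
    have "?g \<in> polyfun" using g by (intro polyfun_intros)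
    moreover have "dfield H V (restr H (lin a)) = (\<lambda>x. restr H (lin a) x ^ restr_mult A H X * restr H ?g x)"
    proof (subst dfield_lin [OF H_subsp t], assumption, rule ext)
      fix x
      show "restr H (\<lambda>x. lin a (V x)) x = restr H (lin a) x ^ restr_mult A H X * restr H ?g x"
        using c g by (simp add: restr_def power_mult_distrib)
    qed
    ultimately show ?thesis by (intro bexI [of _ "restr H ?g"]) auto
  qed
  with dfield_derivation [OF H_subsp pm t] have "dfield H V \<in> multi_der_module A H"
    unfolding multi_der_module_def by blast
  with pm t show "V \<in> {V. polymap V \<and> (\<forall>x\<in>H. V x \<in> H) \<and> dfield H V \<in> multi_der_module A H}" by blast
next
  fix V assume "V \<in> {V. polymap V \<and> (\<forall>x\<in>H. V x \<in> H) \<and> dfield H V \<in> multi_der_module A H}"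
  then have pm: "polymap V" and t: "\<And>x. x \<in> H \<Longrightarrow> V x \<in> H" and V: "dfield H V \<in> multi_der_module A H"
    by auto
  have "\<exists>g\<in>polyfun. \<forall>x\<in>H. lin (nrm H') (V x) = lin (nrm H') x ^ restr_mult A H (H' \<inter> H) * g x"
    if H': "H' \<in> A - {H}" for H'
  proof -
    have "H' \<inter> H \<in> restriction A H" using H' by (auto simp: restriction_def)
    moreover have "nrm H' \<noteq> (\<lambda>_. 0)" "H' = hyp (nrm H')" using nrm [OF hypl] H' by auto
    ultimately obtain g where g: "g \<in> coord_ring H"
      "dfield H V (restr H (lin (nrm H'))) = (\<lambda>x. restr H (lin (nrm H')) x ^ restr_mult A H (H' \<inter> H) * g x)"
      using V H' unfolding multi_der_module_def by blast
    obtain g' where g': "g' \<in> polyfun" "g = restr H g'" using g(1) by (rule coord_ringE)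
    have "lin (nrm H') (V x) = lin (nrm H') x ^ restr_mult A H (H' \<inter> H) * g' x" if "x \<in> H" for x
      using fun_cong [OF g(2), of x] that g'
      by (simp add: dfield_lin [OF H_subsp t])
    with g' show ?thesis by blast
  qed
  with pm t show "V \<in> Nfields A H" by (simp add: Nfields_def)
qed

lemma multi_der_module_subset: "multi_der_module A H \<subseteq> derivations H"
  by (auto simp: multi_der_module_def)

lemma coord_space_H: "\<exists>i0. nrm H i0 \<noteq> 0 \<and> coord_space H (UNIV - {i0}) (hyp_dir (nrm H) i0)"
proof -
  obtain i0 where "nrm H i0 \<noteq> 0" using nrm_nonzero [OF hypl [OF HA]] by auto
  with coord_space_hyp [of "nrm H" i0] hyp_nrm [OF hypl [OF HA]] show ?thesis by auto
qed

lemma free_restricted_iff: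
  "free_restricted_multiarrangement A H \<longleftrightarrow> generated_by H (card (UNIV :: 'n set) - 1) (Nfields A H)"
proof -
  obtain i0 where cs: "coord_space H (UNIV - {i0}) (hyp_dir (nrm H) i0)" using coord_space_H by auto
  have c: "card (UNIV - {i0}) = (card (UNIV :: 'n set)) - 1" by simp
  show ?thesis
    unfolding free_restricted_multiarrangement_def c [symmetric]
    by (rule coord_space.free_iff_generated [OF cs multi_der_module_subset Nfields_iff_multi_der_module
        QH Nfields_const_dir [OF coord_space.w_in [OF cs]] Nfields_zero])
qed

lemma Nfields_indep:
  fixes e :: "nat \<Rightarrow> ('n \<Rightarrow> 'k) \<Rightarrow> 'n \<Rightarrow> 'k"
  assumes sp: "spans H {..<(card (UNIV :: 'n set)) - 1} e (Nfields A H)" and c: "c k \<in> polyfun"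
    and eq: "\<And>x i. x \<in> H \<Longrightarrow> (\<Sum>k<(card (UNIV :: 'n set)) - 1. c k x * e k x i) = 0"
    and k: "k < (card (UNIV :: 'n set)) - 1" and x: "x \<in> H"
  shows "c k x = 0"
proof -
  obtain i0 where cs: "coord_space H (UNIV - {i0}) (hyp_dir (nrm H) i0)" using coord_space_H by auto
  have n: "card (UNIV - {i0}) = (card (UNIV :: 'n set)) - 1" by simp
  show ?thesis
    by (rule coord_space.spans_indep [OF cs multi_der_module_subset Nfields_iff_multi_der_module
        QH Nfields_const_dir [OF coord_space.w_in [OF cs]] Nfields_zero, unfolded n, OF _ sp c eq k x])
qed

end

section \<open>Module operations, grading and division by the form of \<open>H\<close>\<close>

context arr
begin

lemma Dfields_sum:
  assumes "\<And>j. j \<in> J \<Longrightarrow> c j \<in> polyfun" "\<And>j. j \<in> J \<Longrightarrow> V j \<in> Dfields A"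
  shows "(\<lambda>x i. \<Sum>j\<in>J. c j x * V j x i) \<in> Dfields A"
  unfolding Dfields_def
proof (intro CollectI conjI ballI)
  show "polymap (\<lambda>x i. \<Sum>j\<in>J. c j x * V j x i)"
    using assms by (intro polymap_sum) (auto simp: Dfields_def)
  show "(\<lambda>i. \<Sum>j\<in>J. c j x * V j x i) \<in> H'" if "H' \<in> A" "x \<in> H'" for H' x
    by (rule subsp_sum [OF hyperplane_subsp [OF hypl [OF that(1)]]])
      (use assms(2) that in \<open>auto simp: Dfields_def\<close>)
qed

lemma Mfields_D: "V \<in> Mfields A H \<Longrightarrow> V \<in> Dfields A"
  by (simp add: Mfields_def)

lemma Mfields_polymap: "V \<in> Mfields A H \<Longrightarrow> polymap V"
  by (simp add: Mfields_def Dfields_def)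

lemma Mfields_in: "V \<in> Mfields A H \<Longrightarrow> V x \<in> H"
  by (simp add: Mfields_def)

lemma MfieldsI:
  assumes "polymap V" "\<And>x. V x \<in> H" "\<And>H' x. H' \<in> A \<Longrightarrow> H' \<noteq> H \<Longrightarrow> x \<in> H' \<Longrightarrow> V x \<in> H'"
  shows "V \<in> Mfields A H"
  using assms unfolding Mfields_def Dfields_def by blast

lemma Mfields_sum:
  assumes "\<And>j. j \<in> J \<Longrightarrow> c j \<in> polyfun" "\<And>j. j \<in> J \<Longrightarrow> V j \<in> Mfields A H"
  shows "(\<lambda>x i. \<Sum>j\<in>J. c j x * V j x i) \<in> Mfields A H"
  unfolding Mfields_def
proof (intro CollectI conjI allI)
  show "(\<lambda>x i. \<Sum>j\<in>J. c j x * V j x i) \<in> Dfields A"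
    using assms by (intro Dfields_sum Mfields_D)
  show "(\<lambda>i. \<Sum>j\<in>J. c j x * V j x i) \<in> H" for x
    by (rule subsp_sum [OF H_subsp]) (use assms(2) Mfields_in in blast)
qed

lemma Mfields_scale: "c \<in> polyfun \<Longrightarrow> V \<in> Mfields A H \<Longrightarrow> (\<lambda>x i. c x * V x i) \<in> Mfields A H"
  using Mfields_sum [of "{()}" "\<lambda>_. c" "\<lambda>_. V"] by simp

lemma Mfields_diff:
  assumes "U \<in> Mfields A H" "V \<in> Mfields A H"
  shows "(\<lambda>x i. U x i - V x i) \<in> Mfields A H"
proof (rule MfieldsI)
  show "polymap (\<lambda>x i. U x i - V x i)" using assms Mfields_polymap polymap_diff by blast
  show "(\<lambda>i. U x i - V x i) \<in> H" for x
    using subsp_minus [OF H_subsp, of "U x" "V x" 1] Mfields_in assms by simp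
  show "(\<lambda>i. U x i - V x i) \<in> H'" if "H' \<in> A" "x \<in> H'" for H' x
    using subsp_minus [OF hyperplane_subsp [OF hypl], of H' "U x" "V x" 1] that assms
    by (simp add: Mfields_def Dfields_def)
qed

lemma Mfields_zero: "(\<lambda>_ _. 0) \<in> Mfields A H"
  using Dfields_zero subsp_zero [OF H_subsp] by (simp add: Mfields_def)

text \<open>Forms of distinct hyperplanes are coprime: the product already split off does not vanish
  identically on the next hyperplane \<open>H0\<close>, so the remaining quotient vanishes there and
  is divisible by the form of \<open>H0\<close>.\<close>

lemma prod_dvd:
  assumes "K \<subseteq> A" "f \<in> polyfun" "\<And>H' x. H' \<in> K \<Longrightarrow> x \<in> H' \<Longrightarrow> f x = 0"
  shows "\<exists>g\<in>polyfun. \<forall>x. f x = (\<Prod>H'\<in>K. lin (nrm H') x) * g x"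
proof -
  have "finite K" using assms(1) fin by (rule finite_subset)
  then show ?thesis using assms
  proof (induction K)
    case empty
    then show ?case by (intro bexI [of _ f]) auto
  next
    case (insert H0 K)
    then obtain g where g: "g \<in> polyfun" "\<forall>x. f x = (\<Prod>H'\<in>K. lin (nrm H') x) * g x" by auto
    have H0: "H0 \<in> A" using insert.prems by simp
    have pr: "(\<lambda>x. \<Prod>H'\<in>K. lin (nrm H') x) \<in> polyfun" by (intro polyfun_intros)
    have "\<exists>x\<in>H0. (\<Prod>H'\<in>K. lin (nrm H') x) \<noteq> 0"
    proof (rule polyfun_prod_nonzero [OF hyperplane_subsp [OF hypl [OF H0]] insert.hyps(1)])
      show "H0 \<noteq> {}" using subsp_zero [OF hyperplane_subsp [OF hypl [OF H0]]] by auto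
      show "\<exists>x\<in>H0. lin (nrm H') x \<noteq> 0" if "H' \<in> K" for H'
        using nonzero_on_hyperplane [OF H0, of H'] that insert.hyps insert.prems(1) by blast
    qed (rule polyfun_lin)
    then have g0: "g x = 0" if "x \<in> H0" for x
    proof (rule polyfun_cancel [OF hyperplane_subsp [OF hypl [OF H0]] pr g(1)])
      show "(\<Prod>H'\<in>K. lin (nrm H') x) * g x = 0" if "x \<in> H0" for x
        using insert.prems(3) [of H0 x] g(2) that by simp
    qed (rule that)
    have "\<exists>h\<in>polyfun. \<forall>x\<in>UNIV. g x = lin (nrm H0) x * h x"
      by (rule lin_dvd [OF subsp_UNIV g(1)]) (use g0 in_hyp_iff [OF hypl [OF H0]] in blast)
    then obtain h where "h \<in> polyfun" "\<forall>x. g x = lin (nrm H0) x * h x" by auto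
    with g insert.hyps show ?case by (intro bexI [of _ h]) (auto simp: mult_ac)
  qed
qed

definition trace_class :: "('n \<Rightarrow> 'k) set \<Rightarrow> ('n \<Rightarrow> 'k) set set" where
  "trace_class H0 = {H' \<in> A - {H}. H' \<inter> H = H0 \<inter> H}"

lemma trace_class_proportional:
  assumes "H0 \<in> A - {H}"
  obtains c where "\<forall>H'\<in>trace_class H0. c H' \<noteq> 0 \<and> (\<forall>x\<in>H. lin (nrm H') x = c H' * lin (nrm H0) x)"
proof -
  have "\<forall>H'\<in>trace_class H0. \<exists>c. c \<noteq> 0 \<and> (\<forall>x\<in>H. lin (nrm H') x = c * lin (nrm H0) x)"
  proof
    fix H' assume "H' \<in> trace_class H0"
    then have H': "H' \<in> A" "H' \<noteq> H" "H' \<inter> H = H0 \<inter> H" by (auto simp: trace_class_def)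
    have "\<exists>c. \<forall>x\<in>H. lin (nrm H') x = c * lin (nrm H0) x"
    proof (rule lin_proportional [OF H_subsp])
      fix x assume "x \<in> H" "lin (nrm H0) x = 0"
      then have "x \<in> H'" using H' assms in_hyp_iff [OF hypl, of H0] by blast
      then show "lin (nrm H') x = 0" using in_hyp_iff [OF hypl, of H'] H' by simp
    qed
    then obtain c where c: "\<forall>x\<in>H. lin (nrm H') x = c * lin (nrm H0) x" by blast
    moreover have "c \<noteq> 0" using c nonzero_on_hyperplane [OF HA, of H'] H' by auto
    ultimately show "\<exists>c. c \<noteq> 0 \<and> (\<forall>x\<in>H. lin (nrm H') x = c * lin (nrm H0) x)" by blast
  qed
  from bchoice [OF this] show ?thesis using that by (elim exE)
qed

lemma trace_class_prod:
  assumes H0: "H0 \<in> A - {H}"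
  obtains C where "C \<noteq> 0" "\<forall>x\<in>H. (\<Prod>H'\<in>trace_class H0. lin (nrm H') x)
    = C * lin (nrm H0) x ^ restr_mult A H (H0 \<inter> H)"
proof -
  obtain c where c: "\<forall>H'\<in>trace_class H0. c H' \<noteq> 0 \<and> (\<forall>x\<in>H. lin (nrm H') x = c H' * lin (nrm H0) x)"
    by (rule trace_class_proportional [OF H0])
  have fin': "finite (trace_class H0)" using fin by (simp add: trace_class_def)
  have "(\<Prod>H'\<in>trace_class H0. lin (nrm H') x)
      = (\<Prod>H'\<in>trace_class H0. c H') * lin (nrm H0) x ^ restr_mult A H (H0 \<inter> H)" if "x \<in> H" for x
  proof -
    have "(\<Prod>H'\<in>trace_class H0. lin (nrm H') x) = (\<Prod>H'\<in>trace_class H0. c H' * lin (nrm H0) x)"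
      by (rule prod.cong) (use c that in auto)
    then show ?thesis by (simp add: prod.distrib restr_mult_def trace_class_def)
  qed
  moreover have "(\<Prod>H'\<in>trace_class H0. c H') \<noteq> 0" using c fin' by simp
  ultimately show ?thesis using that by blast
qed

text \<open>The multiplicity arises from tangency off \<open>H\<close>. For \<open>x\<close> in a
  member \<open>H'\<close> of the class of \<open>H0\<close>, the vector \<open>V x\<close> lies in
  \<open>H'\<close> and in \<open>H\<close>, and on \<open>H\<close> the forms of \<open>H'\<close>
  and \<open>H0\<close> are proportional, so the form of \<open>H0\<close> vanishes at
  \<open>V x\<close>. Its value on \<open>V\<close> is thus divisible by the product over the class,
  which restricts to the required power on \<open>H\<close>.\<close>

lemma Mfields_subset_Nfields:
  assumes V: "V \<in> Mfields A H" shows "V \<in> Nfields A H"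
proof -
  have "\<exists>g\<in>polyfun. \<forall>x\<in>H. lin (nrm H0) (V x) = lin (nrm H0) x ^ restr_mult A H (H0 \<inter> H) * g x"
    if H0: "H0 \<in> A - {H}" for H0
  proof -
    obtain c where c: "\<forall>H'\<in>trace_class H0. c H' \<noteq> 0 \<and> (\<forall>x\<in>H. lin (nrm H') x = c H' * lin (nrm H0) x)"
      by (rule trace_class_proportional [OF H0])
    obtain C where C: "C \<noteq> 0" "\<forall>x\<in>H. (\<Prod>H'\<in>trace_class H0. lin (nrm H') x)
      = C * lin (nrm H0) x ^ restr_mult A H (H0 \<inter> H)" by (rule trace_class_prod [OF H0])
    have "\<exists>g\<in>polyfun. \<forall>x. lin (nrm H0) (V x) = (\<Prod>H'\<in>trace_class H0. lin (nrm H') x) * g x"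
    proof (rule prod_dvd)
      show "trace_class H0 \<subseteq> A" by (auto simp: trace_class_def)
      show "(\<lambda>x. lin (nrm H0) (V x)) \<in> polyfun" by (rule lin_polymap [OF Mfields_polymap [OF V]])
      fix H' x assume H': "H' \<in> trace_class H0" "x \<in> H'"
      then have "H' \<in> A" by (auto simp: trace_class_def)
      then have "lin (nrm H') (V x) = 0"
        using V H' in_hyp_iff [OF hypl, of H'] unfolding Mfields_def Dfields_def by blast
      then show "lin (nrm H0) (V x) = 0" using c H' Mfields_in [OF V, of x] by auto
    qed
    then obtain g where g: "g \<in> polyfun"
      "\<forall>x. lin (nrm H0) (V x) = (\<Prod>H'\<in>trace_class H0. lin (nrm H') x) * g x" by blast
    show ?thesis
      by (rule bexI [of _ "\<lambda>x. C * g x"]) (use C g in \<open>auto intro: polyfun_intros\<close>)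
  qed
  with V show ?thesis by (simp add: Nfields_def Mfields_polymap Mfields_in)
qed

lemma tangent_vcomp:
  assumes "polymap V" "is_hyperplane H'" "subsp W" "\<And>x. x \<in> W \<Longrightarrow> V x \<in> H'" "x \<in> W"
  shows "vcomp d V x \<in> H'"
  unfolding in_hyp_iff [OF assms(2)] lin_vcomp [OF assms(1)]
  by (rule comp_cong_vanish [OF assms(3,5)]) (use assms(4) in_hyp_iff [OF assms(2)] in blast)

lemma Dfields_vcomp: "V \<in> Dfields A \<Longrightarrow> vcomp d V \<in> Dfields A"
  by (auto simp: Dfields_def polymap_vcomp intro!: tangent_vcomp hypl hyperplane_subsp)

lemma Mfields_vcomp: "V \<in> Mfields A H \<Longrightarrow> vcomp d V \<in> Mfields A H"
  using tangent_vcomp [OF _ hypl [OF HA] subsp_UNIV, of V] Dfields_vcomp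
  by (auto simp: Mfields_def Dfields_def)

lemma Nfields_vcomp:
  assumes V: "V \<in> Nfields A H" shows "vcomp d V \<in> Nfields A H"
proof -
  have pm: "polymap V" and t: "\<And>x. x \<in> H \<Longrightarrow> V x \<in> H" using V by (auto simp: Nfields_def)
  have "\<exists>g\<in>polyfun. \<forall>x\<in>H. lin (nrm H') (vcomp d V x) = lin (nrm H') x ^ restr_mult A H (H' \<inter> H) * g x"
    if H': "H' \<in> A - {H}" for H'
  proof -
    let ?m = "restr_mult A H (H' \<inter> H)"
    obtain g where g: "g \<in> polyfun" "\<forall>x\<in>H. lin (nrm H') (V x) = lin (nrm H') x ^ ?m * g x"
      using NfieldsE [OF V, of H'] H' by blast
    let ?g = "\<lambda>x. if d < ?m then 0 else comp (d - ?m) g x"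
    have "?g \<in> polyfun" using g by (cases "d < ?m") (auto intro: polyfun.const comp_polyfun)
    moreover have "lin (nrm H') (vcomp d V x) = lin (nrm H') x ^ ?m * ?g x" if x: "x \<in> H" for x
    proof -
      have "lin (nrm H') (vcomp d V x) = comp d (\<lambda>x. g x * lin (nrm H') x ^ ?m) x"
        unfolding lin_vcomp [OF pm]
        by (rule comp_cong [OF H_subsp x]) (use g in \<open>auto simp: mult.commute\<close>)
      also have "\<dots> = (if d < ?m then 0 else comp (d - ?m) g x * lin (nrm H') x ^ ?m)"
        by (rule comp_mult_hom [OF g(1) _ hom_lin_power]) (intro polyfun_intros)
      finally show ?thesis by (simp add: mult.commute)
    qed
    ultimately show ?thesis by (intro bexI [of _ ?g]) blast+
  qed
  with tangent_vcomp [OF pm hypl [OF HA] H_subsp t] show ?thesis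
    by (simp add: Nfields_def polymap_vcomp pm)
qed

lemma Euler_Dfields: "(\<lambda>x. x) \<in> Dfields A"
  by (simp add: Dfields_def polymap_id)

lemma divide_alpha:
  assumes "polymap V" "\<And>x. x \<in> H \<Longrightarrow> V x = (\<lambda>_. 0)"
  obtains q where "polymap q" "\<forall>x i. V x i = \<alpha> x * q x i"
proof -
  have "\<exists>g\<in>polyfun. \<forall>x\<in>UNIV. V x i = \<alpha> x * g x" for i
    by (rule lin_dvd [OF subsp_UNIV polymapD [OF assms(1)]]) (use assms(2) H_iff in auto)
  then obtain g where g: "\<And>i. g i \<in> polyfun" "\<And>i x. V x i = \<alpha> x * g i x" by (metis UNIV_I)
  show ?thesis by (rule that [of "\<lambda>x i. g i x"]) (use g in \<open>auto simp: polymap_def\<close>)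
qed

lemma alpha_cancel: "f \<in> polyfun \<Longrightarrow> (\<And>x. \<alpha> x * f x = 0) \<Longrightarrow> f x = 0"
  by (rule polyfun_cancel [OF subsp_UNIV polyfun_lin _ alpha_nonzero]) auto

text \<open>As \<alpha> does not vanish identically on any other hyperplane of \<open>A\<close>, the
  quotient by \<alpha> stays tangent to it. This is the injectivity of the restriction modulo
  \<alpha>.\<close>

lemma Mfields_divide_alpha:
  assumes V: "V \<in> Mfields A H" and "\<And>x. x \<in> H \<Longrightarrow> V x = (\<lambda>_. 0)"
  obtains q where "q \<in> Mfields A H" "\<forall>x i. V x i = \<alpha> x * q x i"
proof -
  obtain q where q: "polymap q" "\<forall>x i. V x i = \<alpha> x * q x i"
    using divide_alpha [OF Mfields_polymap [OF V] assms(2)] by blast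
  then have Vq: "V x = (\<lambda>i. \<alpha> x * q x i)" for x by auto
  have "q \<in> Mfields A H"
  proof (rule MfieldsI [OF q(1)])
    fix x
    have "\<alpha> (q x) = 0"
      by (rule alpha_cancel [OF lin_polymap [OF q(1)]])
        (use Mfields_in [OF V] Vq in \<open>simp add: H_iff lin_scale\<close>)
    then show "q x \<in> H" by (simp add: H_iff)
  next
    fix H' x assume H': "H' \<in> A" "H' \<noteq> H" "x \<in> H'"
    have "lin (nrm H') (q x) = 0"
    proof (rule zero_div_alpha [OF H'(1,2) lin_polymap [OF q(1)] _ H'(3)])
      fix x assume "x \<in> H'"
      then have "V x \<in> H'" using V H' by (simp add: Mfields_def Dfields_def)
      then show "\<alpha> x * lin (nrm H') (q x) = 0"
        using Vq by (simp add: in_hyp_iff [OF hypl [OF H'(1)]] lin_scale)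
    qed
    then show "q x \<in> H'" by (simp add: in_hyp_iff [OF hypl [OF H'(1)]])
  qed
  with q(2) show ?thesis using that by blast
qed

lemma Dfields_alpha:
  assumes "V \<in> Dfields A"
  obtains r where "r \<in> polyfun" "\<forall>x. \<alpha> (V x) = \<alpha> x * r x"
proof -
  have "\<exists>g\<in>polyfun. \<forall>x\<in>UNIV. \<alpha> (V x) = \<alpha> x * g x"
    by (rule lin_dvd [OF subsp_UNIV lin_polymap])
      (use assms HA H_iff in \<open>auto simp: Dfields_def\<close>)
  then show ?thesis using that by blast
qed

text \<open>Applied to the Euler field, \<alpha> returns \<alpha> itself, so subtracting
  \<open>r\<close> times the Euler field annihilates \<alpha>; tangency survives because the Euler
  field is tangent to every central hyperplane.\<close>

lemma Euler_projection:
  assumes V: "V \<in> Dfields A" and r: "r \<in> polyfun" "\<forall>x. \<alpha> (V x) = \<alpha> x * r x"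
  shows "(\<lambda>x i. V x i - r x * x i) \<in> Mfields A H"
proof (rule MfieldsI)
  show "polymap (\<lambda>x i. V x i - r x * x i)"
    using V r(1) by (auto simp: Dfields_def polymap_def intro!: polyfun_diff polyfun.mult polyfun.coord)
  show "(\<lambda>i. V x i - r x * x i) \<in> H" for x
    using r(2) by (simp add: H_iff lin_diff lin_scale)
  show "(\<lambda>i. V x i - r x * x i) \<in> H'" if "H' \<in> A" "x \<in> H'" for H' x
    using subsp_minus [OF hyperplane_subsp [OF hypl], of H' "V x" x "r x"] that V
    by (simp add: Dfields_def)
qed

text \<open>Linear projection onto \<open>H\<close> along a vector on which \<alpha> is 1. It turns
  a field tangent to \<open>H\<close> along \<open>H\<close> into one with values in
  \<open>H\<close> everywhere, without changing it on \<open>H\<close>.\<close>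

lemma project_H:
  assumes V: "polymap V"
  obtains U where "polymap U" "\<forall>x. U x \<in> H" "\<forall>x. V x \<in> H \<longrightarrow> U x = V x"
proof -
  obtain v0 where v0: "\<alpha> v0 \<noteq> 0" using alpha_nonzero by auto
  define v where "v = (\<lambda>i. (1 / \<alpha> v0) * v0 i)"
  have v: "\<alpha> v = 1" unfolding v_def lin_scale using v0 by simp
  show ?thesis
  proof (rule that [of "\<lambda>x i. V x i - \<alpha> (V x) * v i"])
    show "polymap (\<lambda>x i. V x i - \<alpha> (V x) * v i)"
      unfolding polymap_def using polymapD [OF V] lin_polymap [OF V]
      by (intro allI polyfun_diff polyfun.mult polyfun.const) auto
    show "\<forall>x. (\<lambda>i. V x i - \<alpha> (V x) * v i) \<in> H"
      by (simp add: H_iff lin_diff lin_scale v)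
    show "\<forall>x. V x \<in> H \<longrightarrow> (\<lambda>i. V x i - \<alpha> (V x) * v i) = V x" by (simp add: H_iff)
  qed
qed

section \<open>Localization\<close>

lemma arr_localization: "x0 \<in> H \<Longrightarrow> arr (localization A x0) H"
  using central HA by (auto simp: arr_def localization_def is_central_arrangement_def)

text \<open>After translating \<open>x0\<close> to the origin, fields of the localization become
  fields of \<open>A\<close> once multiplied by the forms of the hyperplanes missing
  \<open>x0\<close>. That multiplier is a unit at the new origin, so the translated basis generates
  there, and since the module of the localization is graded, \<open>homogeneous_generators\<close>
  gives global generators, no more in number.\<close>

lemma free_localization:
  assumes free: "free_arrangement A" and x0: "x0 \<in> H"
  shows "free_arrangement (localization A x0)"
proof -
  let ?L = "localization A x0" and ?n = "card (UNIV :: 'n set)"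
  interpret L: arr ?L H by (rule arr_localization [OF x0])
  obtain e where e: "\<forall>k<?n. e k \<in> Dfields A" and sp: "spans UNIV {..<?n} e (Dfields A)"
    using free free_arrangement_iff by (auto simp: generated_by_def)
  let ?s = "\<lambda>y i. y i + x0 i"
  have sm: "polymap ?s" by (auto simp: polymap_def intro: polyfun_intros)
  have sm': "polymap (\<lambda>y i. y i - x0 i)" by (auto simp: polymap_def intro: polyfun_intros)
  define p where "p x = (\<Prod>H'\<in>A - ?L. lin (nrm H') x)" for x
  define f where "f y = p (?s y)" for y
  define e' where "e' k y = e k (?s y)" for k y
  have pp: "p \<in> polyfun" unfolding p_def [abs_def] by (intro polyfun_intros)
  have fp: "f \<in> polyfun" unfolding f_def [abs_def] by (rule polyfun_compose [OF pp sm])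
  have f0: "f (\<lambda>_. 0) \<noteq> 0"
    using fin in_hyp_iff [OF hypl] by (auto simp: f_def p_def localization_def)
  have sH: "?s y \<in> H'" "(\<lambda>i. y i - x0 i) \<in> H'" if "H' \<in> ?L" "y \<in> H'" for H' y
    using subsp_line [OF hyperplane_subsp [OF L.hypl [OF that(1)]] that(2), of x0 1]
      subsp_minus [OF hyperplane_subsp [OF L.hypl [OF that(1)]] that(2), of x0 1] that(1)
    by (auto simp: localization_def)
  have e': "e' k \<in> Dfields ?L" if k: "k < ?n" for k
  proof -
    have ek: "e k \<in> Dfields A" using e k by blast
    then have "polymap (e' k)"
      unfolding e'_def polymap_def using polyfun_compose [OF polymapD sm] by (auto simp: Dfields_def)
    moreover have "e' k y \<in> H'" if "H' \<in> ?L" "y \<in> H'" for H' y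
      using ek that sH(1) [OF that] by (auto simp: e'_def Dfields_def localization_def)
    ultimately show ?thesis by (auto simp: Dfields_def)
  qed
  have gen: "\<exists>c. (\<forall>k<?n. c k \<in> polyfun) \<and> (\<forall>y\<in>UNIV. \<forall>i. f y * V y i = (\<Sum>k<?n. c k y * e' k y i))"
    if V: "V \<in> Dfields ?L" for V
  proof -
    \<comment> \<open>Translation by \<open>x0\<close> preserves every hyperplane of the
      localization; the factor \<open>p\<close> handles all the others.\<close>
    define U where "U z i = p z * V (\<lambda>i. z i - x0 i) i" for z i
    have "U \<in> Dfields A"
      unfolding Dfields_def
    proof (intro CollectI conjI ballI)
      have "(\<lambda>z. V (\<lambda>i. z i - x0 i) j) \<in> polyfun" for j
        using V polyfun_compose [OF polymapD sm', of V j] by (simp add: Dfields_def)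
      then show "polymap U" unfolding polymap_def U_def using pp by (intro allI polyfun.mult)
      fix H' z assume H': "H' \<in> A" "z \<in> H'"
      note sub = hyperplane_subsp [OF hypl [OF H'(1)]]
      show "U z \<in> H'"
      proof (cases "H' \<in> ?L")
        case True
        then have "V (\<lambda>i. z i - x0 i) \<in> H'" using V sH(2) [OF True H'(2)] by (auto simp: Dfields_def)
        then show ?thesis unfolding U_def [abs_def] by (rule subsp_scale [OF sub])
      next
        case False
        then have "p z = 0" unfolding p_def
          using H' in_hyp_iff [OF hypl [OF H'(1)]] fin by (intro prod_zero) auto
        then show ?thesis using subsp_zero [OF sub] by (simp add: U_def [abs_def])
      qed
    qed
    then obtain c where c: "\<forall>k\<in>{..<?n}. c k \<in> polyfun"
        "\<forall>x\<in>UNIV. \<forall>i. U x i = (\<Sum>k\<in>{..<?n}. c k x * e k x i)"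
      by (rule spansE [OF sp])
    let ?c = "\<lambda>k y. c k (?s y)"
    have "\<forall>k<?n. ?c k \<in> polyfun" using c(1) polyfun_compose [OF _ sm] by auto
    moreover have "f y * V y i = (\<Sum>k<?n. ?c k y * e' k y i)" for y i
    proof -
      have "U (?s y) i = f y * V y i" by (simp add: U_def f_def)
      with c(2) show ?thesis by (simp add: e'_def)
    qed
    ultimately show ?thesis by (intro exI [of _ ?c]) blast
  qed
  have pm: "polymap V" if "V \<in> Dfields ?L" for V using that by (simp add: Dfields_def)
  obtain J :: "(nat \<times> nat) set" and h deg where J: "finite J" "\<forall>j\<in>J. h j \<in> Dfields ?L"
    "\<forall>j\<in>J. \<forall>i. hom (deg j) (\<lambda>x. h j x i)" "spans UNIV J h (Dfields ?L)"
    "minimal_gens UNIV J h" "card J \<le> ?n"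
    by (rule homogeneous_generators [OF subsp_UNIV pm L.Dfields_vcomp e' fp f0 gen])
  show ?thesis
    unfolding L.free_arrangement_iff
    by (rule generated_byI [OF J(1,6) bspec [OF J(2)] L.Dfields_zero J(4)])
qed

end

section \<open>Lifting vector fields from the restriction\<close>

context arr
begin

definition lifts :: "(('n \<Rightarrow> 'k) \<Rightarrow> 'n \<Rightarrow> 'k) \<Rightarrow> bool" where
  "lifts V \<longleftrightarrow> (\<exists>m\<in>Mfields A H. \<forall>x\<in>H. \<forall>i. m x i = V x i)"

definition restriction_onto :: bool where
  "restriction_onto \<longleftrightarrow> (\<forall>V\<in>Nfields A H. lifts V)"

text \<open>Multiplication by it makes tangency to the hyperplanes outside \<open>Z\<close>, other
  than \<open>H\<close>, automatic; \<open>Z\<close> lists those still to be treated. Inductions run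
  upward in \<open>Z\<close> to \<open>A - {H}\<close>, where the factor is 1.\<close>

definition cofactor :: "('n \<Rightarrow> 'k) set set \<Rightarrow> ('n \<Rightarrow> 'k) \<Rightarrow> 'k" where
  "cofactor Z x = (\<Prod>H'\<in>A - {H} - Z. lin (nrm H') x)"

lemma liftsI: "m \<in> Mfields A H \<Longrightarrow> (\<And>x i. x \<in> H \<Longrightarrow> m x i = V x i) \<Longrightarrow> lifts V"
  unfolding lifts_def by blast

lemma liftsE:
  assumes "lifts V" obtains m where "m \<in> Mfields A H" "\<forall>x\<in>H. \<forall>i. m x i = V x i"
  using assms unfolding lifts_def by blast

lemma cofactor_polyfun: "cofactor Z \<in> polyfun"
  unfolding cofactor_def [abs_def] by (intro polyfun_intros)

lemma cofactor_all: "cofactor (A - {H}) x = 1"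
  by (simp add: cofactor_def)

lemma cofactor_zero: "H' \<in> A - {H} \<Longrightarrow> H' \<notin> Z \<Longrightarrow> x \<in> H' \<Longrightarrow> cofactor Z x = 0"
  unfolding cofactor_def using fin in_hyp_iff [OF hypl, of H'] by (intro prod_zero) auto

lemma cofactor_remove:
  assumes "H' \<in> Z" "Z \<subseteq> A - {H}"
  shows "cofactor (Z - {H'}) x = lin (nrm H') x * cofactor Z x"
proof -
  have "A - {H} - (Z - {H'}) = insert H' (A - {H} - Z)" using assms by auto
  then show ?thesis using assms fin by (simp add: cofactor_def)
qed

lemma cofactor_Mfields:
  assumes U: "polymap U" "\<And>x. U x \<in> H" and Z: "\<And>H' x. H' \<in> Z \<Longrightarrow> x \<in> H' \<Longrightarrow> U x \<in> H'"
  shows "(\<lambda>x i. cofactor Z x * U x i) \<in> Mfields A H"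
proof (rule MfieldsI)
  show "polymap (\<lambda>x i. cofactor Z x * U x i)" by (rule polymap_scale [OF cofactor_polyfun U(1)])
  show "(\<lambda>i. cofactor Z x * U x i) \<in> H" for x by (rule subsp_scale [OF H_subsp U(2)])
  fix H' x assume H': "H' \<in> A" "H' \<noteq> H" "x \<in> H'"
  note sub = hyperplane_subsp [OF hypl [OF H'(1)]]
  show "(\<lambda>i. cofactor Z x * U x i) \<in> H'"
  proof (cases "H' \<in> Z")
    case True
    then show ?thesis using Z H' by (intro subsp_scale [OF sub]) blast
  next
    case False
    then show ?thesis using cofactor_zero [of H' Z x] H' subsp_zero [OF sub] by simp
  qed
qed

text \<open>For a single class only one form \<beta> matters. A field extending \<open>V\<close> is
  corrected by a multiple of \<alpha> until \<beta> of it is exactly \<open>P * g\<close>, where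
  \<open>P\<close> extends the power of \<beta> on \<open>H\<close> and vanishes on every member of
  the class; this gives tangency to all of them at once.\<close>

lemma lifts_same_trace:
  assumes V: "V \<in> Nfields A H" and H0: "H0 \<in> A - {H}" and Z: "Z \<subseteq> trace_class H0"
  shows "lifts (\<lambda>x i. cofactor Z x * V x i)"
proof -
  let ?\<beta> = "lin (nrm H0)" and ?m = "restr_mult A H (H0 \<inter> H)"
  have pm: "polymap V" and t: "\<And>x. x \<in> H \<Longrightarrow> V x \<in> H" using V by (auto simp: Nfields_def)
  obtain U where U: "polymap U" "\<forall>x. U x \<in> H" "\<forall>x. V x \<in> H \<longrightarrow> U x = V x"
    by (rule project_H [OF pm])
  obtain g where g: "g \<in> polyfun" "\<forall>x\<in>H. ?\<beta> (V x) = ?\<beta> x ^ ?m * g x"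
    using NfieldsE [OF V, of H0] H0 by blast
  obtain c where c: "\<forall>H'\<in>trace_class H0. c H' \<noteq> 0 \<and> (\<forall>x\<in>H. lin (nrm H') x = c H' * ?\<beta> x)"
    by (rule trace_class_proportional [OF H0])
  obtain C where C: "C \<noteq> 0" "\<forall>x\<in>H. (\<Prod>H'\<in>trace_class H0. lin (nrm H') x) = C * ?\<beta> x ^ ?m"
    by (rule trace_class_prod [OF H0])
  define P where "P x = 1 / C * (\<Prod>H'\<in>trace_class H0. lin (nrm H') x)" for x
  have Pp: "P \<in> polyfun" unfolding P_def [abs_def] by (intro polyfun_intros)
  have PH: "P x = ?\<beta> x ^ ?m" if "x \<in> H" for x using C that by (simp add: P_def)
  have "\<exists>h\<in>polyfun. \<forall>x\<in>UNIV. ?\<beta> (U x) - P x * g x = \<alpha> x * h x"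
  proof (rule lin_dvd [OF subsp_UNIV])
    show "(\<lambda>x. ?\<beta> (U x) - P x * g x) \<in> polyfun"
      using lin_polymap [OF U(1)] Pp g(1) by (intro polyfun_diff polyfun.mult)
    show "?\<beta> (U x) - P x * g x = 0" if "\<alpha> x = 0" for x
      using that U(3) t g(2) PH H_iff by simp
  qed
  then obtain h where h: "h \<in> polyfun" "\<And>x. ?\<beta> (U x) - P x * g x = \<alpha> x * h x" by blast
  obtain w0 where w0: "w0 \<in> H" "?\<beta> w0 \<noteq> 0" using nonzero_on_hyperplane [OF HA, of H0] H0 by auto
  define w where "w = (\<lambda>i. (1 / ?\<beta> w0) * w0 i)"
  have wH: "w \<in> H" unfolding w_def by (rule subsp_scale [OF H_subsp w0(1)])
  have w1: "?\<beta> w = 1" unfolding w_def lin_scale using w0 by simp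
  \<comment> \<open>Since \<beta> is 1 on \<open>w\<close>, this removes the error
    \<open>\<alpha> x * h x\<close>; values stay in \<open>H\<close>, and nothing changes on
    \<open>H\<close>, where \<alpha> vanishes.\<close>
  define m where "m x i = U x i - (\<alpha> x * h x) * w i" for x i
  have mp: "polymap m"
    unfolding m_def polymap_def using polymapD [OF U(1)] h(1)
    by (intro allI polyfun_diff polyfun.mult polyfun.const polyfun_lin) auto
  have mH: "m x \<in> H" for x
    unfolding m_def [abs_def] using U(2) wH by (intro subsp_minus [OF H_subsp]) auto
  have mb: "?\<beta> (m x) = P x * g x" for x
    unfolding m_def [abs_def] lin_diff lin_scale w1 using h(2) [of x] by (simp add: algebra_simps)
  have "(\<lambda>x i. cofactor Z x * m x i) \<in> Mfields A H"
  proof (rule cofactor_Mfields [OF mp mH])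
    fix H' x assume H': "H' \<in> Z" "x \<in> H'"
    then have K: "H' \<in> trace_class H0" and HA': "H' \<in> A" using Z by (auto simp: trace_class_def)
    have "lin (nrm H') x = 0" using H' HA' in_hyp_iff [OF hypl] by simp
    then have "P x = 0"
      unfolding P_def using K fin by (auto simp: trace_class_def)
    then have "lin (nrm H') (m x) = 0" using c K mH mb by simp
    then show "m x \<in> H'" using in_hyp_iff [OF hypl [OF HA']] by simp
  qed
  moreover have "cofactor Z x * m x i = cofactor Z x * V x i" if "x \<in> H" for x i
    using that U(3) t H_iff by (simp add: m_def)
  ultimately show ?thesis by (rule liftsI)
qed

lemma lifts_cofactor_empty:
  assumes V: "V \<in> Nfields A H" shows "lifts (\<lambda>x i. cofactor {} x * V x i)"
proof -
  have pm: "polymap V" and t: "\<And>x. x \<in> H \<Longrightarrow> V x \<in> H" using V by (auto simp: Nfields_def)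
  obtain U where U: "polymap U" "\<forall>x. U x \<in> H" "\<forall>x. V x \<in> H \<longrightarrow> U x = V x"
    by (rule project_H [OF pm])
  have "(\<lambda>x i. cofactor {} x * U x i) \<in> Mfields A H"
    using U by (intro cofactor_Mfields) auto
  then show ?thesis by (rule liftsI) (use U t in simp)
qed

text \<open>Two linear forms that are independent on \<open>H\<close> form a regular sequence on the free module
  \<open>D(A) / \<alpha> D(A)\<close>, hence on its direct summand \<open>\<rho>(M)\<close>.\<close>

lemma lifts_regular_pair:
  fixes V :: "('n \<Rightarrow> 'k) \<Rightarrow> 'n \<Rightarrow> 'k"
  assumes free: "free_arrangement A" and V: "polymap V"
    and b: "\<exists>x\<in>H. lin b1 x = 0 \<and> lin b2 x \<noteq> 0" "\<exists>x\<in>H. lin b1 x \<noteq> 0"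
    and l1: "lifts (\<lambda>x i. lin b1 x * V x i)" and l2: "lifts (\<lambda>x i. lin b2 x * V x i)"
  shows "lifts V"
proof -
  let ?n = "card (UNIV :: 'n set)"
  obtain e where e: "\<forall>k<?n. e k \<in> Dfields A" and sp: "spans UNIV {..<?n} e (Dfields A)"
    using free free_arrangement_iff by (auto simp: generated_by_def)
  obtain m1 where m1: "m1 \<in> Mfields A H" "\<forall>x\<in>H. \<forall>i. m1 x i = lin b1 x * V x i" by (rule liftsE [OF l1])
  obtain m2 where m2: "m2 \<in> Mfields A H" "\<forall>x\<in>H. \<forall>i. m2 x i = lin b2 x * V x i" by (rule liftsE [OF l2])
  have "(\<lambda>x i. lin b2 x * m1 x i - lin b1 x * m2 x i) \<in> Mfields A H"
    by (intro Mfields_diff Mfields_scale polyfun_lin m1(1) m2(1))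
  then obtain q where q: "q \<in> Mfields A H"
      "\<forall>x i. lin b2 x * m1 x i - lin b1 x * m2 x i = \<alpha> x * q x i"
    by (rule Mfields_divide_alpha) (use m1 m2 in \<open>auto simp: fun_eq_iff\<close>)
  obtain c1 where c1: "\<forall>k\<in>{..<?n}. c1 k \<in> polyfun" "\<forall>x\<in>UNIV. \<forall>i. m1 x i = (\<Sum>k\<in>{..<?n}. c1 k x * e k x i)"
    by (rule spansE [OF sp Mfields_D [OF m1(1)]])
  obtain c2 where c2: "\<forall>k\<in>{..<?n}. c2 k \<in> polyfun" "\<forall>x\<in>UNIV. \<forall>i. m2 x i = (\<Sum>k\<in>{..<?n}. c2 k x * e k x i)"
    by (rule spansE [OF sp Mfields_D [OF m2(1)]])
  obtain c3 where c3: "\<forall>k\<in>{..<?n}. c3 k \<in> polyfun" "\<forall>x\<in>UNIV. \<forall>i. q x i = (\<Sum>k\<in>{..<?n}. c3 k x * e k x i)"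
    by (rule spansE [OF sp Mfields_D [OF q(1)]])
  \<comment> \<open>Independence of the basis turns the relation between \<open>m1\<close>,
    \<open>m2\<close> and \<open>q\<close> into one between coefficients, to which regularity of the
    two forms on \<open>H\<close> applies.\<close>
  have rel: "lin b2 x * c1 k x - lin b1 x * c2 k x - \<alpha> x * c3 k x = 0" if k: "k < ?n" for k x
  proof (rule Dfields_indep [OF sp, of "\<lambda>k x. lin b2 x * c1 k x - lin b1 x * c2 k x - \<alpha> x * c3 k x", OF _ _ k])
    show "(\<lambda>x. lin b2 x * c1 k x - lin b1 x * c2 k x - \<alpha> x * c3 k x) \<in> polyfun"
      using c1 c2 c3 k by (intro polyfun_intros) auto
    show "(\<Sum>k<?n. (lin b2 x * c1 k x - lin b1 x * c2 k x - \<alpha> x * c3 k x) * e k x i) = 0" for x i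
      using q(2) [rule_format, of x i] c1(2) c2(2) c3(2)
      by (simp add: left_diff_distrib sum_subtractf sum_distrib_left mult.assoc)
  qed
  have "\<forall>k\<in>{..<?n}. \<exists>u. u \<in> polyfun \<and> (\<forall>x\<in>H. c1 k x = lin b1 x * u x)"
  proof
    fix k assume k: "k \<in> {..<?n}"
    have eq: "lin b2 x * c1 k x = lin b1 x ^ 1 * c2 k x" if "x \<in> H" for x
      using rel [of k x] k that H_iff by simp
    have "\<exists>u\<in>polyfun. \<forall>x\<in>H. c1 k x = lin b1 x ^ 1 * u x"
      by (rule lin_power_regular [OF H_subsp bspec [OF c1(1) k] bspec [OF c2(1) k] polyfun_lin b(1) eq b(2)])
    then show "\<exists>u. u \<in> polyfun \<and> (\<forall>x\<in>H. c1 k x = lin b1 x * u x)" by auto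
  qed
  from bchoice [OF this] obtain u where u: "\<forall>k\<in>{..<?n}. u k \<in> polyfun \<and> (\<forall>x\<in>H. c1 k x = lin b1 x * u k x)"
    by (rule exE)
  have "\<forall>k\<in>{..<?n}. \<exists>v. v \<in> polyfun \<and> (\<forall>x. c1 k x - lin b1 x * u k x = \<alpha> x * v x)"
  proof
    fix k assume k: "k \<in> {..<?n}"
    have "\<exists>v\<in>polyfun. \<forall>x\<in>UNIV. c1 k x - lin b1 x * u k x = \<alpha> x * v x"
      by (rule lin_dvd [OF subsp_UNIV])
        (use c1 u k H_iff in \<open>auto intro!: polyfun_diff polyfun.mult polyfun_lin\<close>)
    then show "\<exists>v. v \<in> polyfun \<and> (\<forall>x. c1 k x - lin b1 x * u k x = \<alpha> x * v x)" by auto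
  qed
  from bchoice [OF this] obtain v where v: "\<forall>k\<in>{..<?n}. v k \<in> polyfun \<and> (\<forall>x. c1 k x - lin b1 x * u k x = \<alpha> x * v k x)"
    by (rule exE)
  define U where "U x i = (\<Sum>k<?n. u k x * e k x i)" for x i
  define T where "T x i = (\<Sum>k<?n. v k x * e k x i)" for x i
  have UD: "U \<in> Dfields A" and TD: "T \<in> Dfields A"
    unfolding U_def [abs_def] T_def [abs_def] using u v e by (auto intro!: Dfields_sum)
  have m1eq: "m1 x i = lin b1 x * U x i + \<alpha> x * T x i" for x i
  proof -
    have "m1 x i = (\<Sum>k<?n. (lin b1 x * u k x + \<alpha> x * v k x) * e k x i)"
      unfolding c1(2) [rule_format, OF UNIV_I]
    proof (rule sum.cong [OF refl])
      fix k assume "k \<in> {..<?n}"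
      with v have "c1 k x - lin b1 x * u k x = \<alpha> x * v k x" by blast
      then have "c1 k x = lin b1 x * u k x + \<alpha> x * v k x" by (simp add: algebra_simps)
      then show "c1 k x * e k x i = (lin b1 x * u k x + \<alpha> x * v k x) * e k x i" by simp
    qed
    then show ?thesis
      by (simp add: U_def T_def distrib_right sum.distrib sum_distrib_left mult.assoc)
  qed
  obtain r where r: "r \<in> polyfun" "\<forall>x. \<alpha> (U x) = \<alpha> x * r x" by (rule Dfields_alpha [OF UD])
  obtain s where s: "s \<in> polyfun" "\<forall>x. \<alpha> (T x) = \<alpha> x * s x" by (rule Dfields_alpha [OF TD])
  have rs: "lin b1 x * r x + \<alpha> x * s x = 0" for x
  proof (rule alpha_cancel [of "\<lambda>x. lin b1 x * r x + \<alpha> x * s x"])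
    show "(\<lambda>x. lin b1 x * r x + \<alpha> x * s x) \<in> polyfun" using r s by (intro polyfun_intros)
    fix x
    have "m1 x = (\<lambda>i. lin b1 x * U x i + \<alpha> x * T x i)" using m1eq by auto
    then have "\<alpha> (m1 x) = lin b1 x * (\<alpha> x * r x) + \<alpha> x * (\<alpha> x * s x)"
      using r s by (simp add: lin_add lin_scale)
    moreover have "\<alpha> (m1 x) = 0" using Mfields_in [OF m1(1)] H_iff by simp
    ultimately show "\<alpha> x * (lin b1 x * r x + \<alpha> x * s x) = 0" by (simp add: algebra_simps)
  qed
  \<comment> \<open>The Euler correction that brings \<open>U\<close> into
    \<open>Mfields A H\<close> vanishes on \<open>H\<close>, so \<open>U\<close> keeps its values
    there.\<close>
  have r0: "r x = 0" if "x \<in> H" for x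
  proof (rule polyfun_cancel [OF H_subsp polyfun_lin r(1) b(2) _ that])
    show "lin b1 x * r x = 0" if "x \<in> H" for x using rs [of x] that H_iff by simp
  qed
  show ?thesis
  proof (rule liftsI [OF Euler_projection [OF UD r]])
    fix x i assume x: "x \<in> H"
    have "U x i - V x i = 0"
    proof (rule polyfun_cancel [OF H_subsp polyfun_lin _ b(2) _ x])
      show "(\<lambda>x. U x i - V x i) \<in> polyfun"
        using UD polymapD [OF V] by (auto simp: Dfields_def polymap_def intro: polyfun_diff)
      show "lin b1 x * (U x i - V x i) = 0" if "x \<in> H" for x
        using m1eq [of x i] m1(2) that H_iff by auto
    qed
    then show "U x i - r x * x i = V x i" using r0 [OF x] by simp
  qed
qed

text \<open>Induction on \<open>Z\<close>. Two members of \<open>Z\<close> with different traces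
  have independent forms on \<open>H\<close>; deleting either from \<open>Z\<close> multiplies the
  field by its form, so both products lift and \<open>lifts_regular_pair\<close> lifts the field
  itself. Otherwise \<open>Z\<close> lies in one trace class.\<close>

theorem free_imp_restriction_onto:
  assumes free: "free_arrangement A" shows restriction_onto
  unfolding restriction_onto_def
proof
  fix V assume V: "V \<in> Nfields A H"
  have pm: "polymap V" using V by (simp add: Nfields_def)
  have "lifts (\<lambda>x i. cofactor Z x * V x i)" if "Z \<subseteq> A - {H}" for Z
    using finite_subset [OF that finite_Diff [OF fin]] that
  proof (induction Z rule: finite_psubset_induct)
    case (psubset Z)
    show ?case
    proof (cases "Z = {}")
      case True
      then show ?thesis using lifts_cofactor_empty [OF V] by simp
    next
      case False
      then obtain H0 where H0: "H0 \<in> Z" by auto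
      show ?thesis
      proof (cases "Z \<subseteq> trace_class H0")
        case True
        then show ?thesis using lifts_same_trace [OF V] H0 psubset.prems by blast
      next
        case False
        then obtain H1 where H1: "H1 \<in> Z" "H1 \<inter> H \<noteq> H0 \<inter> H"
          using psubset.prems by (auto simp: trace_class_def)
        have A: "H0 \<in> A" "H1 \<in> A" "H0 \<noteq> H" "H1 \<noteq> H" using H0 H1 psubset.prems by auto
        have l: "lifts (\<lambda>x i. lin (nrm H') x * (cofactor Z x * V x i))" if "H' \<in> Z" for H'
        proof -
          have "lifts (\<lambda>x i. cofactor (Z - {H'}) x * V x i)"
            using psubset.IH [of "Z - {H'}"] psubset.prems that by auto
          then show ?thesis using cofactor_remove [OF that psubset.prems] by (simp add: mult.assoc)
        qed
        have ex: "\<exists>x\<in>H. lin (nrm H0) x = 0 \<and> lin (nrm H1) x \<noteq> 0"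
        proof (rule ccontr)
          assume *: "\<not> ?thesis"
          have "\<exists>c. \<forall>x\<in>H. lin (nrm H1) x = c * lin (nrm H0) x"
            by (rule lin_proportional [OF H_subsp]) (use * in auto)
          then obtain c where c: "\<forall>x\<in>H. lin (nrm H1) x = c * lin (nrm H0) x" by blast
          have "c \<noteq> 0" using c nonzero_on_hyperplane [OF HA A(2)] A by auto
          then have "H1 \<inter> H = H0 \<inter> H"
            using c in_hyp_iff [OF hypl [OF A(1)]] in_hyp_iff [OF hypl [OF A(2)]] by auto
          with H1 show False by simp
        qed
        show ?thesis
          by (rule lifts_regular_pair [OF free polymap_scale [OF cofactor_polyfun pm] ex _ l [OF H0] l [OF H1(1)]])
            (use nonzero_on_hyperplane [OF HA A(1)] A in auto)
      qed
    qed
  qed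
  from this [of "A - {H}"] show "lifts V" by (simp add: cofactor_all)
qed

section \<open>Lifting under local freeness\<close>

lemma lifts_sum:
  assumes "\<And>j. j \<in> J \<Longrightarrow> c j \<in> polyfun" "\<And>j. j \<in> J \<Longrightarrow> lifts (V j)"
    and "\<And>x i. x \<in> H \<Longrightarrow> U x i = (\<Sum>j\<in>J. c j x * V j x i)"
  shows "lifts U"
proof -
  have "\<forall>j\<in>J. \<exists>m. m \<in> Mfields A H \<and> (\<forall>x\<in>H. \<forall>i. m x i = V j x i)"
    using assms(2) unfolding lifts_def by blast
  from bchoice [OF this] obtain m where m: "\<forall>j\<in>J. m j \<in> Mfields A H \<and> (\<forall>x\<in>H. \<forall>i. m j x i = V j x i)"
    by (rule exE)
  have "(\<lambda>x i. \<Sum>j\<in>J. c j x * m j x i) \<in> Mfields A H" using assms(1) m by (intro Mfields_sum) auto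
  then show ?thesis by (rule liftsI) (use m assms(3) in auto)
qed

lemma Nfields_localization:
  assumes V: "V \<in> Nfields A H" and x0: "x0 \<in> H"
  shows "V \<in> Nfields (localization A x0) H"
proof -
  let ?L = "localization A x0"
  have "restr_mult ?L H (H' \<inter> H) = restr_mult A H (H' \<inter> H)" if "H' \<in> ?L" for H'
  proof -
    have "{H'' \<in> ?L - {H}. H'' \<inter> H = H' \<inter> H} = {H'' \<in> A - {H}. H'' \<inter> H = H' \<inter> H}"
      using that x0 by (auto simp: localization_def)
    then show ?thesis by (simp add: restr_mult_def)
  qed
  with V show ?thesis by (auto simp: Nfields_def localization_def)
qed

text \<open>Away from the origin of \<open>H\<close> the restriction map is onto by local freeness, so its cokernel
  is killed by a power of every linear form.\<close>

lemma lifts_power: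
  assumes loc: "locally_free_along A H" and V: "V \<in> Nfields A H"
  shows "lifts (\<lambda>x i. x j ^ card (A - {H}) * V x i)"
proof -
  have "lifts (\<lambda>x i. x j ^ card Z * (cofactor Z x * V x i))" if "Z \<subseteq> A - {H}" for Z
    using finite_subset [OF that finite_Diff [OF fin]] that
  proof (induction Z rule: finite_psubset_induct)
    case (psubset Z)
    show ?case
    proof (cases "\<exists>x0\<in>H - {\<lambda>_. 0}. \<forall>H'\<in>Z. x0 \<in> H'")
      case True
      \<comment> \<open>All of \<open>Z\<close> survives in the localization at \<open>x0\<close>,
        so a lift there is tangent to \<open>Z\<close>; the cofactor takes care of the other
        hyperplanes.\<close>
      then obtain x0 where x0: "x0 \<in> H" "x0 \<noteq> (\<lambda>_. 0)" "\<forall>H'\<in>Z. x0 \<in> H'" by auto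
      interpret L: arr "localization A x0" H by (rule arr_localization [OF x0(1)])
      have "free_arrangement (localization A x0)"
        using loc x0 by (auto simp: locally_free_along_def)
      then have "L.restriction_onto" by (rule L.free_imp_restriction_onto)
      then have "L.lifts V" using Nfields_localization [OF V x0(1)] by (simp add: L.restriction_onto_def)
      then obtain m where m: "m \<in> Mfields (localization A x0) H" "\<forall>x\<in>H. \<forall>i. m x i = V x i"
        by (rule L.liftsE)
      have "(\<lambda>x i. cofactor Z x * m x i) \<in> Mfields A H"
      proof (rule cofactor_Mfields [OF L.Mfields_polymap [OF m(1)] L.Mfields_in [OF m(1)]])
        fix H' x assume H': "H' \<in> Z" "x \<in> H'"
        then have "H' \<in> localization A x0" using x0 psubset.prems by (auto simp: localization_def)
        with m(1) H' show "m x \<in> H'" by (auto simp: Mfields_def Dfields_def)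
      qed
      then have "(\<lambda>x i. x j ^ card Z * (cofactor Z x * m x i)) \<in> Mfields A H"
        by (rule Mfields_scale [rotated]) (intro polyfun_power polyfun.coord)
      then show ?thesis by (rule liftsI) (use m in simp)
    next
      \<comment> \<open>The forms of \<open>Z\<close> now have only the origin as common zero on
        \<open>H\<close>, so \<open>x j\<close> is a combination of them there. Each form times
        \<open>cofactor Z\<close> is the cofactor of a smaller set already treated, so one more
        factor \<open>x j\<close> suffices.\<close>
      case False
      have "\<exists>g. (\<forall>H'\<in>Z. g H' \<in> polyfun) \<and> (\<forall>x\<in>H. x j = (\<Sum>H'\<in>Z. lin (nrm H') x * g H' x))"
      proof (rule lin_dvd_sum [OF psubset.hyps H_subsp polyfun.coord])
        fix x assume x: "x \<in> H" "\<And>H'. H' \<in> Z \<Longrightarrow> lin (nrm H') x = 0"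
        then have "\<forall>H'\<in>Z. x \<in> H'" using psubset.prems in_hyp_iff [OF hypl] by blast
        with False x have "x = (\<lambda>_. 0)" by auto
        then show "x j = 0" by simp
      qed
      then obtain g where g: "\<forall>H'\<in>Z. g H' \<in> polyfun" "\<forall>x\<in>H. x j = (\<Sum>H'\<in>Z. lin (nrm H') x * g H' x)"
        by blast
      show ?thesis
      proof (rule lifts_sum [of Z g "\<lambda>H' x i. x j ^ card (Z - {H'}) * (cofactor (Z - {H'}) x * V x i)"])
        show "g H' \<in> polyfun" if "H' \<in> Z" for H' using g that by blast
        show "lifts (\<lambda>x i. x j ^ card (Z - {H'}) * (cofactor (Z - {H'}) x * V x i))" if "H' \<in> Z" for H'
          using psubset.IH [of "Z - {H'}"] psubset.prems that by auto
        fix x i assume x: "x \<in> H"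
        show "x j ^ card Z * (cofactor Z x * V x i)
            = (\<Sum>H'\<in>Z. g H' x * (x j ^ card (Z - {H'}) * (cofactor (Z - {H'}) x * V x i)))"
        proof (cases "Z = {}")
          case True
          \<comment> \<open>With \<open>Z\<close> empty, failure of the first case means that
            \<open>H\<close> is the origin alone.\<close>
          with False x g(2) have "\<forall>x\<in>H. x = (\<lambda>_. 0)" by auto
          moreover have "V x \<in> H" using V x by (simp add: Nfields_def)
          ultimately have "V x = (\<lambda>_. 0)" by blast
          with True show ?thesis by simp
        next
          case Z0: False
          have "(\<Sum>H'\<in>Z. g H' x * (x j ^ card (Z - {H'}) * (cofactor (Z - {H'}) x * V x i)))
              = (\<Sum>H'\<in>Z. (lin (nrm H') x * g H' x) * (x j ^ (card Z - 1) * (cofactor Z x * V x i)))"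
            by (rule sum.cong) (use psubset.hyps psubset.prems in \<open>auto simp: cofactor_remove mult_ac\<close>)
          also have "\<dots> = (\<Sum>H'\<in>Z. lin (nrm H') x * g H' x) * (x j ^ (card Z - 1) * (cofactor Z x * V x i))"
            by (simp only: sum_distrib_right)
          also have "(\<Sum>H'\<in>Z. lin (nrm H') x * g H' x) = x j" using g(2) x by simp
          also have "x j * (x j ^ (card Z - 1) * (cofactor Z x * V x i)) = x j ^ card Z * (cofactor Z x * V x i)"
            using Z0 psubset.hyps by (simp add: card_gt_0_iff power_eq_if)
          finally show ?thesis by simp
        qed
      qed
    qed
  qed
  from this [of "A - {H}"] show ?thesis by (simp add: cofactor_all)
qed

text \<open>A basis of \<open>Dfields A\<close> projects along the Euler field to generators of
  \<open>Mfields A H\<close>, one too many. The expansion of the Euler field supplies a relation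
  among them whose coefficients do not all vanish at the origin, so a minimal homogeneous system is
  smaller; surjectivity carries it to \<open>Nfields A H\<close>.\<close>

lemma free_imp_restriction_generated:
  assumes free: "free_arrangement A"
  shows "generated_by H (card (UNIV :: 'n set) - 1) (Nfields A H)"
proof -
  let ?n = "card (UNIV :: 'n set)"
  obtain e where e: "\<forall>k<?n. e k \<in> Dfields A" and sp: "spans UNIV {..<?n} e (Dfields A)"
    using free free_arrangement_iff by (auto simp: generated_by_def)
  have "\<forall>k\<in>{..<?n}. \<exists>r. r \<in> polyfun \<and> (\<forall>x. \<alpha> (e k x) = \<alpha> x * r x)"
    using e Dfields_alpha by (metis lessThan_iff)
  from bchoice [OF this] obtain r where r: "\<forall>k\<in>{..<?n}. r k \<in> polyfun \<and> (\<forall>x. \<alpha> (e k x) = \<alpha> x * r k x)"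
    by (rule exE)
  define p where "p k x i = e k x i - r k x * x i" for k x i
  have pM: "p k \<in> Mfields A H" if "k < ?n" for k
    unfolding p_def [abs_def] using Euler_projection [of "e k" "r k"] e r that by auto
  have al: "\<alpha> (\<lambda>i. \<Sum>k<?n. c k * e k x i) = \<alpha> x * (\<Sum>k<?n. c k * r k x)" for c x
    using r by (simp add: lin_sum lin_scale sum_distrib_left mult.left_commute)
  have pe: "(\<Sum>k<?n. c k * p k x i) = (\<Sum>k<?n. c k * e k x i) - (\<Sum>k<?n. c k * r k x) * x i" for c x i
    by (simp add: p_def right_diff_distrib sum_subtractf sum_distrib_right mult.assoc)
  have gen: "\<exists>c. (\<forall>k<?n. c k \<in> polyfun) \<and> (\<forall>x\<in>UNIV. \<forall>i. 1 * V x i = (\<Sum>k<?n. c k x * p k x i))"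
    if V: "V \<in> Mfields A H" for V
  proof -
    obtain c where c: "\<forall>k\<in>{..<?n}. c k \<in> polyfun" "\<forall>x\<in>UNIV. \<forall>i. V x i = (\<Sum>k\<in>{..<?n}. c k x * e k x i)"
      by (rule spansE [OF sp Mfields_D [OF V]])
    have "(\<Sum>k<?n. c k x * r k x) = 0" for x
    proof (rule alpha_cancel [of "\<lambda>x. \<Sum>k<?n. c k x * r k x"])
      show "(\<lambda>x. \<Sum>k<?n. c k x * r k x) \<in> polyfun" using c r by (intro polyfun_intros) auto
      fix x
      have "V x = (\<lambda>i. \<Sum>k<?n. c k x * e k x i)" using c(2) by auto
      with al [of "\<lambda>k. c k x" x] Mfields_in [OF V, of x]
      show "\<alpha> x * (\<Sum>k<?n. c k x * r k x) = 0" by (simp add: H_iff)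
    qed
    with c pe show ?thesis by (intro exI [of _ c]) auto
  qed
  have one: "(\<lambda>_. 1) \<in> polyfun" "(\<lambda>_. 1 :: 'k) (\<lambda>_ :: 'n. 0 :: 'k) \<noteq> 0" by (auto intro: polyfun.const)
  obtain J :: "(nat \<times> nat) set" and h deg where J: "finite J" "\<forall>j\<in>J. h j \<in> Mfields A H"
    "\<forall>j\<in>J. \<forall>i. hom (deg j) (\<lambda>x. h j x i)" "spans UNIV J h (Mfields A H)"
    "minimal_gens UNIV J h" "card J \<le> ?n"
    by (rule homogeneous_generators [OF subsp_UNIV Mfields_polymap Mfields_vcomp pM one gen])
  obtain t where t: "\<forall>k\<in>{..<?n}. t k \<in> polyfun" "\<forall>x\<in>UNIV. \<forall>i. x i = (\<Sum>k\<in>{..<?n}. t k x * e k x i)"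
    by (rule spansE [OF sp Euler_Dfields])
  \<comment> \<open>\<alpha> is applied to the expansion of the Euler field and then cancelled;
    hence some \<open>t k\<close> is nonzero at the origin.\<close>
  have t1: "(\<Sum>k<?n. t k x * r k x) = 1" for x
  proof -
    have "(\<Sum>k<?n. t k x * r k x) - 1 = 0"
    proof (rule alpha_cancel [of "\<lambda>x. (\<Sum>k<?n. t k x * r k x) - 1"])
      show "(\<lambda>x. (\<Sum>k<?n. t k x * r k x) - 1) \<in> polyfun" using t r by (intro polyfun_intros) auto
      fix x
      have "\<alpha> x = \<alpha> (\<lambda>i. \<Sum>k<?n. t k x * e k x i)"
        by (rule arg_cong [of _ _ \<alpha>], rule ext) (use t(2) in blast)
      then show "\<alpha> x * ((\<Sum>k<?n. t k x * r k x) - 1) = 0"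
        using al [of "\<lambda>k. t k x" x] by (simp add: algebra_simps)
    qed
    then show ?thesis by simp
  qed
  have t0: "(\<Sum>k<?n. t k x * p k x i) = 0" for x i
    using pe [of "\<lambda>k. t k x" x i] t1 [of x] t(2) [rule_format, of x i] by simp
  have "card J < ?n"
  proof (rule ccontr)
    assume "\<not> card J < ?n"
    \<comment> \<open>The extra index \<open>None\<close> stands for the Euler relation, so
      \<open>card J = ?n\<close> already gives more unknowns than equations.\<close>
    define I where "I = insert None (Some ` J)"
    have I: "finite I" "card {..<?n} < card I"
      using J(1) \<open>\<not> card J < ?n\<close> by (auto simp: I_def card_image)
    have "\<forall>j\<in>J. \<exists>c. (\<forall>k<?n. c k \<in> polyfun) \<and> (\<forall>x\<in>UNIV. \<forall>i. 1 * h j x i = (\<Sum>k<?n. c k x * p k x i))"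
      using gen J(2) by blast
    from bchoice [OF this] obtain u where u: "\<forall>j\<in>J. (\<forall>k<?n. u j k \<in> polyfun) \<and>
        (\<forall>x\<in>UNIV. \<forall>i. 1 * h j x i = (\<Sum>k<?n. u j k x * p k x i))" by (rule exE)
    let ?u = "\<lambda>j k. case j of None \<Rightarrow> t k (\<lambda>_. 0) | Some j \<Rightarrow> u j k (\<lambda>_. 0)"
    obtain a where "(\<exists>j\<in>I. a j \<noteq> 0) \<and> (\<forall>k\<in>{..<?n}. (\<Sum>j\<in>I. a j * ?u j k) = 0)"
      using underdetermined_system [OF _ I(1,2), of ?u] by auto
    then have a: "\<exists>j\<in>I. a j \<noteq> 0" "\<forall>k\<in>{..<?n}. (\<Sum>j\<in>I. a j * ?u j k) = 0" by blast+
    have Isum: "(\<Sum>j\<in>I. f j) = f None + (\<Sum>j\<in>J. f (Some j))" for f :: "(nat \<times> nat) option \<Rightarrow> 'k"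
      using J(1) by (simp add: I_def sum.reindex)
    let ?r = "\<lambda>k x. a None * t k x + (\<Sum>j\<in>J. a (Some j) * u j k x)"
    have rp: "?r k \<in> polyfun" if "k < ?n" for k using t u that by (intro polyfun_intros) auto
    have r0: "?r k (\<lambda>_. 0) = 0" if "k < ?n" for k using a(2) that by (simp add: Isum)
    have req: "1 * (\<Sum>j\<in>J. a (Some j) * h j x i) = (\<Sum>k<?n. ?r k x * p k x i)" for x i
    proof -
      have "(\<Sum>k<?n. ?r k x * p k x i) = a None * (\<Sum>k<?n. t k x * p k x i)
          + (\<Sum>k<?n. (\<Sum>j\<in>J. a (Some j) * u j k x) * p k x i)"
        by (simp add: distrib_right sum.distrib sum_distrib_left mult.assoc)
      also have "(\<Sum>k<?n. (\<Sum>j\<in>J. a (Some j) * u j k x) * p k x i)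
          = (\<Sum>j\<in>J. a (Some j) * (\<Sum>k<?n. u j k x * p k x i))"
        unfolding sum_distrib_left sum_distrib_right by (subst sum.swap) (simp add: mult.assoc)
      also have "\<dots> = (\<Sum>j\<in>J. a (Some j) * h j x i)" using u by simp
      finally show ?thesis using t0 by simp
    qed
    have aJ: "a (Some j) = 0" if "j \<in> J" for j
      by (rule minimal_gens_combination [of UNIV J h "Mfields A H" ?n p "\<lambda>_. 1" ?r "\<lambda>j. a (Some j)",
          OF J(5,4) pM one rp r0 req that])
    have "a None * t k (\<lambda>_. 0) = 0" if "k < ?n" for k using r0 [OF that] aJ by simp
    then have "(\<Sum>k<?n. a None * t k (\<lambda>_. 0) * r k (\<lambda>_. 0)) = 0"
      by (intro sum.neutral) auto
    then have "a None * (\<Sum>k<?n. t k (\<lambda>_. 0) * r k (\<lambda>_. 0)) = 0"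
      by (simp add: sum_distrib_left mult.assoc)
    then have "a None = 0" using t1 by simp
    with aJ a(1) show False by (auto simp: I_def)
  qed
  then have cJ: "card J \<le> ?n - 1" by simp
  show ?thesis
  proof (rule generated_byI [OF J(1) cJ _ Nfields_zero, of h])
    show "h j \<in> Nfields A H" if "j \<in> J" for j using J(2) that Mfields_subset_Nfields by blast
    show "spans H J h (Nfields A H)"
    proof (rule spansI)
      fix V assume "V \<in> Nfields A H"
      then have "lifts V" using free_imp_restriction_onto [OF free] by (simp add: restriction_onto_def)
      then obtain m where m: "m \<in> Mfields A H" "\<forall>x\<in>H. \<forall>i. m x i = V x i" by (rule liftsE)
      obtain c where c: "\<forall>j\<in>J. c j \<in> polyfun" "\<forall>x\<in>UNIV. \<forall>i. m x i = (\<Sum>j\<in>J. c j x * h j x i)"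
        by (rule spansE [OF J(4) m(1)])
      have "\<forall>x\<in>H. \<forall>i. V x i = (\<Sum>j\<in>J. c j x * h j x i)"
        using m(2) c(2) by (metis UNIV_I)
      with c(1) show "\<exists>c. (\<forall>j\<in>J. c j \<in> polyfun) \<and> (\<forall>x\<in>H. \<forall>i. V x i = (\<Sum>j\<in>J. c j x * h j x i))"
        by (intro exI [of _ c] conjI)
    qed
  qed
qed

end

section \<open>Surjectivity from local freeness\<close>

text \<open>Induction on \<open>j\<close>. Modulo \<open>lin y0\<close>, regularity of the other two
  forms makes \<open>c\<close> a multiple of \<open>lin y1 ^ K\<close>; subtracting it and
  cancelling one factor \<open>lin y0\<close> lowers \<open>j\<close>.\<close>

lemma regular_triple:
  assumes W: "subsp W" and n1: "\<exists>x\<in>W. lin y0 x \<noteq> 0"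
    and n2: "\<exists>x\<in>W. lin y0 x = 0 \<and> lin y1 x \<noteq> 0"
    and n3: "\<exists>x\<in>W. lin y0 x = 0 \<and> lin y1 x = 0 \<and> lin y2 x \<noteq> 0"
    and c: "c \<in> polyfun" and d: "d \<in> polyfun" and e: "e \<in> polyfun"
    and eq: "\<And>x. x \<in> W \<Longrightarrow> lin y2 x ^ K * c x = lin y1 x ^ K * d x + lin y0 x ^ j * e x"
  shows "\<exists>u\<in>polyfun. \<exists>v\<in>polyfun. \<forall>x\<in>W. c x = lin y1 x ^ K * u x + lin y0 x ^ j * v x"
  using c d eq
proof (induction j arbitrary: c d)
  case 0
  then show ?case
    by (intro bexI [of _ "\<lambda>_. 0"] bexI [of _ c]) (auto intro: polyfun.const)
next
  case (Suc j)
  let ?W = "W \<inter> hyp y0"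
  have W': "subsp ?W" by (simp add: W subsp_Int)
  have p1: "(\<lambda>x. lin y1 x ^ K) \<in> polyfun" and p2: "(\<lambda>x. lin y2 x ^ K) \<in> polyfun"
    by (intro polyfun_intros)+
  have "\<exists>u\<in>polyfun. \<forall>x\<in>?W. c x = lin y1 x ^ K * u x"
  proof (rule lin_power_regular [OF W' Suc.prems(1,2) p2])
    show "lin y2 x ^ K * c x = lin y1 x ^ K * d x" if "x \<in> ?W" for x
      using Suc.prems(3) [of x] that by (simp add: hyp_def)
  qed (use n2 n3 in \<open>auto simp: hyp_def\<close>)
  then obtain u where u: "u \<in> polyfun" "\<forall>x\<in>?W. c x = lin y1 x ^ K * u x" by blast
  have "\<exists>c'\<in>polyfun. \<forall>x\<in>W. c x - lin y1 x ^ K * u x = lin y0 x * c' x"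
    by (rule lin_dvd [OF W])
      (use Suc.prems u p1 in \<open>auto simp: hyp_def intro!: polyfun_diff polyfun.mult\<close>)
  then obtain c' where c': "c' \<in> polyfun" "\<forall>x\<in>W. c x - lin y1 x ^ K * u x = lin y0 x * c' x" by blast
  have ceq: "c x = lin y1 x ^ K * u x + lin y0 x * c' x" if "x \<in> W" for x
    using c'(2) that by (simp add: algebra_simps)
  have dp: "(\<lambda>x. d x - lin y2 x ^ K * u x) \<in> polyfun"
    using Suc.prems u p2 by (intro polyfun_diff polyfun.mult)
  have gp: "(\<lambda>x. lin y2 x ^ K * c' x - lin y0 x ^ j * e x) \<in> polyfun"
    using c' e by (intro polyfun_intros)
  \<comment> \<open>After substitution for \<open>c\<close>, the product of
    \<open>lin y1 ^ K\<close> with this difference is divisible by \<open>lin y0\<close>, and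
    \<open>lin y1\<close> is regular modulo \<open>lin y0\<close>.\<close>
  have "\<exists>d'\<in>polyfun. \<forall>x\<in>W. d x - lin y2 x ^ K * u x = lin y0 x ^ 1 * d' x"
  proof (rule lin_power_regular [OF W dp gp p1])
    show "lin y1 x ^ K * (d x - lin y2 x ^ K * u x)
        = lin y0 x ^ 1 * (lin y2 x ^ K * c' x - lin y0 x ^ j * e x)" if "x \<in> W" for x
      using Suc.prems(3) [OF that] ceq [OF that] by (simp add: algebra_simps)
  qed (use n1 n2 in auto)
  then obtain d' where d': "d' \<in> polyfun" "\<forall>x\<in>W. d x - lin y2 x ^ K * u x = lin y0 x * d' x" by auto
  have "lin y2 x ^ K * c' x = lin y1 x ^ K * d' x + lin y0 x ^ j * e x" if x: "x \<in> W" for x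
  proof -
    have "lin y2 x ^ K * c' x - (lin y1 x ^ K * d' x + lin y0 x ^ j * e x) = 0"
    proof (rule polyfun_cancel [OF W polyfun_lin _ n1 _ x])
      show "(\<lambda>x. lin y2 x ^ K * c' x - (lin y1 x ^ K * d' x + lin y0 x ^ j * e x)) \<in> polyfun"
        using c' d' e by (intro polyfun_intros)
      fix x assume x: "x \<in> W"
      have "d x = lin y2 x ^ K * u x + lin y0 x * d' x" using d'(2) x by (simp add: algebra_simps)
      with Suc.prems(3) [OF x] ceq [OF x]
      show "lin y0 x * (lin y2 x ^ K * c' x - (lin y1 x ^ K * d' x + lin y0 x ^ j * e x)) = 0"
        by (simp add: algebra_simps)
    qed
    then show ?thesis by simp
  qed
  from Suc.IH [OF c'(1) d'(1) this] obtain u' v where uv: "u' \<in> polyfun" "v \<in> polyfun"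
    "\<forall>x\<in>W. c' x = lin y1 x ^ K * u' x + lin y0 x ^ j * v x" by blast
  have "(\<lambda>x. u x + lin y0 x * u' x) \<in> polyfun" using u uv by (intro polyfun_intros)
  moreover have "\<forall>x\<in>W. c x = lin y1 x ^ K * (u x + lin y0 x * u' x) + lin y0 x ^ Suc j * v x"
    using ceq uv(3) by (simp add: algebra_simps)
  ultimately show ?case using uv(2) by (intro bexI [of _ v] bexI [of _ "\<lambda>x. u x + lin y0 x * u' x"])
qed

text \<open>A Cech 1-cocycle with values in the polynomial ring of \<open>W\<close>, for the open cover by the
  nonvanishing loci of \<open>y0\<close>, \<open>y1\<close>, \<open>y2\<close>, is a coboundary.\<close>

lemma cocycle_is_coboundary:
  assumes W: "subsp W" and n1: "\<exists>x\<in>W. lin y0 x \<noteq> 0"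
    and n2: "\<exists>x\<in>W. lin y0 x = 0 \<and> lin y1 x \<noteq> 0"
    and n3: "\<exists>x\<in>W. lin y0 x = 0 \<and> lin y1 x = 0 \<and> lin y2 x \<noteq> 0"
    and c: "c1 \<in> polyfun" "c2 \<in> polyfun" and d: "d \<in> polyfun"
    and eq: "\<And>x. x \<in> W \<Longrightarrow> lin y2 x ^ K * c1 x - lin y1 x ^ K * c2 x + lin y0 x ^ K * d x = 0"
  shows "\<exists>u0 u1 u2. u0 \<in> polyfun \<and> u1 \<in> polyfun \<and> u2 \<in> polyfun \<and>
    (\<forall>x\<in>W. c1 x = lin y1 x ^ K * u0 x - lin y0 x ^ K * u1 x \<and>
            c2 x = lin y2 x ^ K * u0 x - lin y0 x ^ K * u2 x)"
proof -
  have "\<exists>u\<in>polyfun. \<exists>v\<in>polyfun. \<forall>x\<in>W. c1 x = lin y1 x ^ K * u x + lin y0 x ^ K * v x"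
  proof (rule regular_triple [OF W n1 n2 n3 c polyfun_uminus [OF d]])
    show "lin y2 x ^ K * c1 x = lin y1 x ^ K * c2 x + lin y0 x ^ K * (- d x)" if "x \<in> W" for x
      using eq [OF that] by (simp add: algebra_simps)
  qed
  then obtain u v where uv: "u \<in> polyfun" "v \<in> polyfun"
    "\<forall>x\<in>W. c1 x = lin y1 x ^ K * u x + lin y0 x ^ K * v x" by blast
  have p1: "(\<lambda>x. lin y1 x ^ K) \<in> polyfun" by (intro polyfun_intros)
  have fp: "(\<lambda>x. lin y2 x ^ K * u x - c2 x) \<in> polyfun" using uv c by (intro polyfun_intros)
  have gp: "(\<lambda>x. - (lin y2 x ^ K * v x) - d x) \<in> polyfun" using uv d by (intro polyfun_intros)
  have "\<exists>w\<in>polyfun. \<forall>x\<in>W. lin y2 x ^ K * u x - c2 x = lin y0 x ^ K * w x"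
  proof (rule lin_power_regular [OF W fp gp p1])
    show "lin y1 x ^ K * (lin y2 x ^ K * u x - c2 x) = lin y0 x ^ K * (- (lin y2 x ^ K * v x) - d x)"
      if "x \<in> W" for x
    proof -
      have "lin y2 x ^ K * (lin y1 x ^ K * u x + lin y0 x ^ K * v x) - lin y1 x ^ K * c2 x + lin y0 x ^ K * d x = 0"
        using eq [OF that] uv(3) that by simp
      moreover have "(lin y1 x ^ K * (lin y2 x ^ K * u x - c2 x)) - lin y0 x ^ K * (- (lin y2 x ^ K * v x) - d x)
        = lin y2 x ^ K * (lin y1 x ^ K * u x + lin y0 x ^ K * v x) - lin y1 x ^ K * c2 x + lin y0 x ^ K * d x"
        by (simp add: algebra_simps)
      ultimately show ?thesis by simp
    qed
  qed (use n1 n2 in auto)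
  then obtain w where w: "w \<in> polyfun" "\<forall>x\<in>W. lin y2 x ^ K * u x - c2 x = lin y0 x ^ K * w x" by blast
  show ?thesis
  proof (rule exI [of _ u], rule exI [of _ "\<lambda>x. - v x"], rule exI [of _ w], intro conjI ballI)
    fix x assume x: "x \<in> W"
    show "c1 x = lin y1 x ^ K * u x - lin y0 x ^ K * (- v x)" using uv x by simp
    have "lin y2 x ^ K * u x - c2 x = lin y0 x ^ K * w x" using w(2) x by blast
    then show "c2 x = lin y2 x ^ K * u x - lin y0 x ^ K * w x" by (simp add: algebra_simps)
  qed (use uv w in auto)
qed

section \<open>The ambient module of fields with values in \<open>H\<close>\<close>

context arr
begin

lemma Nfields_sum:
  assumes c: "\<And>j. j \<in> J \<Longrightarrow> c j \<in> polyfun" and V: "\<And>j. j \<in> J \<Longrightarrow> V j \<in> Nfields A H"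
  shows "(\<lambda>x i. \<Sum>j\<in>J. c j x * V j x i) \<in> Nfields A H"
  unfolding Nfields_def
proof (intro CollectI conjI ballI)
  show "polymap (\<lambda>x i. \<Sum>j\<in>J. c j x * V j x i)"
    using c V by (intro polymap_sum) (auto simp: Nfields_def)
  show "(\<lambda>i. \<Sum>j\<in>J. c j x * V j x i) \<in> H" if "x \<in> H" for x
    by (rule subsp_sum [OF H_subsp]) (use V that in \<open>auto simp: Nfields_def\<close>)
  fix H' assume H': "H' \<in> A - {H}"
  let ?m = "restr_mult A H (H' \<inter> H)"
  have "\<forall>j\<in>J. \<exists>g. g \<in> polyfun \<and> (\<forall>x\<in>H. lin (nrm H') (V j x) = lin (nrm H') x ^ ?m * g x)"
  proof
    fix j assume "j \<in> J"
    obtain g where "g \<in> polyfun" "\<forall>x\<in>H. lin (nrm H') (V j x) = lin (nrm H') x ^ ?m * g x"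
      using NfieldsE [OF V [OF \<open>j \<in> J\<close>], of H'] H' by blast
    then show "\<exists>g. g \<in> polyfun \<and> (\<forall>x\<in>H. lin (nrm H') (V j x) = lin (nrm H') x ^ ?m * g x)" by blast
  qed
  from bchoice [OF this] obtain g where
    g: "\<forall>j\<in>J. g j \<in> polyfun \<and> (\<forall>x\<in>H. lin (nrm H') (V j x) = lin (nrm H') x ^ ?m * g j x)" by (rule exE)
  let ?g = "\<lambda>x. \<Sum>j\<in>J. c j x * g j x"
  have "?g \<in> polyfun" using c g by (intro polyfun_intros) auto
  moreover have "lin (nrm H') (\<lambda>i. \<Sum>j\<in>J. c j x * V j x i) = lin (nrm H') x ^ ?m * ?g x" if "x \<in> H" for x
  proof -
    have "lin (nrm H') (\<lambda>i. \<Sum>j\<in>J. c j x * V j x i) = (\<Sum>j\<in>J. c j x * lin (nrm H') (V j x))"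
      by (simp add: lin_sum lin_scale)
    also have "\<dots> = (\<Sum>j\<in>J. lin (nrm H') x ^ ?m * (c j x * g j x))"
      by (rule sum.cong) (use g that in auto)
    finally show ?thesis by (simp add: sum_distrib_left)
  qed
  ultimately show "\<exists>g\<in>polyfun. \<forall>x\<in>H. lin (nrm H') (\<lambda>i. \<Sum>j\<in>J. c j x * V j x i) = lin (nrm H') x ^ ?m * g x"
    by (intro bexI [of _ ?g]) blast+
qed

definition Hfields :: "(('n \<Rightarrow> 'k) \<Rightarrow> 'n \<Rightarrow> 'k) set" where
  "Hfields = {V. polymap V \<and> (\<forall>x. V x \<in> H)}"

lemma Hfields_diff: "U \<in> Hfields \<Longrightarrow> V \<in> Hfields \<Longrightarrow> (\<lambda>x i. U x i - V x i) \<in> Hfields"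
  using subsp_minus [OF H_subsp, of _ _ 1] by (auto simp: Hfields_def polymap_diff)

lemma Hfields_scale: "c \<in> polyfun \<Longrightarrow> V \<in> Hfields \<Longrightarrow> (\<lambda>x i. c x * V x i) \<in> Hfields"
  using subsp_scale [OF H_subsp] by (auto simp: Hfields_def polymap_scale)

lemma Hfields_add: "U \<in> Hfields \<Longrightarrow> V \<in> Hfields \<Longrightarrow> (\<lambda>x i. U x i + V x i) \<in> Hfields"
  using subsp_line [OF H_subsp, of _ _ 1] by (auto simp: Hfields_def polymap_def intro: polyfun.add)

lemma Mfields_H: "V \<in> Mfields A H \<Longrightarrow> V \<in> Hfields"
  by (simp add: Hfields_def Mfields_polymap Mfields_in)

lemma Hfields_divide_alpha:
  assumes V: "V \<in> Hfields" and 0: "\<And>x i. x \<in> H \<Longrightarrow> V x i = 0"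
  obtains q where "q \<in> Hfields" "\<forall>x i. V x i = \<alpha> x * q x i"
proof -
  have pm: "polymap V" using V by (simp add: Hfields_def)
  obtain q where q: "polymap q" "\<forall>x i. V x i = \<alpha> x * q x i"
    by (rule divide_alpha [OF pm]) (use 0 in auto)
  then have Vq: "V x = (\<lambda>i. \<alpha> x * q x i)" for x by auto
  have "\<alpha> (q x) = 0" for x
  proof (rule alpha_cancel [OF lin_polymap [OF q(1)]])
    fix x
    have "\<alpha> (V x) = 0" using V by (simp add: Hfields_def H_iff)
    then show "\<alpha> x * \<alpha> (q x) = 0" using Vq [of x] by (simp add: lin_scale)
  qed
  then have "q \<in> Hfields" using q by (simp add: Hfields_def H_iff)
  with q(2) show ?thesis using that by blast
qed

lemma Mfields_tangent: "V \<in> Mfields A H \<Longrightarrow> H' \<in> A \<Longrightarrow> x \<in> H' \<Longrightarrow> lin (nrm H') (V x) = 0"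
  using in_hyp_iff [OF hypl, of H'] unfolding Mfields_def Dfields_def by blast

lemma MfieldsI_H:
  assumes "V \<in> Hfields" "\<And>H' x. H' \<in> A - {H} \<Longrightarrow> x \<in> H' \<Longrightarrow> lin (nrm H') (V x) = 0"
  shows "V \<in> Mfields A H"
proof (rule MfieldsI)
  fix H' x assume "H' \<in> A" "H' \<noteq> H" "x \<in> H'"
  with assms(2) [of H' x] show "V x \<in> H'" using in_hyp_iff [OF hypl, of H'] by simp
qed (use assms(1) in \<open>auto simp: Hfields_def\<close>)

end

text \<open>The elements \<open>g\<close> satisfying \<open>torsion K g\<close> represent torsion classes, with respect to
  \<open>y 0\<close>, \<open>y 1\<close>, \<open>y 2\<close>, in the cokernel of the map that sends a vector field \<open>\<delta>\<close> with
  \<open>\<delta>(\<alpha>) = 0\<close> to the family of the \<open>\<delta>(\<alpha>') mod \<alpha>'\<close>; the kernel of this map is \<open>Mfields A H\<close>.\<close>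

locale triple_arr = arr A H
  for A :: "('n::finite \<Rightarrow> 'k::field_char_0) set set" and H +
  fixes y :: "nat \<Rightarrow> 'n \<Rightarrow> 'k" and q :: nat
  assumes n1: "\<exists>x\<in>H. lin (y 0) x \<noteq> 0"
    and n2: "\<exists>x\<in>H. lin (y 0) x = 0 \<and> lin (y 1) x \<noteq> 0"
    and n3: "\<exists>x\<in>H. lin (y 0) x = 0 \<and> lin (y 1) x = 0 \<and> lin (y 2) x \<noteq> 0"
    and lq: "V \<in> Nfields A H \<Longrightarrow> j < 3 \<Longrightarrow> lifts (\<lambda>x i. lin (y j) x ^ q * V x i)"
    and gen: "generated_by H (card (UNIV :: 'n set) - 1) (Nfields A H)"
begin

definition torsion :: "nat \<Rightarrow> (('n \<Rightarrow> 'k) set \<Rightarrow> ('n \<Rightarrow> 'k) \<Rightarrow> 'k) \<Rightarrow> bool" where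
  "torsion K g \<longleftrightarrow> (\<forall>H'\<in>A - {H}. g H' \<in> polyfun) \<and>
     (\<forall>j\<in>{..<3}. \<exists>\<delta>. \<delta> \<in> Hfields \<and> (\<forall>H'\<in>A - {H}. \<forall>x\<in>H'. lin (nrm H') (\<delta> x) = lin (y j) x ^ K * g H' x))"

text \<open>On \<open>H\<close> the forms \<open>y 0\<close> and \<open>y 1\<close> are independent,
  so the three cannot all be multiples of the form of \<open>H'\<close>. The point found allows
  cancelling a power of some \<open>y j\<close> on the trace.\<close>

lemma y_nonzero_on_trace:
  assumes "H' \<in> A - {H}"
  shows "\<exists>j\<in>{..<3}. \<exists>x\<in>H' \<inter> H. lin (y j) x \<noteq> 0"
proof (rule ccontr)
  assume *: "\<not> ?thesis"
  have "\<exists>c. \<forall>x\<in>H. lin (y j) x = c * lin (nrm H') x" if "j < 3" for j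
    by (rule lin_proportional [OF H_subsp])
      (use * that assms in_hyp_iff [OF hypl, of H'] in auto)
  then obtain c0 c1 where c: "\<forall>x\<in>H. lin (y 0) x = c0 * lin (nrm H') x"
    "\<forall>x\<in>H. lin (y 1) x = c1 * lin (nrm H') x"
    by (metis zero_less_numeral one_less_numeral_iff semiring_norm(77))
  from n1 c(1) have "c0 \<noteq> 0" by auto
  with n2 c show False by auto
qed

text \<open>Let \<open>\<delta> j\<close> represent \<open>y j ^ K * g\<close>. The cross
  differences \<open>\<theta> i j\<close> lie in \<open>Mfields A H\<close> and restrict to a Cech
  cocycle with values in the free module \<open>Nfields A H\<close>, hence to a coboundary given by
  fields \<open>N j\<close>. Subtracting the \<open>N j\<close>, after multiplying by
  \<open>y j ^ q\<close> to make them liftable, gives fields \<open>D j\<close> whose quotients by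
  \<open>y j ^ (K + q)\<close> agree on \<open>H\<close>. Their common value extends to
  \<open>\<epsilon>\<close>, and what remains of \<open>g\<close> is divisible by \<alpha>.\<close>

lemma torsion_step:
  assumes T: "torsion K g"
  shows "\<exists>\<epsilon> g' K'. \<epsilon> \<in> Hfields \<and> torsion K' g' \<and>
    (\<forall>H'\<in>A - {H}. \<forall>x\<in>H'. g H' x = lin (nrm H') (\<epsilon> x) + \<alpha> x * g' H' x)"
proof -
  let ?n = "card (UNIV :: 'n set) - 1"
  let ?y = "\<lambda>j x. lin (y j) x"
  have gp: "\<forall>H'\<in>A - {H}. g H' \<in> polyfun"
    and T': "\<forall>j\<in>{..<3}. \<exists>\<delta>. \<delta> \<in> Hfields \<and> (\<forall>H'\<in>A - {H}. \<forall>x\<in>H'. lin (nrm H') (\<delta> x) = ?y j x ^ K * g H' x)"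
    using T by (simp_all add: torsion_def)
  from bchoice [OF T'] obtain \<delta> where \<delta>: "\<forall>j\<in>{..<3}. \<delta> j \<in> Hfields \<and>
      (\<forall>H'\<in>A - {H}. \<forall>x\<in>H'. lin (nrm H') (\<delta> j x) = ?y j x ^ K * g H' x)" by (rule exE)
  define \<theta> where "\<theta> i j x k = ?y j x ^ K * \<delta> i x k - ?y i x ^ K * \<delta> j x k" for i j x k
  have \<theta>M: "\<theta> i j \<in> Mfields A H" if "i < 3" "j < 3" for i j
  proof (rule MfieldsI_H)
    show "\<theta> i j \<in> Hfields"
      unfolding \<theta>_def [abs_def] using \<delta> that
      by (intro Hfields_diff Hfields_scale polyfun_power polyfun_lin) auto
    show "lin (nrm H') (\<theta> i j x) = 0" if "H' \<in> A - {H}" "x \<in> H'" for H' x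
      unfolding \<theta>_def [abs_def] lin_diff lin_scale using \<delta> \<open>i < 3\<close> \<open>j < 3\<close> that by simp
  qed
  obtain e where e: "\<forall>k<?n. e k \<in> Nfields A H" and sp: "spans H {..<?n} e (Nfields A H)"
    using gen by (auto simp: generated_by_def)
  have \<theta>N: "\<theta> i j \<in> Nfields A H" if "i < 3" "j < 3" for i j
    using \<theta>M that Mfields_subset_Nfields by blast
  obtain c1 where c1: "\<forall>k\<in>{..<?n}. c1 k \<in> polyfun" "\<forall>x\<in>H. \<forall>i. \<theta> 0 1 x i = (\<Sum>k\<in>{..<?n}. c1 k x * e k x i)"
    by (rule spansE [OF sp \<theta>N [of 0 1]]) auto
  obtain c2 where c2: "\<forall>k\<in>{..<?n}. c2 k \<in> polyfun" "\<forall>x\<in>H. \<forall>i. \<theta> 0 2 x i = (\<Sum>k\<in>{..<?n}. c2 k x * e k x i)"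
    by (rule spansE [OF sp \<theta>N [of 0 2]]) auto
  obtain d where d: "\<forall>k\<in>{..<?n}. d k \<in> polyfun" "\<forall>x\<in>H. \<forall>i. \<theta> 1 2 x i = (\<Sum>k\<in>{..<?n}. d k x * e k x i)"
    by (rule spansE [OF sp \<theta>N [of 1 2]]) auto
  have rel: "?y 2 x ^ K * c1 k x - ?y 1 x ^ K * c2 k x + ?y 0 x ^ K * d k x = 0"
    if k: "k < ?n" and x: "x \<in> H" for k x
  proof (rule Nfields_indep [OF sp, of "\<lambda>k x. ?y 2 x ^ K * c1 k x - ?y 1 x ^ K * c2 k x + ?y 0 x ^ K * d k x", OF _ _ k x])
    show "(\<lambda>x. ?y 2 x ^ K * c1 k x - ?y 1 x ^ K * c2 k x + ?y 0 x ^ K * d k x) \<in> polyfun"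
      using c1 c2 d k by (intro polyfun_intros) auto
    fix x i assume x: "x \<in> H"
    have "(\<Sum>k<?n. (?y 2 x ^ K * c1 k x - ?y 1 x ^ K * c2 k x + ?y 0 x ^ K * d k x) * e k x i)
        = ?y 2 x ^ K * \<theta> 0 1 x i - ?y 1 x ^ K * \<theta> 0 2 x i + ?y 0 x ^ K * \<theta> 1 2 x i"
      using c1(2) c2(2) d(2) x
      by (simp add: left_diff_distrib distrib_right sum_subtractf sum.distrib sum_distrib_left mult.assoc)
    also have "\<dots> = 0" by (simp add: \<theta>_def algebra_simps)
    finally show "(\<Sum>k<?n. (?y 2 x ^ K * c1 k x - ?y 1 x ^ K * c2 k x + ?y 0 x ^ K * d k x) * e k x i) = 0" .
  qed
  have "\<forall>k\<in>{..<?n}. \<exists>u. (\<forall>j\<in>{..<3::nat}. u j \<in> polyfun) \<and>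
    (\<forall>x\<in>H. c1 k x = ?y 1 x ^ K * u 0 x - ?y 0 x ^ K * u 1 x \<and> c2 k x = ?y 2 x ^ K * u 0 x - ?y 0 x ^ K * u 2 x)"
  proof
    fix k assume k: "k \<in> {..<?n}"
    obtain u0 u1 u2 where u: "u0 \<in> polyfun" "u1 \<in> polyfun" "u2 \<in> polyfun"
      "\<forall>x\<in>H. c1 k x = ?y 1 x ^ K * u0 x - ?y 0 x ^ K * u1 x \<and> c2 k x = ?y 2 x ^ K * u0 x - ?y 0 x ^ K * u2 x"
      using cocycle_is_coboundary [OF H_subsp n1 n2 n3, of "c1 k" "c2 k" "d k" K] c1 c2 d k rel by auto
    show "\<exists>u. (\<forall>j\<in>{..<3::nat}. u j \<in> polyfun) \<and>
      (\<forall>x\<in>H. c1 k x = ?y 1 x ^ K * u 0 x - ?y 0 x ^ K * u 1 x \<and> c2 k x = ?y 2 x ^ K * u 0 x - ?y 0 x ^ K * u 2 x)"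
      by (rule exI [of _ "\<lambda>j. if j = 0 then u0 else if j = 1 then u1 else u2"]) (use u in auto)
  qed
  from bchoice [OF this] obtain u where u: "\<forall>k\<in>{..<?n}. (\<forall>j\<in>{..<3::nat}. u k j \<in> polyfun) \<and>
    (\<forall>x\<in>H. c1 k x = ?y 1 x ^ K * u k 0 x - ?y 0 x ^ K * u k 1 x \<and>
      c2 k x = ?y 2 x ^ K * u k 0 x - ?y 0 x ^ K * u k 2 x)" by (rule exE)
  define N where "N j x i = (\<Sum>k<?n. u k j x * e k x i)" for j x i
  have NN: "N j \<in> Nfields A H" if "j < 3" for j
    unfolding N_def [abs_def] using u e that by (intro Nfields_sum) auto
  have \<theta>eq: "\<theta> 0 j x i = ?y j x ^ K * N 0 x i - ?y 0 x ^ K * N j x i" if "j < 3" "x \<in> H" for j x i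
  proof -
    have "j = 0 \<or> j = 1 \<or> j = 2" using that by auto
    moreover have "\<theta> 0 1 x i = (\<Sum>k<?n. (?y 1 x ^ K * u k 0 x - ?y 0 x ^ K * u k 1 x) * e k x i)"
      using c1(2) u that by simp
    moreover have "\<theta> 0 2 x i = (\<Sum>k<?n. (?y 2 x ^ K * u k 0 x - ?y 0 x ^ K * u k 2 x) * e k x i)"
      using c2(2) u that by simp
    ultimately show ?thesis
      by (auto simp: \<theta>_def N_def left_diff_distrib sum_subtractf sum_distrib_left mult.assoc)
  qed
  have "\<forall>j\<in>{..<3}. \<exists>m. m \<in> Mfields A H \<and> (\<forall>x\<in>H. \<forall>i. m x i = ?y j x ^ q * N j x i)"
    using lq [OF NN] unfolding lifts_def Bex_def by simp
  from bchoice [OF this] obtain \<mu> where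
    \<mu>: "\<forall>j\<in>{..<3}. \<mu> j \<in> Mfields A H \<and> (\<forall>x\<in>H. \<forall>i. \<mu> j x i = ?y j x ^ q * N j x i)" by (rule exE)
  define K' where "K' = K + q"
  \<comment> \<open>Members of \<open>Mfields A H\<close> have zero image in the cokernel, so
    \<open>D j\<close> still represents \<open>g\<close>, now with exponent \<open>K + q\<close>; on
    \<open>H\<close> it equals \<open>y j ^ q * (\<delta> j - N j)\<close>.\<close>
  define D where "D j x i = ?y j x ^ q * \<delta> j x i - \<mu> j x i" for j x i
  have DH: "D j \<in> Hfields" if "j < 3" for j
    unfolding D_def [abs_def] using \<delta> \<mu> that Mfields_H
    by (intro Hfields_diff Hfields_scale polyfun_power polyfun_lin) auto
  have Dg: "lin (nrm H') (D j x) = ?y j x ^ K' * g H' x" if "j < 3" "H' \<in> A - {H}" "x \<in> H'" for j H' x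
  proof -
    have "lin (nrm H') (\<mu> j x) = 0" using Mfields_tangent [of "\<mu> j" H' x] \<mu> that by simp
    then show ?thesis
      unfolding D_def [abs_def] lin_diff lin_scale using \<delta> that by (simp add: K'_def power_add mult_ac)
  qed
  have D0: "?y j x ^ K' * D 0 x i = ?y 0 x ^ K' * D j x i" if "j < 3" "x \<in> H" for j x i
  proof -
    have "?y j x ^ K * \<delta> 0 x i - ?y 0 x ^ K * \<delta> j x i = ?y j x ^ K * N 0 x i - ?y 0 x ^ K * N j x i"
      using \<theta>eq [OF that, of i] by (simp add: \<theta>_def)
    then have eq: "?y j x ^ K * (\<delta> 0 x i - N 0 x i) = ?y 0 x ^ K * (\<delta> j x i - N j x i)"
      by (simp add: algebra_simps)
    have D: "D 0 x i = ?y 0 x ^ q * (\<delta> 0 x i - N 0 x i)" "D j x i = ?y j x ^ q * (\<delta> j x i - N j x i)"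
      using \<mu> that by (auto simp: D_def algebra_simps)
    have "?y j x ^ K' * D 0 x i = (?y j x ^ q * ?y 0 x ^ q) * (?y j x ^ K * (\<delta> 0 x i - N 0 x i))"
      by (simp only: D K'_def power_add mult_ac)
    also have "\<dots> = (?y j x ^ q * ?y 0 x ^ q) * (?y 0 x ^ K * (\<delta> j x i - N j x i))"
      by (simp only: eq)
    also have "\<dots> = ?y 0 x ^ K' * D j x i"
      by (simp only: D K'_def power_add mult_ac)
    finally show ?thesis .
  qed
  have Dp: "(\<lambda>x. D j x i) \<in> polyfun" if "j < 3" for j i
    using DH [OF that] by (simp add: Hfields_def polymap_def)
  have "\<forall>i. \<exists>f. f \<in> polyfun \<and> (\<forall>x\<in>H. D 0 x i = ?y 0 x ^ K' * f x)"
  proof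
    fix i
    have "\<exists>f\<in>polyfun. \<forall>x\<in>H. D 0 x i = ?y 0 x ^ K' * f x"
    proof (rule lin_power_regular [OF H_subsp Dp Dp])
      show "(\<lambda>x. ?y 1 x ^ K') \<in> polyfun" by (intro polyfun_intros)
      show "?y 1 x ^ K' * D 0 x i = ?y 0 x ^ K' * D 1 x i" if "x \<in> H" for x using D0 that by simp
    qed (use n1 n2 in auto)
    then show "\<exists>f. f \<in> polyfun \<and> (\<forall>x\<in>H. D 0 x i = ?y 0 x ^ K' * f x)" by blast
  qed
  from choice [OF this] obtain f where f: "\<forall>i. f i \<in> polyfun \<and> (\<forall>x\<in>H. D 0 x i = ?y 0 x ^ K' * f i x)"
    by (rule exE)
  have y0p: "(\<lambda>x. ?y 0 x ^ K') \<in> polyfun" and y0n: "\<exists>x\<in>H. ?y 0 x ^ K' \<noteq> 0"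
    using n1 by (auto intro!: polyfun_power polyfun_lin)
  have fpm: "polymap (\<lambda>x i. f i x)" using f by (simp add: polymap_def)
  have fH: "(\<lambda>i. f i x) \<in> H" if x: "x \<in> H" for x
  proof -
    have "\<alpha> (\<lambda>i. f i x) = 0"
    proof (rule polyfun_cancel [OF H_subsp y0p lin_polymap [OF fpm] y0n _ x])
      fix x assume x: "x \<in> H"
      have "D 0 x = (\<lambda>i. ?y 0 x ^ K' * f i x)" using f x by auto
      moreover have "\<alpha> (D 0 x) = 0" using DH [of 0] by (simp add: Hfields_def H_iff)
      ultimately show "?y 0 x ^ K' * \<alpha> (\<lambda>i. f i x) = 0" by (simp add: lin_scale)
    qed
    then show ?thesis by (simp add: H_iff)
  qed
  obtain \<epsilon> where \<epsilon>: "polymap \<epsilon>" "\<forall>x. \<epsilon> x \<in> H" "\<forall>x. (\<lambda>i. f i x) \<in> H \<longrightarrow> \<epsilon> x = (\<lambda>i. f i x)"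
    by (rule project_H [OF fpm])
  have \<epsilon>H: "\<epsilon> \<in> Hfields" using \<epsilon> by (simp add: Hfields_def)
  have D\<epsilon>: "D j x i - ?y j x ^ K' * \<epsilon> x i = 0" if j: "j < 3" and x: "x \<in> H" for j x i
  proof (rule polyfun_cancel [OF H_subsp y0p _ y0n _ x])
    show "(\<lambda>x. D j x i - ?y j x ^ K' * \<epsilon> x i) \<in> polyfun"
      using Dp [OF j] polymapD [OF \<epsilon>(1)] by (intro polyfun_diff polyfun.mult polyfun_power polyfun_lin) auto
    fix x assume x: "x \<in> H"
    have "D 0 x i = ?y 0 x ^ K' * \<epsilon> x i" using f fH [OF x] \<epsilon>(3) x by simp
    with D0 [OF j x, of i] show "?y 0 x ^ K' * (D j x i - ?y j x ^ K' * \<epsilon> x i) = 0"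
      by (auto simp: algebra_simps)
  qed
  have "\<forall>j\<in>{..<3}. \<exists>b. b \<in> Hfields \<and> (\<forall>x i. D j x i - ?y j x ^ K' * \<epsilon> x i = \<alpha> x * b x i)"
  proof
    fix j :: nat assume j: "j \<in> {..<3}"
    have "(\<lambda>x i. D j x i - ?y j x ^ K' * \<epsilon> x i) \<in> Hfields"
      using DH j \<epsilon>H by (intro Hfields_diff Hfields_scale polyfun_power polyfun_lin) auto
    then obtain b where "b \<in> Hfields" "\<forall>x i. D j x i - ?y j x ^ K' * \<epsilon> x i = \<alpha> x * b x i"
      by (rule Hfields_divide_alpha) (use D\<epsilon> j in auto)
    then show "\<exists>b. b \<in> Hfields \<and> (\<forall>x i. D j x i - ?y j x ^ K' * \<epsilon> x i = \<alpha> x * b x i)" by blast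
  qed
  from bchoice [OF this] obtain b where
    b: "\<forall>j\<in>{..<3}. b j \<in> Hfields \<and> (\<forall>x i. D j x i - ?y j x ^ K' * \<epsilon> x i = \<alpha> x * b j x i)" by (rule exE)
  \<comment> \<open>Used twice: restricted to the trace of \<open>H'\<close> it shows that
    \<open>g\<close> minus the image of \<open>\<epsilon>\<close> vanishes there, and after
    cancelling \<alpha> it makes the \<open>b j\<close> witnesses that the quotient is
    torsion.\<close>
  have key: "?y j x ^ K' * (g H' x - lin (nrm H') (\<epsilon> x)) = \<alpha> x * lin (nrm H') (b j x)"
    if "j < 3" "H' \<in> A - {H}" "x \<in> H'" for j H' x
  proof -
    have "(\<lambda>i. D j x i - ?y j x ^ K' * \<epsilon> x i) = (\<lambda>i. \<alpha> x * b j x i)" using b that by auto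
    then have "lin (nrm H') (\<lambda>i. D j x i - ?y j x ^ K' * \<epsilon> x i) = lin (nrm H') (\<lambda>i. \<alpha> x * b j x i)" by simp
    then show ?thesis unfolding lin_diff lin_scale using Dg [OF that] by (simp add: algebra_simps)
  qed
  have "\<forall>H'\<in>A - {H}. \<exists>g'. g' \<in> polyfun \<and> (\<forall>x\<in>H'. g H' x - lin (nrm H') (\<epsilon> x) = \<alpha> x * g' x)"
  proof
    fix H' assume H': "H' \<in> A - {H}"
    have sub: "subsp H'" using H' hyperplane_subsp [OF hypl] by simp
    have hp: "(\<lambda>x. g H' x - lin (nrm H') (\<epsilon> x)) \<in> polyfun"
      using gp H' lin_polymap [OF \<epsilon>(1)] by (intro polyfun_diff) auto
    obtain j where j: "j < 3" "\<exists>x\<in>H' \<inter> H. ?y j x \<noteq> 0" using y_nonzero_on_trace [OF H'] by auto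
    have z: "g H' x - lin (nrm H') (\<epsilon> x) = 0" if x: "x \<in> H' \<inter> H" for x
    proof (rule polyfun_cancel [OF subsp_Int [OF sub H_subsp] _ hp _ _ x])
      show "(\<lambda>x. ?y j x ^ K') \<in> polyfun" by (intro polyfun_intros)
      show "\<exists>x\<in>H' \<inter> H. ?y j x ^ K' \<noteq> 0" using j by auto
      show "?y j x ^ K' * (g H' x - lin (nrm H') (\<epsilon> x)) = 0" if "x \<in> H' \<inter> H" for x
        using key [OF j(1) H', of x] that by (simp add: H_iff)
    qed
    have "\<exists>g'\<in>polyfun. \<forall>x\<in>H'. g H' x - lin (nrm H') (\<epsilon> x) = \<alpha> x * g' x"
      by (rule lin_dvd [OF sub hp]) (use z H_iff in blast)
    then show "\<exists>g'. g' \<in> polyfun \<and> (\<forall>x\<in>H'. g H' x - lin (nrm H') (\<epsilon> x) = \<alpha> x * g' x)" by blast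
  qed
  from bchoice [OF this] obtain g' where
    g': "\<forall>H'\<in>A - {H}. g' H' \<in> polyfun \<and> (\<forall>x\<in>H'. g H' x - lin (nrm H') (\<epsilon> x) = \<alpha> x * g' H' x)" by (rule exE)
  have "torsion K' g'"
    unfolding torsion_def
  proof (intro conjI ballI)
    show "g' H' \<in> polyfun" if "H' \<in> A - {H}" for H' using g' that by blast
    fix j :: nat assume j: "j \<in> {..<3}"
    have bp: "polymap (b j)" using b j by (simp add: Hfields_def)
    have "lin (nrm H') (b j x) = ?y j x ^ K' * g' H' x" if H': "H' \<in> A - {H}" and x: "x \<in> H'" for H' x
    proof -
      have "?y j x ^ K' * g' H' x - lin (nrm H') (b j x) = 0"
      proof (rule zero_div_alpha [of H' "\<lambda>x. ?y j x ^ K' * g' H' x - lin (nrm H') (b j x)"])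
        show "(\<lambda>x. ?y j x ^ K' * g' H' x - lin (nrm H') (b j x)) \<in> polyfun"
          using g' H' lin_polymap [OF bp] by (intro polyfun_diff polyfun.mult polyfun_power polyfun_lin) auto
        fix x assume x: "x \<in> H'"
        have "g H' x - lin (nrm H') (\<epsilon> x) = \<alpha> x * g' H' x" using g' H' x by blast
        with key [of j H' x] j H' x
        show "\<alpha> x * (?y j x ^ K' * g' H' x - lin (nrm H') (b j x)) = 0"
          by (simp add: algebra_simps)
      qed (use H' x in auto)
      then show ?thesis by simp
    qed
    with b j show "\<exists>\<delta>. \<delta> \<in> Hfields \<and> (\<forall>H'\<in>A - {H}. \<forall>x\<in>H'. lin (nrm H') (\<delta> x) = ?y j x ^ K' * g' H' x)"
      by (intro exI [of _ "b j"]) blast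
  qed
  moreover have "g H' x = lin (nrm H') (\<epsilon> x) + \<alpha> x * g' H' x" if "H' \<in> A - {H}" "x \<in> H'" for H' x
  proof -
    have "g H' x - lin (nrm H') (\<epsilon> x) = \<alpha> x * g' H' x" using g' that by blast
    then show ?thesis by (simp add: algebra_simps)
  qed
  ultimately show ?thesis
    using \<epsilon>H by (intro exI [of _ \<epsilon>] exI [of _ g'] exI [of _ K'] conjI) blast+
qed

lemma torsion_iterate:
  assumes T: "torsion K g"
  shows "\<exists>\<epsilon> g' K'. \<epsilon> \<in> Hfields \<and> torsion K' g' \<and>
    (\<forall>H'\<in>A - {H}. \<forall>x\<in>H'. g H' x = lin (nrm H') (\<epsilon> x) + \<alpha> x ^ N * g' H' x)"
proof (induction N)
  case 0
  have "(\<lambda>_ _. 0) \<in> Hfields" using Mfields_H [OF Mfields_zero] .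
  with T show ?case by (intro exI [of _ "\<lambda>_ _. 0"] exI [of _ g] exI [of _ K]) simp
next
  case (Suc N)
  then obtain \<epsilon> g' K' where 1: "\<epsilon> \<in> Hfields" "torsion K' g'"
    "\<forall>H'\<in>A - {H}. \<forall>x\<in>H'. g H' x = lin (nrm H') (\<epsilon> x) + \<alpha> x ^ N * g' H' x" by blast
  from torsion_step [OF 1(2)] obtain \<epsilon>' g'' K'' where 2: "\<epsilon>' \<in> Hfields" "torsion K'' g''"
    "\<forall>H'\<in>A - {H}. \<forall>x\<in>H'. g' H' x = lin (nrm H') (\<epsilon>' x) + \<alpha> x * g'' H' x" by blast
  let ?\<epsilon> = "\<lambda>x i. \<epsilon> x i + \<alpha> x ^ N * \<epsilon>' x i"
  have "?\<epsilon> \<in> Hfields"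
    using 1 2 by (intro Hfields_add Hfields_scale polyfun_power polyfun_lin)
  moreover have "g H' x = lin (nrm H') (?\<epsilon> x) + \<alpha> x ^ Suc N * g'' H' x" if "H' \<in> A - {H}" "x \<in> H'" for H' x
  proof -
    have "g H' x = lin (nrm H') (\<epsilon> x) + \<alpha> x ^ N * (lin (nrm H') (\<epsilon>' x) + \<alpha> x * g'' H' x)"
      using 1(3) 2(3) that by simp
    then show ?thesis unfolding lin_add lin_scale by (simp add: algebra_simps)
  qed
  ultimately show ?case using 2(2) by (intro exI [of _ ?\<epsilon>] exI [of _ g''] exI [of _ K''] conjI) blast+
qed

text \<open>The cokernel is graded and its degrees are bounded below, while every torsion class is
  divisible by \<open>\<alpha>\<close>; comparing components of low degree shows that it vanishes.\<close>

lemma torsion_vanishes: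
  assumes T: "torsion K g"
  shows "\<exists>\<epsilon>\<in>Hfields. \<forall>H'\<in>A - {H}. \<forall>x\<in>H'. g H' x = lin (nrm H') (\<epsilon> x)"
proof -
  have gp: "\<forall>H'\<in>A - {H}. g H' \<in> polyfun" using T by (simp add: torsion_def)
  then have "\<forall>H'\<in>A - {H}. \<exists>N. \<forall>d\<ge>N. \<forall>x. comp d (g H') x = 0" using comp_bounded by blast
  from bchoice [OF this] obtain N' where N': "\<forall>H'\<in>A - {H}. \<forall>d\<ge>N' H'. \<forall>x. comp d (g H') x = 0"
    by (rule exE)
  \<comment> \<open>The sum serves as a common degree bound that is meaningful even if
    \<open>H\<close> is the only hyperplane.\<close>
  define N where "N = (\<Sum>H'\<in>A - {H}. N' H')"
  have N: "comp d (g H') x = 0" if "H' \<in> A - {H}" "d \<ge> N" for H' d x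
  proof -
    have "N' H' \<le> N" unfolding N_def using that fin by (intro member_le_sum) auto
    with N' that show ?thesis by simp
  qed
  obtain \<epsilon> g' K' where \<epsilon>: "\<epsilon> \<in> Hfields" and T': "torsion K' g'"
    and eq: "\<forall>H'\<in>A - {H}. \<forall>x\<in>H'. g H' x = lin (nrm H') (\<epsilon> x) + \<alpha> x ^ N * g' H' x"
    using torsion_iterate [OF T, of N] by blast
  have pm: "polymap \<epsilon>" and tH: "\<And>x. \<epsilon> x \<in> H" using \<epsilon> by (auto simp: Hfields_def)
  \<comment> \<open>Truncation of \<open>\<epsilon>\<close> below degree \<open>N\<close>: there
    \<open>\<alpha> ^ N * g'\<close> contributes nothing, while \<open>g\<close> has no components
    from \<open>N\<close> on. The factor 1 fits the shape of \<open>polymap_sum\<close> and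
    \<open>subsp_sum\<close>.\<close>
  define \<eta> where "\<eta> x i = (\<Sum>d<N. 1 * vcomp d \<epsilon> x i)" for x i
  have "\<eta> \<in> Hfields"
    unfolding Hfields_def
  proof (intro CollectI conjI allI)
    show "polymap \<eta>" unfolding \<eta>_def [abs_def]
      by (rule polymap_sum) (auto intro: polyfun.const polymap_vcomp pm)
    show "\<eta> x \<in> H" for x unfolding \<eta>_def [abs_def]
      by (rule subsp_sum [OF H_subsp]) (use tangent_vcomp [OF pm hypl [OF HA] subsp_UNIV] tH in auto)
  qed
  moreover have "g H' x = lin (nrm H') (\<eta> x)" if H': "H' \<in> A - {H}" and x: "x \<in> H'" for H' x
  proof -
    have sub: "subsp H'" using H' hyperplane_subsp [OF hypl] by simp
    have g'p: "g' H' \<in> polyfun" using T' H' by (simp add: torsion_def)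
    have ap: "(\<lambda>x. \<alpha> x ^ N) \<in> polyfun" by (intro polyfun_intros)
    have "comp d (g H') x = lin (nrm H') (vcomp d \<epsilon> x)" if d: "d < N" for d
    proof -
      have "comp d (g H') x = comp d (\<lambda>x. lin (nrm H') (\<epsilon> x) + g' H' x * \<alpha> x ^ N) x"
        by (rule comp_cong [OF sub x]) (use eq H' in \<open>simp add: mult.commute\<close>)
      also have "\<dots> = comp d (\<lambda>x. lin (nrm H') (\<epsilon> x)) x + comp d (\<lambda>x. g' H' x * \<alpha> x ^ N) x"
        by (rule comp_add [OF lin_polymap [OF pm] polyfun.mult [OF g'p ap]])
      also have "comp d (\<lambda>x. g' H' x * \<alpha> x ^ N) x = 0"
        using d by (simp add: comp_mult_hom [OF g'p ap hom_lin_power])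
      finally show ?thesis by (simp add: lin_vcomp [OF pm])
    qed
    then have "(\<Sum>d<N. comp d (g H') x) = (\<Sum>d<N. lin (nrm H') (vcomp d \<epsilon> x))" by simp
    moreover have "(\<Sum>d<N. comp d (g H') x) = g H' x"
      using N [OF H'] gp H' by (intro sum_comp) auto
    moreover have "lin (nrm H') (\<eta> x) = (\<Sum>d<N. lin (nrm H') (vcomp d \<epsilon> x))"
      unfolding \<eta>_def [abs_def] by (simp add: lin_sum)
    ultimately show ?thesis by simp
  qed
  ultimately show ?thesis by blast
qed

text \<open>The connecting map of the snake lemma. An extension \<open>U\<close> of \<open>V\<close>
  with values in \<open>H\<close> has image divisible by \<alpha>; the quotient is torsion because
  \<open>y j ^ q\<close> times \<open>V\<close> lifts. As torsion vanishes, subtracting \<alpha>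
  times a field corrects \<open>U\<close> to a member of \<open>Mfields A H\<close>.\<close>

lemma restriction_onto: "restriction_onto"
  unfolding restriction_onto_def
proof
  fix V assume V: "V \<in> Nfields A H"
  let ?y = "\<lambda>j x. lin (y j) x"
  have pm: "polymap V" and t: "\<And>x. x \<in> H \<Longrightarrow> V x \<in> H" using V by (auto simp: Nfields_def)
  obtain U where U: "polymap U" "\<forall>x. U x \<in> H" "\<forall>x. V x \<in> H \<longrightarrow> U x = V x"
    by (rule project_H [OF pm])
  have UH: "U \<in> Hfields" using U by (simp add: Hfields_def)
  have "\<forall>H'\<in>A - {H}. \<exists>g. g \<in> polyfun \<and> (\<forall>x\<in>H'. lin (nrm H') (U x) = \<alpha> x * g x)"
  proof
    fix H' assume H': "H' \<in> A - {H}"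
    have sub: "subsp H'" using H' hyperplane_subsp [OF hypl] by simp
    obtain h where h: "\<forall>x\<in>H. lin (nrm H') (V x) = lin (nrm H') x ^ restr_mult A H (H' \<inter> H) * h x"
      using NfieldsE [OF V, of H'] H' by blast
    \<comment> \<open>\<open>H'\<close> is counted in its own multiplicity, so the exponent is
      positive and the form of \<open>H'\<close> vanishes on \<open>V\<close> along the
      trace.\<close>
    have "H' \<in> {H'' \<in> A - {H}. H'' \<inter> H = H' \<inter> H}" using H' by simp
    then have m: "restr_mult A H (H' \<inter> H) > 0"
      unfolding restr_mult_def using fin by (auto simp: card_gt_0_iff)
    have "\<exists>g\<in>polyfun. \<forall>x\<in>H'. lin (nrm H') (U x) = \<alpha> x * g x"
    proof (rule lin_dvd [OF sub lin_polymap [OF U(1)]])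
      fix x assume x: "x \<in> H'" "\<alpha> x = 0"
      then have "lin (nrm H') x = 0" "x \<in> H" using H' in_hyp_iff [OF hypl, of H'] H_iff by auto
      with h m U(3) t show "lin (nrm H') (U x) = 0" by simp
    qed
    then show "\<exists>g. g \<in> polyfun \<and> (\<forall>x\<in>H'. lin (nrm H') (U x) = \<alpha> x * g x)" by blast
  qed
  from bchoice [OF this] obtain g where
    g: "\<forall>H'\<in>A - {H}. g H' \<in> polyfun \<and> (\<forall>x\<in>H'. lin (nrm H') (U x) = \<alpha> x * g H' x)" by (rule exE)
  have "torsion q g"
    unfolding torsion_def
  proof (intro conjI ballI)
    show "g H' \<in> polyfun" if "H' \<in> A - {H}" for H' using g that by blast
    fix j :: nat assume j: "j \<in> {..<3}"
    then have "lifts (\<lambda>x i. ?y j x ^ q * V x i)" using lq [OF V] by simp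
    then obtain m where m: "m \<in> Mfields A H" "\<forall>x\<in>H. \<forall>i. m x i = ?y j x ^ q * V x i" by (rule liftsE)
    have "(\<lambda>x i. ?y j x ^ q * U x i - m x i) \<in> Hfields"
      using UH Mfields_H [OF m(1)] by (intro Hfields_diff Hfields_scale polyfun_power polyfun_lin)
    then obtain b where b: "b \<in> Hfields" "\<forall>x i. ?y j x ^ q * U x i - m x i = \<alpha> x * b x i"
      by (rule Hfields_divide_alpha) (use m U t in auto)
    have bp: "polymap b" using b by (simp add: Hfields_def)
    have "lin (nrm H') (b x) = ?y j x ^ q * g H' x" if H': "H' \<in> A - {H}" and x: "x \<in> H'" for H' x
    proof -
      have "?y j x ^ q * g H' x - lin (nrm H') (b x) = 0"
      proof (rule zero_div_alpha [of H' "\<lambda>x. ?y j x ^ q * g H' x - lin (nrm H') (b x)"])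
        show "(\<lambda>x. ?y j x ^ q * g H' x - lin (nrm H') (b x)) \<in> polyfun"
          using g H' lin_polymap [OF bp] by (intro polyfun_diff polyfun.mult polyfun_power polyfun_lin) auto
        fix x assume x: "x \<in> H'"
        have "(\<lambda>i. ?y j x ^ q * U x i - m x i) = (\<lambda>i. \<alpha> x * b x i)" using b by auto
        then have "lin (nrm H') (\<lambda>i. ?y j x ^ q * U x i - m x i) = lin (nrm H') (\<lambda>i. \<alpha> x * b x i)" by simp
        moreover have "lin (nrm H') (m x) = 0" using Mfields_tangent [OF m(1), of H' x] H' x by simp
        moreover have "lin (nrm H') (U x) = \<alpha> x * g H' x" using g H' x by blast
        ultimately show "\<alpha> x * (?y j x ^ q * g H' x - lin (nrm H') (b x)) = 0"
          unfolding lin_diff lin_scale by (simp add: algebra_simps)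
      qed (use H' x in auto)
      then show ?thesis by simp
    qed
    with b show "\<exists>\<delta>. \<delta> \<in> Hfields \<and> (\<forall>H'\<in>A - {H}. \<forall>x\<in>H'. lin (nrm H') (\<delta> x) = ?y j x ^ q * g H' x)"
      by (intro exI [of _ b]) blast
  qed
  from torsion_vanishes [OF this] obtain \<epsilon> where
    \<epsilon>: "\<epsilon> \<in> Hfields" "\<forall>H'\<in>A - {H}. \<forall>x\<in>H'. g H' x = lin (nrm H') (\<epsilon> x)" by blast
  have "(\<lambda>x i. U x i - \<alpha> x * \<epsilon> x i) \<in> Mfields A H"
  proof (rule MfieldsI_H)
    show "(\<lambda>x i. U x i - \<alpha> x * \<epsilon> x i) \<in> Hfields"
      using UH \<epsilon>(1) by (intro Hfields_diff Hfields_scale polyfun_lin)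
    show "lin (nrm H') (\<lambda>i. U x i - \<alpha> x * \<epsilon> x i) = 0" if "H' \<in> A - {H}" "x \<in> H'" for H' x
      unfolding lin_diff lin_scale using g \<epsilon>(2) that by simp
  qed
  then show "lifts V" by (rule liftsI) (use U t H_iff in auto)
qed

end

section \<open>Lifting a homogeneous basis\<close>

context arr
begin

lemma comp_hom_self: "h \<in> polyfun \<Longrightarrow> hom d h \<Longrightarrow> comp d h x = h x"
  using comp_mult_hom [OF polyfun.const [of 1], of h d d x] by (simp add: comp_const)

text \<open>Homogeneous generators of \<open>Nfields A H\<close> lift to homogeneous members of
  \<open>Mfields A H\<close>, which generate modulo \<alpha> and, by iteration, modulo every power
  of \<alpha>; comparing degrees makes this exact. The Euler field completes the count from
  \<open>?n - 1\<close> to \<open>?n\<close>.\<close>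

lemma restriction_onto_imp_free:
  assumes onto: restriction_onto
    and gen: "generated_by H (card (UNIV :: 'n set) - 1) (Nfields A H)"
  shows "free_arrangement A"
proof -
  let ?n = "card (UNIV :: 'n set)"
  obtain e where e: "\<forall>k<?n - 1. e k \<in> Nfields A H" and sp: "spans H {..<?n - 1} e (Nfields A H)"
    using gen by (auto simp: generated_by_def)
  have one: "(\<lambda>_. 1) \<in> polyfun" "(\<lambda>_. 1 :: 'k) (\<lambda>_ :: 'n. 0 :: 'k) \<noteq> 0" by (auto intro: polyfun.const)
  have pmN: "polymap V" if "V \<in> Nfields A H" for V using that by (simp add: Nfields_def)
  have ek: "e k \<in> Nfields A H" if "k < ?n - 1" for k using e that by blast
  have genN: "\<exists>c. (\<forall>k<?n - 1. c k \<in> polyfun) \<and> (\<forall>x\<in>H. \<forall>i. 1 * V x i = (\<Sum>k<?n - 1. c k x * e k x i))"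
    if V: "V \<in> Nfields A H" for V
  proof -
    obtain c where "\<forall>k\<in>{..<?n - 1}. c k \<in> polyfun" "\<forall>x\<in>H. \<forall>i. V x i = (\<Sum>k\<in>{..<?n - 1}. c k x * e k x i)"
      by (rule spansE [OF sp V])
    then show ?thesis by (intro exI [of _ c]) simp
  qed
  obtain J :: "(nat \<times> nat) set" and h0 deg where J: "finite J" "\<forall>j\<in>J. h0 j \<in> Nfields A H"
    "\<forall>j\<in>J. \<forall>i. hom (deg j) (\<lambda>x. h0 j x i)" "spans H J h0 (Nfields A H)"
    "minimal_gens H J h0" "card J \<le> ?n - 1"
    by (rule homogeneous_generators [OF H_subsp pmN Nfields_vcomp ek one genN])
  have "\<forall>j\<in>J. \<exists>m. m \<in> Mfields A H \<and> (\<forall>x\<in>H. \<forall>i. m x i = h0 j x i)"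
    using onto J(2) unfolding restriction_onto_def lifts_def Bex_def by simp
  from bchoice [OF this] obtain m where m: "\<forall>j\<in>J. m j \<in> Mfields A H \<and> (\<forall>x\<in>H. \<forall>i. m j x i = h0 j x i)"
    by (rule exE)
  \<comment> \<open>A lift of a homogeneous field need not be homogeneous; its component of the same
    degree is again a lift.\<close>
  define h where "h j = vcomp (deg j) (m j)" for j
  have hM: "h j \<in> Mfields A H" if "j \<in> J" for j using m that by (simp add: h_def Mfields_vcomp)
  have hp: "(\<lambda>x. h j x i) \<in> polyfun" if "j \<in> J" for j i
    using Mfields_polymap [OF hM [OF that]] by (simp add: polymap_def)
  have hh: "hom (deg j) (\<lambda>x. h j x i)" if "j \<in> J" for j i
    using m that Mfields_polymap by (simp add: h_def vcomp_def hom_comp polymap_def)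
  have hH: "h j x i = h0 j x i" if j: "j \<in> J" and x: "x \<in> H" for j x i
  proof -
    have "h j x i = comp (deg j) (\<lambda>x. h0 j x i) x"
      unfolding h_def vcomp_def by (rule comp_cong [OF H_subsp x]) (use m j in auto)
    also have "\<dots> = h0 j x i"
      by (rule comp_hom_self) (use J j pmN in \<open>auto simp: polymap_def\<close>)
    finally show ?thesis .
  qed
  have iter: "\<exists>c g. (\<forall>j\<in>J. c j \<in> polyfun) \<and> g \<in> Mfields A H \<and>
      (\<forall>x i. V x i = (\<Sum>j\<in>J. c j x * h j x i) + \<alpha> x ^ N * g x i)" if V: "V \<in> Mfields A H" for V N
  proof (induction N)
    case 0
    show ?case by (rule exI [of _ "\<lambda>_ _. 0"], rule exI [of _ V]) (use V in \<open>auto intro: polyfun.const\<close>)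
  next
    case (Suc N)
    then obtain c g where c: "\<forall>j\<in>J. c j \<in> polyfun" and g: "g \<in> Mfields A H"
      and eq: "\<forall>x i. V x i = (\<Sum>j\<in>J. c j x * h j x i) + \<alpha> x ^ N * g x i" by blast
    obtain d where d: "\<forall>j\<in>J. d j \<in> polyfun" "\<forall>x\<in>H. \<forall>i. g x i = (\<Sum>j\<in>J. d j x * h0 j x i)"
      by (rule spansE [OF J(4) Mfields_subset_Nfields [OF g]])
    have "(\<lambda>x i. g x i - (\<Sum>j\<in>J. d j x * h j x i)) \<in> Mfields A H"
      using d hM g by (intro Mfields_diff Mfields_sum) auto
    then obtain g' where g': "g' \<in> Mfields A H" "\<forall>x i. g x i - (\<Sum>j\<in>J. d j x * h j x i) = \<alpha> x * g' x i"
      by (rule Mfields_divide_alpha) (use d hH in \<open>auto simp: fun_eq_iff\<close>)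
    let ?c = "\<lambda>j x. c j x + \<alpha> x ^ N * d j x"
    have "\<forall>j\<in>J. ?c j \<in> polyfun" using c d by (intro ballI polyfun_intros) auto
    moreover have "V x i = (\<Sum>j\<in>J. ?c j x * h j x i) + \<alpha> x ^ Suc N * g' x i" for x i
    proof -
      have "g x i = (\<Sum>j\<in>J. d j x * h j x i) + \<alpha> x * g' x i"
        using g'(2) by (simp add: algebra_simps)
      then have "V x i = (\<Sum>j\<in>J. c j x * h j x i) + \<alpha> x ^ N * ((\<Sum>j\<in>J. d j x * h j x i) + \<alpha> x * g' x i)"
        using eq by simp
      then show ?thesis by (simp add: distrib_right distrib_left sum.distrib sum_distrib_left mult_ac)
    qed
    ultimately show ?case using g'(1) by (intro exI [of _ ?c] exI [of _ g'] conjI) blast+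
  qed
  have spM: "\<exists>c. (\<forall>j\<in>J. c j \<in> polyfun) \<and> (\<forall>x i. V x i = (\<Sum>j\<in>J. c j x * h j x i))"
    if V: "V \<in> Mfields A H" for V
  proof -
    have Vp: "(\<lambda>x. V x i) \<in> polyfun" for i using Mfields_polymap [OF V] by (simp add: polymap_def)
    obtain N where N: "\<forall>d\<ge>N. \<forall>x i. vcomp d V x i = 0" using vcomp_bounded [OF Mfields_polymap [OF V]] by blast
    obtain c g where c: "\<forall>j\<in>J. c j \<in> polyfun" and g: "g \<in> Mfields A H"
      and eq: "\<forall>x i. V x i = (\<Sum>j\<in>J. c j x * h j x i) + \<alpha> x ^ N * g x i" using iter [OF V, of N] by blast
    \<comment> \<open>Coefficients cut down so that the combination keeps exactly its components of
      degree below \<open>N\<close>; the guard stops truncated subtraction from adding spurious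
      constant terms.\<close>
    let ?q = "\<lambda>d j x. if d < deg j then 0 else comp (d - deg j) (c j) x"
    let ?c = "\<lambda>j x. \<Sum>d<N. ?q d j x"
    have cp: "\<forall>j\<in>J. ?c j \<in> polyfun"
    proof (intro ballI polyfun_sum)
      fix j d assume "j \<in> J"
      then show "?q d j \<in> polyfun" using c by (cases "d < deg j") (auto intro: polyfun.const comp_polyfun)
    qed
    have ap: "(\<lambda>x. \<alpha> x ^ N) \<in> polyfun" by (intro polyfun_intros)
    have gp: "(\<lambda>x. g x i) \<in> polyfun" for i using Mfields_polymap [OF g] by (simp add: polymap_def)
    have "V x i = (\<Sum>j\<in>J. ?c j x * h j x i)" for x i
    proof -
      have "comp d (\<lambda>x. V x i) x = (\<Sum>j\<in>J. ?q d j x * h j x i)" if d: "d < N" for d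
      proof -
        have chp: "(\<lambda>x. c j x * h j x i) \<in> polyfun" if "j \<in> J" for j
          using c hp that by (intro polyfun.mult) auto
        have "comp d (\<lambda>x. V x i) x = comp d (\<lambda>x. (\<Sum>j\<in>J. c j x * h j x i) + g x i * \<alpha> x ^ N) x"
          using eq by (simp add: mult.commute)
        also have "\<dots> = comp d (\<lambda>x. \<Sum>j\<in>J. c j x * h j x i) x + comp d (\<lambda>x. g x i * \<alpha> x ^ N) x"
          by (rule comp_add [OF polyfun_sum [OF chp] polyfun.mult [OF gp ap]])
        also have "comp d (\<lambda>x. g x i * \<alpha> x ^ N) x = 0"
          using d by (simp add: comp_mult_hom [OF gp ap hom_lin_power])
        also have "comp d (\<lambda>x. \<Sum>j\<in>J. c j x * h j x i) x = (\<Sum>j\<in>J. comp d (\<lambda>x. c j x * h j x i) x)"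
          using chp by (rule comp_sum)
        also have "\<dots> = (\<Sum>j\<in>J. ?q d j x * h j x i)"
        proof (rule sum.cong [OF refl])
          fix j assume j: "j \<in> J"
          show "comp d (\<lambda>x. c j x * h j x i) x = ?q d j x * h j x i"
            by (subst comp_mult_hom [OF _ hp [OF j] hh [OF j]]) (use c j in auto)
        qed
        finally show ?thesis by simp
      qed
      then have "(\<Sum>d<N. comp d (\<lambda>x. V x i) x) = (\<Sum>d<N. \<Sum>j\<in>J. ?q d j x * h j x i)" by simp
      also have "\<dots> = (\<Sum>j\<in>J. ?c j x * h j x i)"
        unfolding sum_distrib_right by (rule sum.swap)
      also have "(\<Sum>d<N. comp d (\<lambda>x. V x i) x) = V x i"
        by (rule sum_comp [OF Vp]) (use N in \<open>simp add: vcomp_def\<close>)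
      finally show ?thesis .
    qed
    with cp show ?thesis by (intro exI [of _ ?c] conjI allI)
  qed
  define I where "I = insert None (Some ` J)"
  define k where "k j = (case j of None \<Rightarrow> (\<lambda>x. x) | Some j \<Rightarrow> h j)" for j
  have I: "finite I" "card I \<le> ?n"
  proof -
    show "finite I" using J(1) by (simp add: I_def)
    have "card I = Suc (card J)" using J(1) by (simp add: I_def card_image)
    moreover have "?n > 0" by (simp add: card_gt_0_iff)
    ultimately show "card I \<le> ?n" using J(6) by linarith
  qed
  show ?thesis
    unfolding free_arrangement_iff
  proof (rule generated_byI [OF I _ Dfields_zero, of k])
    show "k j \<in> Dfields A" if "j \<in> I" for j
      using that hM Mfields_D Euler_Dfields by (auto simp: I_def k_def)
    show "spans UNIV I k (Dfields A)"
    proof (rule spansI)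
      fix V assume V: "V \<in> Dfields A"
      obtain r where r: "r \<in> polyfun" "\<forall>x. \<alpha> (V x) = \<alpha> x * r x" by (rule Dfields_alpha [OF V])
      obtain c where c: "\<forall>j\<in>J. c j \<in> polyfun"
        "\<forall>x i. V x i - r x * x i = (\<Sum>j\<in>J. c j x * h j x i)"
        using spM [OF Euler_projection [OF V r]] by blast
      let ?c = "\<lambda>j. case j of None \<Rightarrow> r | Some j \<Rightarrow> c j"
      have "\<forall>j\<in>I. ?c j \<in> polyfun" using r c by (auto simp: I_def)
      moreover have "V x i = (\<Sum>j\<in>I. ?c j x * k j x i)" for x i
      proof -
        have "(\<Sum>j\<in>I. ?c j x * k j x i) = r x * x i + (\<Sum>j\<in>J. c j x * h j x i)"
          using J(1) by (simp add: I_def k_def sum.reindex)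
        with c(2) show ?thesis by (metis add_diff_cancel_left' diff_add_cancel add.commute)
      qed
      ultimately show "\<exists>c. (\<forall>j\<in>I. c j \<in> polyfun) \<and> (\<forall>x\<in>UNIV. \<forall>i. V x i = (\<Sum>j\<in>I. c j x * k j x i))"
        by (intro exI [of _ ?c] conjI) auto
    qed
  qed
qed

end

section \<open>Three independent coordinates on \<open>H\<close> and the conclusion\<close>

lemma lin_unit: "lin (\<lambda>i. if i = s then 1 else 0) x = x s"
  by (simp add: lin_def if_distrib [of "\<lambda>y. y * _"] cong: if_cong)

text \<open>On \<open>H\<close> the coordinates other than a suitable \<open>i0\<close> are
  independent, and dimension at least 4 leaves three of them. The vectors \<open>hyp_dir\<close>
  witness the nonvanishing conditions, and the exponent \<open>card (A - {H})\<close> is the one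
  provided by \<open>lifts_power\<close>.\<close>

lemma (in arr) triple_arr_exists:
  assumes card: "card (UNIV :: 'n set) \<ge> 4" and loc: "locally_free_along A H"
    and gen: "generated_by H (card (UNIV :: 'n set) - 1) (Nfields A H)"
  shows "\<exists>y q. triple_arr A H y q"
proof -
  obtain i0 where cs: "coord_space H (UNIV - {i0}) (hyp_dir (nrm H) i0)" using coord_space_H by blast
  have "card (UNIV - {i0}) \<ge> 3" using card by simp
  then obtain S where S: "S \<subseteq> UNIV - {i0}" "card S = 3" by (rule obtain_subset_with_card_n)
  then obtain s0 s1 s2 where s: "S = {s0, s1, s2}" "s0 \<noteq> s1" "s0 \<noteq> s2" "s1 \<noteq> s2"
    by (auto simp: card_3_iff)
  then have i0: "s0 \<noteq> i0" "s1 \<noteq> i0" "s2 \<noteq> i0" using S by auto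
  define s where "s j = (if j = 0 then s0 else if j = 1 then s1 else s2)" for j :: nat
  define y where "y j = (\<lambda>i. if i = s j then 1 else 0 :: 'k)" for j
  have yl: "lin (y j) x = x (s j)" for j x unfolding y_def by (rule lin_unit)
  have w: "hyp_dir (nrm H) i0 t \<in> H" if "t \<noteq> i0" for t
    using coord_space.w_in [OF cs] that by simp
  have "triple_arr A H y (card (A - {H}))"
  proof unfold_locales
    show "\<exists>x\<in>H. lin (y 0) x \<noteq> 0"
      by (rule bexI [OF _ w [OF i0(1)]]) (simp add: yl s_def hyp_dir_def)
    show "\<exists>x\<in>H. lin (y 0) x = 0 \<and> lin (y 1) x \<noteq> 0"
      by (rule bexI [OF _ w [OF i0(2)]]) (use s(2-) i0 in \<open>auto simp: yl s_def hyp_dir_def\<close>)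
    show "\<exists>x\<in>H. lin (y 0) x = 0 \<and> lin (y 1) x = 0 \<and> lin (y 2) x \<noteq> 0"
      by (rule bexI [OF _ w [OF i0(3)]]) (use s(2-) i0 in \<open>auto simp: yl s_def hyp_dir_def\<close>)
    show "lifts (\<lambda>x i. lin (y j) x ^ card (A - {H}) * V x i)" if "V \<in> Nfields A H" for V j
      unfolding yl by (rule lifts_power [OF loc that])
  qed (rule gen)
  then show ?thesis by blast
qed

theorem mainTheorem8:
  fixes A :: "('n::finite \<Rightarrow> 'k::field_char_0) set set"
    and H :: "('n \<Rightarrow> 'k) set"
    and l :: nat
  assumes "card (UNIV :: 'n set) = l + 1"
    and "l \<ge> 3"
    and "is_central_arrangement A"
    and "H \<in> A"
  shows "free_arrangement A \<longleftrightarrow>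
           (locally_free_along A H \<and> free_restricted_multiarrangement A H)"
proof -
  interpret arr A H by unfold_locales fact+
  show ?thesis
  proof
    assume free: "free_arrangement A"
    then have "locally_free_along A H"
      using free_localization by (auto simp: locally_free_along_def)
    with free_imp_restriction_generated [OF free]
    show "locally_free_along A H \<and> free_restricted_multiarrangement A H"
      by (simp add: free_restricted_iff)
  next
    assume "locally_free_along A H \<and> free_restricted_multiarrangement A H"
    then have loc: "locally_free_along A H"
      and gen: "generated_by H (card (UNIV :: 'n set) - 1) (Nfields A H)"
      by (simp_all add: free_restricted_iff)
    obtain y q where "triple_arr A H y q"
      using triple_arr_exists [OF _ loc gen] assms by auto
    then have restriction_onto by (rule triple_arr.restriction_onto)
    then show "free_arrangement A" using gen by (rule restriction_onto_imp_free)
  qed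
qed

end
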